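(* Let $\mathcal{B}=\bigoplus_{i\ge0}\mathcal{B}_i$ be the Hopf algebra of binary delta-matroids and $\mathcal{B}^e$ its Hopf subalgebra spanned by even binary delta-matroids. Define $\mathcal{FB}_i=\mathcal{B}_i/\langle D-D'_{ab}-\widetilde D_{ab}+(\widetilde D_{ab})'_{ab}\rangle$ and $\mathcal{FB}^e_i=\mathcal{B}^e_i/\langle D-D'_{ab}-\widetilde D_{ab}+(\widetilde D_{ab})'_{ab}\rangle$, where the relations range over all (respectively, all even) binary delta-matroids $D$ with $i$-element ground set $E$ and all distinct $a,b\in E$, and set $\mathcal{FB}=\bigoplus_i\mathcal{FB}_i$, $\mathcal{FB}^e=\bigoplus_i\mathcal{FB}^e_i$. Then the multiplication and comultiplication of $\mathcal{B}$ induce on $\mathcal{FB}$ and on $\mathcal{FB}^e$ structures of graded commutative cocommutative Hopf algebras.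
   Context: Set system $(E;\Phi)$: finite $E$, nonempty $\Phi\subseteq2^E$, up to isomorphism. Twist $D*E'=(E;\{\phi\Delta E'\mid\phi\in\Phi\})$. A binary delta-matroid is a set system isomorphic to a twist of the nondegeneracy delta-matroid of a framed graph (simple graph with framing $V\to\{0,1\}$, $\mathbb{F}_2$-adjacency matrix with framing on the diagonal; feasible sets are vertex subsets with nondegenerate induced adjacency matrix over $\mathbb{F}_2$, including $\emptyset$). Even: all feasible sets have the same parity of cardinality. $\mathcal{B}_i$ is the complex vector space freely spanned by binary delta-matroids with $i$-element ground set; multiplication is direct sum $(E_1;\Phi_1)(E_2;\Phi_2)=(E_1\sqcup E_2;\{\phi_1\sqcup\phi_2\})$ with unit $(\emptyset;\{\emptyset\})$; comultiplication $\mu(D)=\sum_{E'\subseteq E}D_{E'}\otimes D_{E\setminus E'}$, where $D_{E'}$ is the restriction (deletion of all elements of $E\setminus E'$; deletion of non-coloop $e$: $(E\setminus\{e\};\{\phi\in\Phi\mid e\notin\phi\})$; deletion of a coloop $e$ (an element in every feasible set) means contraction $(E\setminus\{e\};\{\phi\setminus\{e\}\mid e\in\phi\in\Phi\})$); counit is the identification $\mathcal{B}_0\cong\mathbb{C}$ and zero in positive degrees. Sliding: $\widetilde D_{ab}=(E;\Phi\,\Delta\,\{\phi\sqcup\{a\}\mid\phi\subseteq E\setminus\{a,b\},\ \phi\sqcup\{b\}\in\Phi\})$; exchange: $D'_{ab}=\big(\widetilde{(D*\{b\})}_{ab}\big)*\{b\}$. *)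

theory Defs
  imports Complex_Main "HOL-Combinatorics.Permutations"
begin

type_synonym ss = "nat \<times> nat set set"

definition symd :: "'a set \<Rightarrow> 'a set \<Rightarrow> 'a set" where
  "symd A B = (A - B) \<union> (B - A)"

definition wf_ss :: "ss \<Rightarrow> bool" where
  "wf_ss D \<longleftrightarrow> snd D \<noteq> {} \<and> (\<forall>\<phi>\<in>snd D. \<phi> \<subseteq> {..<fst D})"

definition iso_ss :: "ss \<Rightarrow> ss \<Rightarrow> bool" where
  "iso_ss D D' \<longleftrightarrow> fst D = fst D' \<and>
     (\<exists>\<sigma>. \<sigma> permutes {..<fst D} \<and> snd D' = (\<lambda>\<phi>. \<sigma> ` \<phi>) ` snd D)"

definition twist :: "nat set \<Rightarrow> ss \<Rightarrow> ss" where
  "twist X D = (fst D, (\<lambda>\<phi>. symd \<phi> X) ` snd D)"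

definition framed_graph :: "nat set \<Rightarrow> (nat \<Rightarrow> nat \<Rightarrow> bool) \<Rightarrow> bool" where
  "framed_graph W adj \<longleftrightarrow> finite W \<and> (\<forall>i j. adj i j = adj j i) \<and> (\<forall>i. \<not> adj i i)"

definition fg_matrix :: "(nat \<Rightarrow> nat \<Rightarrow> bool) \<Rightarrow> (nat \<Rightarrow> bool) \<Rightarrow> nat \<Rightarrow> nat \<Rightarrow> bool" where
  "fg_matrix adj fr i j = (if i = j then fr i else adj i j)"

text \<open>Nondegeneracy over F_2 of the principal submatrix on phi: its determinant over F_2,
  i.e. the Leibniz sum (signs are irrelevant mod 2), is 1.\<close>

definition nondeg_F2 :: "(nat \<Rightarrow> nat \<Rightarrow> bool) \<Rightarrow> nat set \<Rightarrow> bool" where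
  "nondeg_F2 M \<phi> \<longleftrightarrow> odd (card {\<sigma>. \<sigma> permutes \<phi> \<and> (\<forall>i\<in>\<phi>. M i (\<sigma> i))})"

definition nondeg_dm :: "nat set \<Rightarrow> (nat \<Rightarrow> nat \<Rightarrow> bool) \<Rightarrow> (nat \<Rightarrow> bool) \<Rightarrow> nat set set" where
  "nondeg_dm W adj fr = {\<phi>. \<phi> \<subseteq> W \<and> nondeg_F2 (fg_matrix adj fr) \<phi>}"

definition binary_dm :: "ss \<Rightarrow> bool" where
  "binary_dm D \<longleftrightarrow> wf_ss D \<and>
     (\<exists>W adj fr X f. framed_graph W adj \<and> X \<subseteq> W \<and> bij_betw f W {..<fst D} \<and>
        snd D = (\<lambda>\<phi>. f ` \<phi>) ` ((\<lambda>\<phi>. symd \<phi> X) ` nondeg_dm W adj fr))"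

definition even_ss :: "ss \<Rightarrow> bool" where
  "even_ss D \<longleftrightarrow> (\<forall>\<phi>\<in>snd D. \<forall>\<psi>\<in>snd D. even (card \<phi>) = even (card \<psi>))"

definition dsum :: "ss \<Rightarrow> ss \<Rightarrow> ss" where
  "dsum D1 D2 = (fst D1 + fst D2,
     {\<phi>1 \<union> (\<lambda>x. x + fst D1) ` \<phi>2 | \<phi>1 \<phi>2. \<phi>1 \<in> snd D1 \<and> \<phi>2 \<in> snd D2})"

definition unit_ss :: ss where "unit_ss = (0, {{}})"

text \<open>Deletion of an element e (contraction if e is a coloop), on set systems with an
  arbitrary ground set E.\<close>

definition del :: "nat \<Rightarrow> nat set \<times> nat set set \<Rightarrow> nat set \<times> nat set set" where
  "del e G = (fst G - {e},
     if (\<forall>\<phi>\<in>snd G. e \<in> \<phi>) then (\<lambda>\<phi>. \<phi> - {e}) ` snd G else {\<phi>\<in>snd G. e \<notin> \<phi>})"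

definition relabel :: "nat set \<Rightarrow> nat \<Rightarrow> nat" where
  "relabel A x = card {y\<in>A. y < x}"

definition restr :: "nat set \<Rightarrow> ss \<Rightarrow> ss" where
  "restr E' D = (let G = foldr del (sorted_list_of_set ({..<fst D} - E')) ({..<fst D}, snd D)
                 in (card E', (\<lambda>\<phi>. relabel E' ` \<phi>) ` snd G))"

definition slide :: "nat \<Rightarrow> nat \<Rightarrow> ss \<Rightarrow> ss" where
  "slide a b D = (fst D, symd (snd D)
      {\<phi> \<union> {a} | \<phi>. \<phi> \<subseteq> {..<fst D} - {a, b} \<and> \<phi> \<union> {b} \<in> snd D})"

definition exch :: "nat \<Rightarrow> nat \<Rightarrow> ss \<Rightarrow> ss" where
  "exch a b D = twist {b} (slide a b (twist {b} D))"

definition supp :: "('a \<Rightarrow> complex) \<Rightarrow> 'a set" where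
  "supp v = {x. v x \<noteq> 0}"

definition bv :: "'a \<Rightarrow> 'a \<Rightarrow> complex" where
  "bv a = (\<lambda>x. if x = a then 1 else 0)"

definition scal :: "complex \<Rightarrow> ('a \<Rightarrow> complex) \<Rightarrow> 'a \<Rightarrow> complex" where
  "scal c v = (\<lambda>x. c * v x)"

definition vadd :: "('a \<Rightarrow> complex) \<Rightarrow> ('a \<Rightarrow> complex) \<Rightarrow> 'a \<Rightarrow> complex" where
  "vadd v w = (\<lambda>x. v x + w x)"

definition vsub :: "('a \<Rightarrow> complex) \<Rightarrow> ('a \<Rightarrow> complex) \<Rightarrow> 'a \<Rightarrow> complex" where
  "vsub v w = (\<lambda>x. v x - w x)"

definition vsum :: "('i \<Rightarrow> 'a \<Rightarrow> complex) \<Rightarrow> 'i set \<Rightarrow> 'a \<Rightarrow> complex" where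
  "vsum f I = (\<lambda>x. \<Sum>i\<in>I. f i x)"

definition cspan :: "('a \<Rightarrow> complex) set \<Rightarrow> ('a \<Rightarrow> complex) set" where
  "cspan S = {v. \<exists>F c. finite F \<and> F \<subseteq> S \<and> v = vsum (\<lambda>u. scal (c u) u) F}"

definition fsupp_on :: "'a set \<Rightarrow> ('a \<Rightarrow> complex) set" where
  "fsupp_on A = {v. finite (supp v) \<and> supp v \<subseteq> A}"

definition tens :: "('a \<Rightarrow> complex) \<Rightarrow> ('b \<Rightarrow> complex) \<Rightarrow> 'a \<times> 'b \<Rightarrow> complex" where
  "tens v w = (\<lambda>(a, b). v a * w b)"

definition tens3 :: "('a \<Rightarrow> complex) \<Rightarrow> ('a \<Rightarrow> complex) \<Rightarrow> ('a \<Rightarrow> complex)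
                      \<Rightarrow> 'a \<times> 'a \<times> 'a \<Rightarrow> complex" where
  "tens3 u v w = (\<lambda>(a, b, c). u a * v b * w c)"

definition linext :: "('a \<Rightarrow> 'b \<Rightarrow> complex) \<Rightarrow> ('a \<Rightarrow> complex) \<Rightarrow> 'b \<Rightarrow> complex" where
  "linext f v = vsum (\<lambda>a. scal (v a) (f a)) (supp v)"

definition mult :: "(ss \<Rightarrow> complex) \<Rightarrow> (ss \<Rightarrow> complex) \<Rightarrow> ss \<Rightarrow> complex" where
  "mult x y = linext (\<lambda>a. linext (\<lambda>b. bv (dsum a b)) y) x"

definition unitv :: "ss \<Rightarrow> complex" where "unitv = bv unit_ss"

definition comult_b :: "ss \<Rightarrow> ss \<times> ss \<Rightarrow> complex" where
  "comult_b D = vsum (\<lambda>E'. tens (bv (restr E' D)) (bv (restr ({..<fst D} - E') D))) (Pow {..<fst D})"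

definition comult :: "(ss \<Rightarrow> complex) \<Rightarrow> ss \<times> ss \<Rightarrow> complex" where
  "comult x = linext comult_b x"

definition counit :: "(ss \<Rightarrow> complex) \<Rightarrow> complex" where
  "counit x = x unit_ss"

definition mtens :: "(ss \<times> ss \<Rightarrow> complex) \<Rightarrow> ss \<Rightarrow> complex" where
  "mtens t = linext (\<lambda>p. bv (dsum (fst p) (snd p))) t"

definition tmult :: "(ss \<times> ss \<Rightarrow> complex) \<Rightarrow> (ss \<times> ss \<Rightarrow> complex) \<Rightarrow> ss \<times> ss \<Rightarrow> complex" where
  "tmult s t = linext (\<lambda>p. linext (\<lambda>q.
       tens (bv (dsum (fst p) (fst q))) (bv (dsum (snd p) (snd q)))) t) s"

definition tswap :: "('a \<times> 'a \<Rightarrow> complex) \<Rightarrow> 'a \<times> 'a \<Rightarrow> complex" where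
  "tswap t = (\<lambda>(a, b). t (b, a))"

definition tmap :: "((ss \<Rightarrow> complex) \<Rightarrow> ss \<Rightarrow> complex) \<Rightarrow> ((ss \<Rightarrow> complex) \<Rightarrow> ss \<Rightarrow> complex)
                    \<Rightarrow> (ss \<times> ss \<Rightarrow> complex) \<Rightarrow> ss \<times> ss \<Rightarrow> complex" where
  "tmap f g t = linext (\<lambda>p. tens (f (bv (fst p))) (g (bv (snd p)))) t"

definition comult_l :: "(ss \<times> ss \<Rightarrow> complex) \<Rightarrow> ss \<times> ss \<times> ss \<Rightarrow> complex" where
  "comult_l t = linext (\<lambda>p. linext (\<lambda>q. tens3 (bv (fst q)) (bv (snd q)) (bv (snd p)))
                                   (comult_b (fst p))) t"

definition comult_r :: "(ss \<times> ss \<Rightarrow> complex) \<Rightarrow> ss \<times> ss \<times> ss \<Rightarrow> complex" where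
  "comult_r t = linext (\<lambda>p. linext (\<lambda>q. tens3 (bv (fst p)) (bv (fst q)) (bv (snd q)))
                                   (comult_b (snd p))) t"

definition counit_l :: "(ss \<times> ss \<Rightarrow> complex) \<Rightarrow> ss \<Rightarrow> complex" where
  "counit_l t = linext (\<lambda>p. scal (counit (bv (fst p))) (bv (snd p))) t"

definition counit_r :: "(ss \<times> ss \<Rightarrow> complex) \<Rightarrow> ss \<Rightarrow> complex" where
  "counit_r t = linext (\<lambda>p. scal (counit (bv (snd p))) (bv (fst p))) t"

definition hcomp :: "nat \<Rightarrow> (ss \<Rightarrow> complex) \<Rightarrow> ss \<Rightarrow> complex" where
  "hcomp k v = (\<lambda>D. if fst D = k then v D else 0)"

text \<open>Given the space V (finitely supported vectors on a set A of labelled set systems) and a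
  subspace J, hopf_quotient A J says: V is closed under the operations, J is a graded
  two-sided ideal and coideal with counit zero, and V/J with the induced operations is a
  graded commutative cocommutative Hopf algebra (all axioms hold modulo J, resp. modulo
  J \<otimes> V + V \<otimes> J, etc.; an antipode preserving J exists).\<close>

definition hopf_quotient :: "ss set \<Rightarrow> (ss \<Rightarrow> complex) set \<Rightarrow> bool" where
  "hopf_quotient A J \<longleftrightarrow>
   (let V = fsupp_on A;
        JT = cspan ({tens j v | j v. j \<in> J \<and> v \<in> V} \<union> {tens v j | j v. j \<in> J \<and> v \<in> V});
        JT3 = cspan ({tens3 j v w | j v w. j \<in> J \<and> v \<in> V \<and> w \<in> V} \<union>
                     {tens3 v j w | j v w. j \<in> J \<and> v \<in> V \<and> w \<in> V} \<union>
                     {tens3 v w j | j v w. j \<in> J \<and> v \<in> V \<and> w \<in> V})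
    in
    \<comment> \<open>V is a graded subalgebra and subcoalgebra\<close>
    unitv \<in> V \<and>
    (\<forall>x\<in>V. \<forall>y\<in>V. mult x y \<in> V) \<and>
    (\<forall>x\<in>V. comult x \<in> fsupp_on (A \<times> A)) \<and>
    (\<forall>a\<in>A. \<forall>b\<in>A. fst (dsum a b) = fst a + fst b) \<and>
    (\<forall>a\<in>A. \<forall>p\<in>supp (comult_b a). fst (fst p) + fst (snd p) = fst a) \<and>
    \<comment> \<open>J is a graded subspace of V, a two-sided ideal, a coideal, killed by the counit\<close>
    J \<subseteq> V \<and> cspan J = J \<and>
    (\<forall>j\<in>J. \<forall>k. hcomp k j \<in> J) \<and>
    (\<forall>j\<in>J. \<forall>x\<in>V. mult j x \<in> J \<and> mult x j \<in> J) \<and>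
    (\<forall>j\<in>J. comult j \<in> JT) \<and>
    (\<forall>j\<in>J. counit j = 0) \<and>
    \<comment> \<open>algebra axioms modulo J, commutativity\<close>
    (\<forall>x\<in>V. \<forall>y\<in>V. \<forall>z\<in>V. vsub (mult (mult x y) z) (mult x (mult y z)) \<in> J) \<and>
    (\<forall>x\<in>V. vsub (mult unitv x) x \<in> J \<and> vsub (mult x unitv) x \<in> J) \<and>
    (\<forall>x\<in>V. \<forall>y\<in>V. vsub (mult x y) (mult y x) \<in> J) \<and>
    \<comment> \<open>coalgebra axioms modulo J, cocommutativity\<close>
    (\<forall>x\<in>V. vsub (comult_l (comult x)) (comult_r (comult x)) \<in> JT3) \<and>
    (\<forall>x\<in>V. vsub (counit_l (comult x)) x \<in> J \<and> vsub (counit_r (comult x)) x \<in> J) \<and>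
    (\<forall>x\<in>V. vsub (comult x) (tswap (comult x)) \<in> JT) \<and>
    \<comment> \<open>bialgebra compatibility\<close>
    (\<forall>x\<in>V. \<forall>y\<in>V. vsub (comult (mult x y)) (tmult (comult x) (comult y)) \<in> JT) \<and>
    vsub (comult unitv) (tens unitv unitv) \<in> JT \<and>
    (\<forall>x\<in>V. \<forall>y\<in>V. counit (mult x y) = counit x * counit y) \<and>
    counit unitv = 1 \<and>
    \<comment> \<open>antipode\<close>
    (\<exists>S. (\<forall>x\<in>V. \<forall>y\<in>V. S (vadd x y) = vadd (S x) (S y)) \<and>
         (\<forall>c. \<forall>x\<in>V. S (scal c x) = scal c (S x)) \<and>
         S ` V \<subseteq> V \<and> S ` J \<subseteq> J \<and>
         (\<forall>x\<in>V. vsub (mtens (tmap S id (comult x))) (scal (counit x) unitv) \<in> J) \<and>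
         (\<forall>x\<in>V. vsub (mtens (tmap id S (comult x))) (scal (counit x) unitv) \<in> J)))"

definition iso_rels :: "ss set \<Rightarrow> (ss \<Rightarrow> complex) set" where
  "iso_rels A = {vsub (bv D) (bv D') | D D'. D \<in> A \<and> D' \<in> A \<and> iso_ss D D'}"

definition four_term_rels :: "ss set \<Rightarrow> (ss \<Rightarrow> complex) set" where
  "four_term_rels A = {vadd (vsub (vsub (bv D) (bv (exch a b D))) (bv (slide a b D)))
                            (bv (exch a b (slide a b D)))
                       | D a b. D \<in> A \<and> a < fst D \<and> b < fst D \<and> a \<noteq> b}"

definition binary_dms :: "ss set" where
  "binary_dms = {D. binary_dm D}"

definition even_binary_dms :: "ss set" where
  "even_binary_dms = {D. binary_dm D \<and> even_ss D}"

end

(* Over F_2, a binary delta-matroid is the family of coordinate transversals of a Lagrangian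
   subspace L of F_2^E + F_2^E: phi is feasible iff L meets the coordinate Lagrangian
   F_2^phi + F_2^(E - phi) trivially.  The graph {(u, M u)} of the matrix M of a framed graph gives
   its nondegeneracy delta-matroid, twists exchange the two coordinates of an element, and every
   Lagrangian has a transversal, hence arises in this way.  In these terms the restriction to E' is
   symplectic reduction by the vectors (0, e), e not in E', while sliding and exchange are linear
   symplectic maps.  So all three operations preserve binarity, restrictions compose, sliding and
   exchange commute with restriction to a set containing a and b, exchange becomes invisible after
   restriction to any other set, and sliding becomes invisible if both a and b are deleted.
   Consequently a four-term relation is mapped by the coproduct to four-term relations tensored with
   the identity plus terms cancelling in pairs.  The antipode is the recursively defined left
   convolution inverse of the identity; it is a right inverse by cocommutativity and preserves the
   relations by the same argument, by induction on the degree. *)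
theory Submission
  imports Defs "HOL-Library.Z2" "HOL-Library.Function_Algebras" "Jordan_Normal_Form.Determinant"
begin

hide_const (open) Group.monoid.mult

text \<open>Deletion is defined by cases, according to whether the element is a coloop, and
  \<open>restr\<close> iterates it in a fixed order. Argued on set systems, order independence and
  compatibility with sliding would branch at every step. Symplectic reduction has no cases:
  \<open>yv e\<close> lies in L exactly when e is a coloop, and both rules of deletion become the
  same reduction. Identities between restrictions then follow by representing both sides by one
  Lagrangian; which L represents a given D does not matter, since L is only used to recover D.

  On the ground sets \<open>{..<n}\<close>, associativity, coassociativity, cocommutativity, the
  unit and counit laws and the bialgebra law hold exactly. Isomorphism relations enter through
  commutativity, which exchanges two blocks of labels, and through commutativity the right antipode
  law. The subspace of relations must in turn be shown to be respected by all operations; this is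
  where the commutation of sliding and exchange with restriction is used.

  All binary and even binary delta-matroids are treated by one argument that uses only closure of
  the class under the operations.\<close>

section \<open>Kernels of matrices over the two-element field\<close>

text \<open>By default, arithmetic on \<^typ>\<open>bit\<close> is rewritten to bitwise logic, which defeats ring normalisation.\<close>

declare add_bit_eq_xor [simp del] mult_bit_eq_and [simp del] minus_bit_def [simp del]
  uminus_bit_def [simp del]

lemma bit_add_self [simp]: "(a::bit) + a = 0"
  by (cases a) (simp_all add: one_add_one)

lemma bit_add_self_left [simp]: "(a::bit) + (a + b) = b"
  by (simp add: add.assoc[symmetric])

lemma bit_add_eq_0_iff [simp]: "(a::bit) + b = 0 \<longleftrightarrow> a = b"
  by (cases a; cases b) simp_all

lemma bit_all: "(\<forall>x::bit. P x) \<longleftrightarrow> P 0 \<and> P 1"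
  by (metis bit.exhaust)

definition bitmat :: "(nat \<Rightarrow> nat \<Rightarrow> bool) \<Rightarrow> nat \<Rightarrow> nat \<Rightarrow> bit" where
  "bitmat M i j = of_bool (M i j)"

lemma signof_bit: "(signof p :: bit) = 1"
  by (auto simp: sign_def uminus_bit_def)

text \<open>Over \<open>bit\<close> all signs are 1, so the Leibniz sum counts, modulo 2, the
  permutations that stay on nonzero entries of \<open>M\<close>. The determinant is available for
  matrices indexed by \<open>{0..<n}\<close>, hence the transport along an enumeration
  \<open>e\<close> of \<phi>. A trivial kernel is the form of nondegeneracy that can be compared
  with Lagrangians.\<close>

lemma nondeg_F2_iff_kernel:
  assumes "finite \<phi>"
  shows "nondeg_F2 M \<phi> \<longleftrightarrow>
    (\<forall>u. (\<forall>i. i \<notin> \<phi> \<longrightarrow> u i = 0) \<and> (\<forall>i\<in>\<phi>. (\<Sum>j\<in>\<phi>. bitmat M i j * u j) = 0)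
      \<longrightarrow> (\<forall>i. u i = 0))"
proof -
  define n where "n = card \<phi>"
  obtain e where e: "bij_betw e {0..<n} \<phi>"
    using ex_bij_betw_nat_finite[OF assms] unfolding n_def by blast
  define A :: "bit mat" where "A = mat n n (\<lambda>(i,j). bitmat M (e i) (e j))"
  have A: "A \<in> carrier_mat n n" by (simp add: A_def)
  let ?P = "{\<pi>. \<pi> permutes {0..<n}}" and ?Q = "{\<sigma>. \<sigma> permutes \<phi>}"
  let ?c = "\<lambda>\<pi> x. if x \<in> \<phi> then e (\<pi> (inv_into {0..<n} e x)) else x"
  have bij: "bij_betw ?c ?P ?Q" by (rule bij_betw_permutations[OF e])
  have "det A = (\<Sum>\<pi>\<in>?P. \<Prod>i=0..<n. bitmat M (e i) (e (\<pi> i)))"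
    unfolding det_def A_def
    by (auto simp: signof_bit permutes_in_image intro!: sum.cong prod.cong)
  also have "\<dots> = (\<Sum>\<pi>\<in>?P. \<Prod>x\<in>\<phi>. bitmat M x (?c \<pi> x))"
  proof (intro sum.cong refl)
    fix \<pi> assume "\<pi> \<in> ?P"
    have "(\<Prod>x\<in>\<phi>. bitmat M x (?c \<pi> x)) = (\<Prod>i=0..<n. bitmat M (e i) (?c \<pi> (e i)))"
      by (rule prod.reindex_bij_betw[OF e, symmetric])
    also have "\<dots> = (\<Prod>i=0..<n. bitmat M (e i) (e (\<pi> i)))"
      using e by (intro prod.cong refl) (auto simp: bij_betw_def inv_into_f_f)
    finally show "(\<Prod>i=0..<n. bitmat M (e i) (e (\<pi> i))) = (\<Prod>x\<in>\<phi>. bitmat M x (?c \<pi> x))" ..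
  qed
  also have "\<dots> = (\<Sum>\<sigma>\<in>?Q. \<Prod>x\<in>\<phi>. bitmat M x (\<sigma> x))"
    by (rule sum.reindex_bij_betw[OF bij])
  also have "\<dots> = (\<Sum>\<sigma>\<in>?Q. of_bool (\<forall>i\<in>\<phi>. M i (\<sigma> i)))"
    using assms by (intro sum.cong refl) (auto simp: bitmat_def intro!: prod.neutral)
  also have "\<dots> = of_nat (card {\<sigma>. \<sigma> permutes \<phi> \<and> (\<forall>i\<in>\<phi>. M i (\<sigma> i))})"
    using finite_permutations[OF assms] by (simp add: sum_of_bool_eq Int_def conj_commute)
  finally have det: "det A = 0 \<longleftrightarrow> \<not> nondeg_F2 M \<phi>"
    unfolding nondeg_F2_def by (metis even_of_nat_iff even_zero bit_not_zero_iff odd_one)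
  have ker: "det A = 0 \<longleftrightarrow>
      (\<exists>v. v \<in> carrier_vec n \<and> v \<noteq> 0\<^sub>v n \<and> A *\<^sub>v v = 0\<^sub>v n)"
    by (rule det_0_iff_vec_prod_zero[OF A])
  have Av: "(A *\<^sub>v v) $ i = (\<Sum>j\<in>\<phi>. bitmat M (e i) j * v $ inv_into {0..<n} e j)"
    if "i < n" "v \<in> carrier_vec n" for v i
  proof -
    have "(A *\<^sub>v v) $ i = (\<Sum>k=0..<n. bitmat M (e i) (e k) * v $ k)"
      using that by (auto simp: A_def scalar_prod_def intro!: sum.cong)
    also have "\<dots> = (\<Sum>k=0..<n. bitmat M (e i) (e k) * v $ inv_into {0..<n} e (e k))"
      using e by (auto simp: bij_betw_def inv_into_f_f intro!: sum.cong)
    also have "\<dots> = (\<Sum>j\<in>\<phi>. bitmat M (e i) j * v $ inv_into {0..<n} e j)"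
      by (rule sum.reindex_bij_betw[OF e])
    finally show ?thesis .
  qed
  have im: "e i \<in> \<phi>" if "i < n" for i using e that by (auto simp: bij_betw_def)
  have inv: "inv_into {0..<n} e x < n" "e (inv_into {0..<n} e x) = x" if "x \<in> \<phi>" for x
    using e that by (auto simp: bij_betw_def f_inv_into_f dest: inv_into_into[of x e "{0..<n}"])
  have inv2: "inv_into {0..<n} e (e i) = i" if "i < n" for i
    using e that by (auto simp: bij_betw_def inv_into_f_f)
  show ?thesis
  proof (cases "nondeg_F2 M \<phi>")
    case True
    have "\<forall>i. u i = 0" if u: "\<forall>i. i \<notin> \<phi> \<longrightarrow> u i = 0"
      "\<forall>i\<in>\<phi>. (\<Sum>j\<in>\<phi>. bitmat M i j * u j) = 0" for u
    proof -
      define v where "v = vec n (\<lambda>i. u (e i))"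
      have v: "v \<in> carrier_vec n" by (simp add: v_def)
      have "A *\<^sub>v v = 0\<^sub>v n"
      proof (rule eq_vecI)
        fix i assume "i < dim_vec (0\<^sub>v n :: bit vec)"
        hence i: "i < n" by simp
        have "(\<Sum>j\<in>\<phi>. bitmat M (e i) j * v $ inv_into {0..<n} e j) = (\<Sum>j\<in>\<phi>. bitmat M (e i) j * u j)"
          using inv by (intro sum.cong refl) (simp add: v_def)
        thus "(A *\<^sub>v v) $ i = 0\<^sub>v n $ i" using Av[OF i v] u(2) im[OF i] i by simp
      qed (simp add: A_def)
      hence "v = 0\<^sub>v n" using True det ker v by blast
      hence "u (e i) = 0" if "i < n" for i using that unfolding v_def
        by (metis index_vec index_zero_vec(1))
      thus ?thesis using u(1) inv by metis
    qed
    thus ?thesis using True by blast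
  next
    case False
    then obtain v where v: "v \<in> carrier_vec n" "v \<noteq> 0\<^sub>v n" "A *\<^sub>v v = 0\<^sub>v n"
      using det ker by blast
    define u where "u x = (if x \<in> \<phi> then v $ inv_into {0..<n} e x else 0)" for x
    obtain i where i: "i < n" "v $ i \<noteq> 0" using v(1,2) by (metis carrier_vecD eq_vecI index_zero_vec(1) index_zero_vec(2))
    have "u (e i) \<noteq> 0" using i im inv2 by (simp add: u_def)
    moreover have "(\<Sum>j\<in>\<phi>. bitmat M x j * u j) = 0" if x: "x \<in> \<phi>" for x
    proof -
      have "(\<Sum>j\<in>\<phi>. bitmat M x j * u j) = (A *\<^sub>v v) $ inv_into {0..<n} e x"
        using Av[OF inv(1)[OF x] v(1)] inv(2)[OF x] by (simp add: u_def)
      thus ?thesis using v(3) inv(1)[OF x] by simp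
    qed
    moreover have "\<forall>x. x \<notin> \<phi> \<longrightarrow> u x = 0" by (simp add: u_def)
    ultimately show ?thesis using False by blast
  qed
qed

section \<open>Lagrangian subspaces and their transversals\<close>

type_synonym bvec = "(nat \<Rightarrow> bit) \<times> (nat \<Rightarrow> bit)"

text \<open>Vectors are total functions on \<open>nat\<close>; vanishing outside \<open>E\<close> is
  what makes them elements of F_2^E + F_2^E.\<close>

definition supported :: "nat set \<Rightarrow> bvec \<Rightarrow> bool" where
  "supported E p \<longleftrightarrow> (\<forall>i. i \<notin> E \<longrightarrow> fst p i = 0 \<and> snd p i = 0)"

definition bplus :: "bvec \<Rightarrow> bvec \<Rightarrow> bvec" where
  "bplus p q = (\<lambda>i. fst p i + fst q i, \<lambda>i. snd p i + snd q i)"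

definition bzero :: bvec where "bzero = (\<lambda>_. 0, \<lambda>_. 0)"

definition yv :: "nat \<Rightarrow> bvec" where "yv e = (\<lambda>_. 0, (\<lambda>_. 0)(e := 1))"

definition sform :: "nat set \<Rightarrow> bvec \<Rightarrow> bvec \<Rightarrow> bit" where
  "sform E p q = (\<Sum>i\<in>E. fst p i * snd q i + snd p i * fst q i)"

text \<open>\<open>L\<close> is its own orthogonal complement among the supported vectors. Closure
  under addition follows from this, so it is a subspace over F_2, and dimensions are never
  counted.\<close>

definition lagrangian :: "nat set \<Rightarrow> bvec set \<Rightarrow> bool" where
  "lagrangian E L \<longleftrightarrow> (\<forall>p. p \<in> L \<longleftrightarrow> supported E p \<and> (\<forall>q\<in>L. sform E p q = 0))"

definition in_coord :: "nat set \<Rightarrow> bvec \<Rightarrow> bool" where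
  "in_coord \<phi> p \<longleftrightarrow> (\<forall>i. i \<notin> \<phi> \<longrightarrow> fst p i = 0) \<and> (\<forall>i\<in>\<phi>. snd p i = 0)"

definition feasible :: "nat set \<Rightarrow> bvec set \<Rightarrow> nat set set" where
  "feasible E L = {\<phi>. \<phi> \<subseteq> E \<and> (\<forall>p\<in>L. in_coord \<phi> p \<longrightarrow> p = bzero)}"

lemma bvec_eq_iff: "p = q \<longleftrightarrow> (\<forall>i. fst p i = fst q i \<and> snd p i = snd q i)" for p q :: bvec
  by (auto simp: prod_eq_iff fun_eq_iff)

lemma bplus_sel [simp]: "fst (bplus p q) i = fst p i + fst q i" "snd (bplus p q) i = snd p i + snd q i"
  by (simp_all add: bplus_def)

lemma bzero_sel [simp]: "fst bzero i = 0" "snd bzero i = 0"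
  by (simp_all add: bzero_def)

lemma yv_sel [simp]: "fst (yv e) i = 0" "snd (yv e) i = (if i = e then 1 else 0)"
  by (simp_all add: yv_def)

lemma sform_commute: "sform E p q = sform E q p"
  by (simp add: sform_def mult.commute add.commute)

lemma sform_bplus: "sform E (bplus p q) r = sform E p r + sform E q r"
  by (simp add: sform_def sum.distrib[symmetric] algebra_simps)

lemma sform_bplus2: "sform E r (bplus p q) = sform E r p + sform E r q"
  by (metis sform_bplus sform_commute)

lemma sform_bzero [simp]: "sform E bzero q = 0" "sform E q bzero = 0"
  by (simp_all add: sform_def)

lemma sform_yv [simp]: "finite E \<Longrightarrow> e \<in> E \<Longrightarrow> sform E (yv e) q = fst q e"
  by (simp add: sform_def if_distribR if_distrib[of "\<lambda>x. x * _"] sum.delta cong: if_cong)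

lemma lagrangianD:
  assumes "lagrangian E L"
  shows "p \<in> L \<Longrightarrow> supported E p" "p \<in> L \<Longrightarrow> q \<in> L \<Longrightarrow> sform E p q = 0"
    "supported E p \<Longrightarrow> (\<And>q. q \<in> L \<Longrightarrow> sform E p q = 0) \<Longrightarrow> p \<in> L"
  using assms unfolding lagrangian_def by blast+

lemma lagrangianI:
  assumes "\<And>p. p \<in> L \<Longrightarrow> supported E p"
    and "\<And>p q. p \<in> L \<Longrightarrow> q \<in> L \<Longrightarrow> sform E p q = 0"
    and "\<And>p. supported E p \<Longrightarrow> (\<And>q. q \<in> L \<Longrightarrow> sform E p q = 0) \<Longrightarrow> p \<in> L"
  shows "lagrangian E L"
  unfolding lagrangian_def using assms(1,2) assms(3) by meson

lemma lagrangian_bzero: "lagrangian E L \<Longrightarrow> bzero \<in> L"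
  by (rule lagrangianD(3)) (auto simp: supported_def)

lemma supported_bplus: "supported E p \<Longrightarrow> supported E q \<Longrightarrow> supported E (bplus p q)"
  by (simp add: supported_def)

lemma lagrangian_bplus:
  assumes "lagrangian E L" "p \<in> L" "q \<in> L" shows "bplus p q \<in> L"
  using lagrangianD(1,2)[OF assms(1)] assms(2,3)
  by (intro lagrangianD(3)[OF assms(1)] supported_bplus) (simp_all add: sform_bplus)

text \<open>Over F_2 twists, slides and exchanges are their own inverses, so invariance of the form
  under \<open>M\<close> is enough: a vector orthogonal to the image is pulled back by
  \<open>M\<close> itself.\<close>

lemma lagrangian_image:
  assumes L: "lagrangian E L" and inv: "\<And>p. M (M p) = p"
    and supp: "\<And>p. supported E p \<Longrightarrow> supported E (M p)"
    and form: "\<And>p q. sform E (M p) (M q) = sform E p q"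
  shows "lagrangian E (M ` L)"
proof (rule lagrangianI)
  fix p assume p: "supported E p" "\<And>q. q \<in> M ` L \<Longrightarrow> sform E p q = 0"
  have "M p \<in> L"
    using lagrangianD(3)[OF L supp[OF p(1)]] p(2) form inv by (metis imageI)
  thus "p \<in> M ` L" using inv by (metis image_eqI)
next
  fix p assume "p \<in> M ` L"
  thus "supported E p" using lagrangianD(1)[OF L] supp by blast
next
  fix p q assume "p \<in> M ` L" "q \<in> M ` L"
  thus "sform E p q = 0" using lagrangianD(2)[OF L] form by fastforce
qed

text \<open>Symplectic reduction of \<open>L\<close> by the span of the vectors \<^term>\<open>yv e\<close> with \<open>e\<close> outside \<open>E'\<close>.\<close>

definition reduce :: "nat set \<Rightarrow> bvec set \<Rightarrow> bvec set" where
  "reduce E' L = (\<lambda>p. (fst p, \<lambda>i. if i \<in> E' then snd p i else 0)) ` {p \<in> L. \<forall>i. i \<notin> E' \<longrightarrow> fst p i = 0}"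

lemma reduceI:
  "q \<in> L \<Longrightarrow> (\<And>i. i \<notin> E' \<Longrightarrow> fst q i = 0) \<Longrightarrow> (\<And>i. fst p i = fst q i) \<Longrightarrow>
    (\<And>i. snd p i = (if i \<in> E' then snd q i else 0)) \<Longrightarrow> p \<in> reduce E' L"
  unfolding reduce_def by (intro image_eqI[of _ _ q]) (simp_all add: bvec_eq_iff)

lemma reduceE:
  assumes "p \<in> reduce E' L"
  obtains q where "q \<in> L" "\<forall>i. i \<notin> E' \<longrightarrow> fst q i = 0" "\<forall>i. fst p i = fst q i"
    "\<forall>i. snd p i = (if i \<in> E' then snd q i else 0)"
  using assms unfolding reduce_def by auto

text \<open>This makes iterated deletion independent of the order of the deleted elements.\<close>

lemma reduce_reduce:
  assumes "E'' \<subseteq> E'" shows "reduce E'' (reduce E' L) = reduce E'' L"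
proof (intro equalityI subsetI)
  fix p assume "p \<in> reduce E'' (reduce E' L)"
  then obtain q where q: "q \<in> reduce E' L" "\<forall>i. i \<notin> E'' \<longrightarrow> fst q i = 0" "\<forall>i. fst p i = fst q i"
    "\<forall>i. snd p i = (if i \<in> E'' then snd q i else 0)" by (rule reduceE)
  from q(1) obtain r where "r \<in> L" "\<forall>i. i \<notin> E' \<longrightarrow> fst r i = 0" "\<forall>i. fst q i = fst r i"
    "\<forall>i. snd q i = (if i \<in> E' then snd r i else 0)" by (rule reduceE)
  thus "p \<in> reduce E'' L" using q assms by (intro reduceI[of r]) auto
next
  fix p assume "p \<in> reduce E'' L"
  then obtain q where q: "q \<in> L" "\<forall>i. i \<notin> E'' \<longrightarrow> fst q i = 0" "\<forall>i. fst p i = fst q i"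
    "\<forall>i. snd p i = (if i \<in> E'' then snd q i else 0)" by (rule reduceE)
  have "(fst q, \<lambda>i. if i \<in> E' then snd q i else 0) \<in> reduce E' L"
    using q assms by (intro reduceI[of q]) auto
  thus "p \<in> reduce E'' (reduce E' L)"
    by (rule reduceI) (use q assms in auto)
qed

lemma reduce_self: assumes L: "lagrangian E L" shows "reduce E L = L"
proof (intro equalityI subsetI)
  fix p assume "p \<in> reduce E L"
  then obtain q where q: "q \<in> L" "\<forall>i. i \<notin> E \<longrightarrow> fst q i = 0" "\<forall>i. fst p i = fst q i"
    "\<forall>i. snd p i = (if i \<in> E then snd q i else 0)" by (rule reduceE)
  hence "p = q" using lagrangianD(1)[OF L q(1)] by (simp add: supported_def bvec_eq_iff)
  thus "p \<in> L" using q(1) by (simp only:)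
next
  fix p assume "p \<in> L"
  thus "p \<in> reduce E L" using lagrangianD(1)[OF L, of p]
    by (intro reduceI[of p]) (simp_all add: supported_def)
qed

text \<open>Each summand of the form contains a first coordinate. Where those of both vectors
  vanish, the second coordinates can be forgotten without changing the form.\<close>

lemma sform_reduce:
  assumes "finite E" "E' \<subseteq> E" and p: "\<forall>i. i \<notin> E' \<longrightarrow> fst p i = 0" "\<forall>i. i \<notin> E' \<longrightarrow> fst q i = 0"
    and eq: "\<And>i. i \<in> E' \<Longrightarrow> snd p i = snd p' i" "\<And>i. i \<in> E' \<Longrightarrow> snd q i = snd q' i" "\<And>i. fst p i = fst p' i" "\<And>i. fst q i = fst q' i"
  shows "sform E' p' q' = sform E p q"
proof -
  have "sform E p q = sform E' p q"
    unfolding sform_def using p by (intro sum.mono_neutral_right[OF assms(1,2)]) simp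
  also have "\<dots> = sform E' p' q'" unfolding sform_def
    using eq by (intro sum.cong refl) simp
  finally show ?thesis by simp
qed

text \<open>A vector orthogonal to the reduction is orthogonal to the part of \<open>L\<close> whose
  first coordinate at \<open>e\<close> vanishes, and its pairing is constant on the rest of
  \<open>L\<close>. Hence either the vector itself or its sum with \<open>yv e\<close> lies in
  \<open>L\<close>, and both have the same image in the reduction.\<close>

lemma lagrangian_reduce_delete:
  assumes L: "lagrangian E L" and fin: "finite E" and e: "e \<in> E"
  shows "lagrangian (E - {e}) (reduce (E - {e}) L)"
proof (rule lagrangianI)
  fix p assume "p \<in> reduce (E - {e}) L"
  thus "supported (E - {e}) p" using lagrangianD(1)[OF L]
    by (auto simp: reduce_def supported_def)
next
  fix p q assume "p \<in> reduce (E - {e}) L" "q \<in> reduce (E - {e}) L"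
  then obtain p' q' where
    p': "p' \<in> L" "\<forall>i. i \<notin> E - {e} \<longrightarrow> fst p' i = 0" "\<forall>i. fst p i = fst p' i"
      "\<forall>i. snd p i = (if i \<in> E - {e} then snd p' i else 0)" and
    q': "q' \<in> L" "\<forall>i. i \<notin> E - {e} \<longrightarrow> fst q' i = 0" "\<forall>i. fst q i = fst q' i"
      "\<forall>i. snd q i = (if i \<in> E - {e} then snd q' i else 0)"
    by (elim reduceE)
  have "sform (E - {e}) p q = sform E p' q'"
    by (rule sform_reduce) (use p' q' fin in auto)
  thus "sform (E - {e}) p q = 0" using lagrangianD(2)[OF L p'(1) q'(1)] by simp
next
  fix p assume p: "supported (E - {e}) p" and orth: "\<And>q. q \<in> reduce (E - {e}) L \<Longrightarrow> sform (E - {e}) p q = 0"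
  have orth': "sform E p q = 0" if "q \<in> L" "fst q e = 0" for q
  proof -
    have q: "\<forall>i. i \<notin> E - {e} \<longrightarrow> fst q i = 0"
      using that lagrangianD(1)[OF L that(1)] by (auto simp: supported_def)
    let ?q = "(fst q, \<lambda>i. if i \<in> E - {e} then snd q i else 0)"
    have "?q \<in> reduce (E - {e}) L" using q that(1) by (auto simp: reduce_def)
    hence "sform (E - {e}) p ?q = 0" by (rule orth)
    moreover have "sform (E - {e}) p ?q = sform E p q"
      by (rule sform_reduce) (use p q fin in \<open>auto simp: supported_def\<close>)
    ultimately show ?thesis by simp
  qed
  have fin_case: "p \<in> reduce (E - {e}) L" if "p' \<in> L" "p' = p \<or> p' = bplus p (yv e)" for p'
    by (rule reduceI[OF that(1)]) (use that p e in \<open>auto simp: supported_def\<close>)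
  have ps: "supported E p" "supported E (bplus p (yv e))" using p e by (auto simp: supported_def)
  show "p \<in> reduce (E - {e}) L"
  proof (cases "\<exists>q0\<in>L. fst q0 e \<noteq> 0 \<and> sform E p q0 = 1")
    case False
    hence "sform E p q = 0" if "q \<in> L" for q using orth'[of q] that by force
    thus ?thesis using lagrangianD(3)[OF L ps(1)] fin_case by blast
  next
    case True
    then obtain q0 where q0: "q0 \<in> L" "fst q0 e = 1" "sform E p q0 = 1" by auto
    \<comment> \<open>If \<open>fst q e\<close> is 1, then \<open>q + q0\<close> has first
      coordinate 0 at \<open>e\<close>, so \<open>p\<close> pairs with \<open>q\<close> as it does
      with \<open>q0\<close>, giving 1; the pairing of \<open>yv e\<close> with \<open>q\<close>
      contributes the second 1.\<close>
    have "sform E (bplus p (yv e)) q = 0" if q: "q \<in> L" for q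
    proof (cases "fst q e = 0")
      case True thus ?thesis using orth'[OF q] fin e by (simp add: sform_bplus)
    next
      case False
      hence "sform E p (bplus q q0) = 0" using orth' lagrangian_bplus[OF L q q0(1)] q0 by auto
      thus ?thesis using False q0 fin e by (auto simp: sform_bplus sform_bplus2)
    qed
    thus ?thesis using lagrangianD(3)[OF L ps(2)] fin_case by blast
  qed
qed

lemma lagrangian_reduce:
  assumes "lagrangian E L" "finite E" "E' \<subseteq> E"
  shows "lagrangian E' (reduce E' L)"
proof -
  have "lagrangian (E - X) (reduce (E - X) L)" if "finite X" "X \<subseteq> E" for X using that
  proof (induction X rule: finite_induct)
    case empty thus ?case using assms reduce_self by simp
  next
    case (insert e X)
    have "lagrangian (E - X - {e}) (reduce (E - X - {e}) (reduce (E - X) L))"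
      using insert assms(2) by (intro lagrangian_reduce_delete) auto
    moreover have "E - X - {e} = E - insert e X" by blast
    moreover have "reduce (E - insert e X) (reduce (E - X) L) = reduce (E - insert e X) L"
      by (rule reduce_reduce) blast
    ultimately show ?case by simp
  qed
  from this[of "E - E'"] show ?thesis using assms
    by (simp add: double_diff finite_subset)
qed

section \<open>Deletion of an element as symplectic reduction\<close>

text \<open>Since \<phi> omits \<open>e\<close>, a vector of its coordinate Lagrangian has first
  coordinate 0 at \<open>e\<close> and so survives to the reduction. Truncation can kill it only if
  it is zero or \<open>yv e\<close>, and the latter is not in \<open>L\<close>.\<close>

lemma feasible_reduce_noncoloop:
  assumes L: "lagrangian E L" and e: "e \<in> E" and y: "yv e \<notin> L" and \<phi>: "\<phi> \<subseteq> E - {e}"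
  shows "\<phi> \<in> feasible (E - {e}) (reduce (E - {e}) L) \<longleftrightarrow> \<phi> \<in> feasible E L"
proof
  assume *: "\<phi> \<in> feasible E L"
  show "\<phi> \<in> feasible (E - {e}) (reduce (E - {e}) L)"
    unfolding feasible_def
  proof (intro CollectI conjI ballI impI \<phi>)
    fix p assume pr: "p \<in> reduce (E - {e}) L" and p: "in_coord \<phi> p"
    from pr obtain q where q: "q \<in> L" "\<forall>i. i \<notin> E - {e} \<longrightarrow> fst q i = 0" "\<forall>i. fst p i = fst q i"
      "\<forall>i. snd p i = (if i \<in> E - {e} then snd q i else 0)" by (rule reduceE)
    have "in_coord \<phi> q" using p q \<phi> by (simp add: in_coord_def subset_iff)
    hence "q = bzero" using * q(1) by (auto simp: feasible_def)
    thus "p = bzero" using q by (simp add: bvec_eq_iff)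
  qed
next
  assume *: "\<phi> \<in> feasible (E - {e}) (reduce (E - {e}) L)"
  have "p = bzero" if p: "p \<in> L" "in_coord \<phi> p" for p
  proof -
    let ?p = "(fst p, \<lambda>i. if i \<in> E - {e} then snd p i else 0)"
    have "?p \<in> reduce (E - {e}) L"
      by (rule reduceI[OF p(1)]) (use p \<phi> e lagrangianD(1)[OF L p(1)] in \<open>auto simp: in_coord_def\<close>)
    moreover have "in_coord \<phi> ?p" using p(2) by (auto simp: in_coord_def)
    ultimately have "?p = bzero" using * unfolding feasible_def by blast
    hence "p = bzero \<or> p = yv e" using lagrangianD(1)[OF L p(1)]
      by (cases "snd p e") (auto simp: bvec_eq_iff supported_def split: if_splits)
    thus ?thesis using y p(1) by blast
  qed
  thus "\<phi> \<in> feasible E L" using \<phi> by (auto simp: feasible_def)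
qed

lemma feasible_subset: "\<phi> \<in> feasible E L \<Longrightarrow> \<phi> \<subseteq> E"
  by (simp add: feasible_def)

lemma coloop_fst:
  assumes "lagrangian E L" "finite E" "e \<in> E" "yv e \<in> L" "p \<in> L"
  shows "fst p e = 0"
  using lagrangianD(2)[OF assms(1,4,5)] assms by simp

lemma feasible_coloop:
  assumes "yv e \<in> L" "\<phi> \<in> feasible E L" shows "e \<in> \<phi>"
proof (rule ccontr)
  assume "e \<notin> \<phi>"
  hence "in_coord \<phi> (yv e)" by (auto simp: in_coord_def)
  hence "yv e = bzero" using assms by (auto simp: feasible_def)
  hence "snd (yv e) e = 0" by (simp only: bzero_sel)
  thus False by simp
qed

text \<open>Isotropy with \<open>yv e\<close> forces the first coordinate at \<open>e\<close> to
  vanish on all of \<open>L\<close>, so reduction only clears the second coordinate there, and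
  \<open>in_coord (insert e \<phi>)\<close> asks that coordinate to be 0 as well.\<close>

lemma feasible_reduce_coloop:
  assumes L: "lagrangian E L" and fin: "finite E" and e: "e \<in> E" and y: "yv e \<in> L" and \<phi>: "\<phi> \<subseteq> E - {e}"
  shows "\<phi> \<in> feasible (E - {e}) (reduce (E - {e}) L) \<longleftrightarrow> insert e \<phi> \<in> feasible E L"
proof
  assume *: "insert e \<phi> \<in> feasible E L"
  have "p = bzero" if p: "p \<in> reduce (E - {e}) L" "in_coord \<phi> p" for p
  proof -
    obtain q where q: "q \<in> L" "\<forall>i. i \<notin> E - {e} \<longrightarrow> fst q i = 0"
      "\<forall>i. fst p i = fst q i"
      "\<forall>i. snd p i = (if i \<in> E - {e} then snd q i else 0)" using p(1) by (rule reduceE)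
    have "p = q \<or> p = bplus q (yv e)" using q lagrangianD(1)[OF L q(1)]
      by (cases "snd q e") (auto simp: bvec_eq_iff supported_def)
    hence "p \<in> L" using q(1) y lagrangian_bplus[OF L] by blast
    moreover have "in_coord (insert e \<phi>) p" using p(2) q(4) by (auto simp: in_coord_def)
    ultimately show ?thesis using * by (auto simp: feasible_def)
  qed
  thus "\<phi> \<in> feasible (E - {e}) (reduce (E - {e}) L)" using \<phi> by (auto simp: feasible_def)
next
  assume *: "\<phi> \<in> feasible (E - {e}) (reduce (E - {e}) L)"
  have "p = bzero" if p: "p \<in> L" "in_coord (insert e \<phi>) p" for p
  proof -
    have pe: "fst p e = 0" "snd p e = 0" using coloop_fst[OF L fin e y p(1)] p(2) by (auto simp: in_coord_def)
    have "p \<in> reduce (E - {e}) L"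
      by (rule reduceI[OF p(1)]) (use pe lagrangianD(1)[OF L p(1)] in \<open>auto simp: supported_def\<close>)
    moreover have "in_coord \<phi> p" using p(2) pe by (auto simp: in_coord_def)
    ultimately show ?thesis using * unfolding feasible_def by blast
  qed
  thus "insert e \<phi> \<in> feasible E L" using \<phi> e by (auto simp: feasible_def)
qed

text \<open>Existence of a transversal: one of the reduction by \<open>e\<close> is kept if
  \<open>e\<close> is not a coloop and is enlarged by \<open>e\<close> if it is.\<close>

lemma feasible_nonempty:
  "finite E \<Longrightarrow> lagrangian E L \<Longrightarrow> feasible E L \<noteq> {}"
proof (induction E arbitrary: L rule: finite_induct)
  case empty
  have "p = bzero" if "p \<in> L" for p using lagrangianD(1)[OF empty that] by (auto simp: supported_def bvec_eq_iff)
  thus ?case by (auto simp: feasible_def)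
next
  case (insert e E)
  have EE: "insert e E - {e} = E" using insert by auto
  have "lagrangian E (reduce E L)" using lagrangian_reduce[OF insert.prems, of E] insert by auto
  then obtain \<phi> where \<phi>: "\<phi> \<in> feasible E (reduce E L)" "\<phi> \<subseteq> E" using insert.IH feasible_subset by blast
  show ?case
    using feasible_reduce_noncoloop[OF insert.prems, of e \<phi>] feasible_reduce_coloop[OF insert.prems, of e \<phi>] \<phi> EE insert
    by (cases "yv e \<in> L") auto
qed

lemma del_feasible:
  assumes L: "lagrangian E L" and fin: "finite E" and e: "e \<in> E"
  shows "del e (E, feasible E L) = (E - {e}, feasible (E - {e}) (reduce (E - {e}) L))"
proof -
  let ?R = "feasible (E - {e}) (reduce (E - {e}) L)"
  have sub: "\<phi> \<subseteq> E - {e}" if "\<phi> \<in> ?R" for \<phi> using that by (simp add: feasible_def)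
  have subE: "\<phi> \<subseteq> E" if "\<phi> \<in> feasible E L" for \<phi> using that by (simp add: feasible_def)
  \<comment> \<open>A feasible set of the reduction. If \<open>yv e\<close> is not in
    \<open>L\<close>, it is a feasible set of \<open>L\<close> that omits \<open>e\<close>, so the
    case distinction in \<open>del\<close> agrees with the one on \<open>yv e\<close>.\<close>
  obtain \<psi> where \<psi>: "\<psi> \<in> ?R" using feasible_nonempty[OF _ lagrangian_reduce_delete[OF assms]] fin by blast
  show ?thesis
  proof (cases "yv e \<in> L")
    case True
    note r = feasible_reduce_coloop[OF L fin e True]
    have "(\<lambda>\<phi>. \<phi> - {e}) ` feasible E L = ?R"
    proof (intro equalityI subsetI)
      fix \<phi> assume "\<phi> \<in> (\<lambda>\<phi>. \<phi> - {e}) ` feasible E L"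
      then obtain \<phi>' where "\<phi>' \<in> feasible E L" "\<phi> = \<phi>' - {e}" by blast
      thus "\<phi> \<in> ?R" using r[of \<phi>] subE feasible_coloop[OF True] by (auto simp: insert_absorb)
    next
      fix \<phi> assume "\<phi> \<in> ?R"
      thus "\<phi> \<in> (\<lambda>\<phi>. \<phi> - {e}) ` feasible E L" using r[of \<phi>] sub[of \<phi>]
        by (intro image_eqI[of _ _ "insert e \<phi>"]) auto
    qed
    thus ?thesis using feasible_coloop[OF True] by (auto simp: del_def)
  next
    case False
    note r = feasible_reduce_noncoloop[OF L e False]
    have "\<psi> \<in> feasible E L" "e \<notin> \<psi>" using r[of \<psi>] \<psi> sub[OF \<psi>] by auto
    moreover have "{\<phi> \<in> feasible E L. e \<notin> \<phi>} = ?R" using r sub subE by blast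
    ultimately show ?thesis by (auto simp: del_def)
  qed
qed

lemma foldr_del_feasible:
  assumes L: "lagrangian E L" and fin: "finite E"
  shows "distinct xs \<Longrightarrow> set xs \<subseteq> E \<Longrightarrow>
    foldr del xs (E, feasible E L) = (E - set xs, feasible (E - set xs) (reduce (E - set xs) L))"
proof (induction xs)
  case Nil thus ?case using reduce_self[OF L] by simp
next
  case (Cons x xs)
  have "lagrangian (E - set xs) (reduce (E - set xs) L)" using lagrangian_reduce[OF L fin] by blast
  hence "del x (E - set xs, feasible (E - set xs) (reduce (E - set xs) L)) =
     (E - set xs - {x}, feasible (E - set xs - {x}) (reduce (E - set xs - {x}) (reduce (E - set xs) L)))"
    using Cons.prems fin by (intro del_feasible) auto
  moreover have "E - set xs - {x} = E - set (x # xs)" by auto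
  ultimately show ?case using Cons by (simp add: reduce_reduce Diff_subset subset_iff)
qed

lemma in_coord_iff: "in_coord \<phi> p \<longleftrightarrow> (\<forall>i. (if i \<in> \<phi> then snd p i else fst p i) = 0)"
  by (auto simp: in_coord_def)

section \<open>Twists, slides and exchanges as symplectic involutions\<close>

definition twistv :: "nat set \<Rightarrow> bvec \<Rightarrow> bvec" where
  "twistv X p = (\<lambda>i. if i \<in> X then snd p i else fst p i, \<lambda>i. if i \<in> X then fst p i else snd p i)"

lemma twistv_sel [simp]:
  "fst (twistv X p) i = (if i \<in> X then snd p i else fst p i)"
  "snd (twistv X p) i = (if i \<in> X then fst p i else snd p i)"
  by (simp_all add: twistv_def)

lemma twistv_twistv [simp]: "twistv X (twistv X p) = p"
  by (simp add: bvec_eq_iff)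

lemma lagrangian_twistv: "lagrangian E L \<Longrightarrow> lagrangian E (twistv X ` L)"
  by (rule lagrangian_image) (auto simp: supported_def sform_def add.commute intro!: sum.cong)

lemma symd_symd [simp]: "symd (symd A B) B = A"
  by (auto simp: symd_def)

lemma mem_symd: "x \<in> symd A B \<longleftrightarrow> (x \<in> A) \<noteq> (x \<in> B)"
  by (auto simp: symd_def)

lemma mem_twist_image: "\<phi> \<in> (\<lambda>\<phi>. symd \<phi> X) ` S \<longleftrightarrow> symd \<phi> X \<in> S"
  by (metis (no_types, lifting) imageE image_eqI symd_symd)

lemma in_coord_twistv: "in_coord \<phi> (twistv X p) \<longleftrightarrow> in_coord (symd \<phi> X) p"
  by (auto simp: in_coord_iff mem_symd)

lemma twistv_eq_bzero [simp]: "twistv X p = bzero \<longleftrightarrow> p = bzero"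
proof -
  have "twistv X bzero = bzero" by (simp add: bvec_eq_iff)
  thus ?thesis by (metis twistv_twistv)
qed

lemma feasible_twistv:
  assumes "X \<subseteq> E" shows "feasible E (twistv X ` L) = (\<lambda>\<phi>. symd \<phi> X) ` feasible E L"
proof (rule Set.set_eqI)
  fix \<phi>
  have "\<phi> \<subseteq> E \<longleftrightarrow> symd \<phi> X \<subseteq> E" using assms by (auto simp: symd_def)
  thus "\<phi> \<in> feasible E (twistv X ` L) \<longleftrightarrow> \<phi> \<in> (\<lambda>\<phi>. symd \<phi> X) ` feasible E L"
    unfolding mem_twist_image by (simp add: feasible_def in_coord_twistv)
qed

text \<open>The second coordinates change by the inverse transpose of the change of the first ones,
  which keeps the form invariant. On the graph of a matrix this is the congruence adding row
  \<open>b\<close> to row \<open>a\<close> and column \<open>b\<close> to column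
  \<open>a\<close>.\<close>

definition slidev :: "nat \<Rightarrow> nat \<Rightarrow> bvec \<Rightarrow> bvec" where
  "slidev a b p = (\<lambda>i. if i = b then fst p b + fst p a else fst p i,
                   \<lambda>i. if i = a then snd p a + snd p b else snd p i)"

lemma slidev_sel [simp]:
  "fst (slidev a b p) i = (if i = b then fst p b + fst p a else fst p i)"
  "snd (slidev a b p) i = (if i = a then snd p a + snd p b else snd p i)"
  by (simp_all add: slidev_def)

lemma slidev_slidev [simp]: "a \<noteq> b \<Longrightarrow> slidev a b (slidev a b p) = p"
  by (simp add: bvec_eq_iff add.assoc)

lemma slidev_eq_bzero [simp]: "a \<noteq> b \<Longrightarrow> slidev a b p = bzero \<longleftrightarrow> p = bzero"
proof -
  assume "a \<noteq> b"
  moreover have "slidev a b bzero = bzero" by (simp add: bvec_eq_iff)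
  ultimately show ?thesis by (metis slidev_slidev)
qed

lemma sform_split2:
  assumes "finite E" "a \<in> E" "b \<in> E" "a \<noteq> b"
  shows "sform E p q = fst p a * snd q a + snd p a * fst q a + (fst p b * snd q b + snd p b * fst q b)
     + sform (E - {a,b}) p q"
proof -
  define F where "F = E - {a,b}"
  have "E = insert a (insert b F)" "finite F" "a \<notin> F" "b \<notin> F" using assms by (auto simp: F_def)
  then show ?thesis using assms(4) unfolding F_def[symmetric] by (simp add: sform_def add.assoc)
qed

lemma sform_slidev:
  assumes "finite E" "a \<in> E" "b \<in> E" "a \<noteq> b"
  shows "sform E (slidev a b p) (slidev a b q) = sform E p q"
proof -
  have "sform (E - {a,b}) (slidev a b p) (slidev a b q) = sform (E - {a,b}) p q"
    by (auto simp: sform_def intro!: sum.cong)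
  thus ?thesis using assms(4)
    unfolding sform_split2[OF assms, of "slidev a b p"] sform_split2[OF assms, of p]
    by (cases "fst p a"; cases "fst q a"; cases "snd p b"; cases "snd q b") (simp_all add: algebra_simps)
qed

lemma lagrangian_slidev:
  assumes "finite E" "a \<in> E" "b \<in> E" "a \<noteq> b" "lagrangian E L"
  shows "lagrangian E (slidev a b ` L)"
  by (rule lagrangian_image) (use assms in \<open>auto simp: supported_def sform_slidev\<close>)


text \<open>For the graph of a symmetric matrix m the reason is that the slide turns the entry m_aa
  into the value of the quadratic form at e_a + e_b, which is m_aa + m_bb since the off-diagonal
  terms cancel. To cover all Lagrangians at once the proof is exhaustive: \<open>mk\<close> codes
  the 16 vectors by their coordinates and \<open>P\<close> their membership in
  \<open>L\<close>.\<close>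

lemma feasible_slidev_pair:
  assumes L: "lagrangian {a,b} L" and ab: "a \<noteq> b"
  shows "{a} \<in> feasible {a,b} (slidev a b ` L) \<longleftrightarrow> ({a} \<in> feasible {a,b} L) \<noteq> ({b} \<in> feasible {a,b} L)"
proof -
  define mk :: "bit \<Rightarrow> bit \<Rightarrow> bit \<Rightarrow> bit \<Rightarrow> bvec" where
    "mk = (\<lambda>x y z w. (\<lambda>i. if i = a then x else if i = b then y else 0, \<lambda>i. if i = a then z else if i = b then w else 0))"
  define P where "P x y z w \<longleftrightarrow> mk x y z w \<in> L" for x y z w
  have surj: "\<exists>x y z w. p = mk x y z w" if "supported {a,b} p" for p
  proof -
    have "p = mk (fst p a) (fst p b) (snd p a) (snd p b)"
      using that by (auto simp: mk_def bvec_eq_iff supported_def)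
    thus ?thesis by blast
  qed
  have form: "sform {a,b} (mk x y z w) (mk x' y' z' w') = x * z' + z * x' + (y * w' + w * y')" for x y z w x' y' z' w'
    using ab by (simp add: sform_def mk_def)
  have supp: "supported {a,b} (mk x y z w)" for x y z w by (simp add: supported_def mk_def)
  have all: "(\<forall>p\<in>L. Q p) \<longleftrightarrow> (\<forall>x y z w. P x y z w \<longrightarrow> Q (mk x y z w))" for Q
    unfolding P_def using surj lagrangianD(1)[OF L] by metis
  have "P x y z w \<longleftrightarrow> (\<forall>x' y' z' w'. P x' y' z' w' \<longrightarrow> x * z' + z * x' + (y * w' + w * y') = 0)" for x y z w
  proof -
    have "P x y z w \<longleftrightarrow> (\<forall>q\<in>L. sform {a,b} (mk x y z w) q = 0)"
      unfolding P_def using L supp unfolding lagrangian_def by blast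
    thus ?thesis unfolding all form .
  qed
  hence P: "\<forall>x y z w. P x y z w \<longleftrightarrow> (\<forall>x' y' z' w'. P x' y' z' w' \<longrightarrow> x * z' + z * x' + (y * w' + w * y') = 0)"
    by blast
  have z: "mk x y z w = bzero \<longleftrightarrow> x = 0 \<and> y = 0 \<and> z = 0 \<and> w = 0" for x y z w
    using ab by (auto simp: mk_def bvec_eq_iff split: if_splits)
  have c: "in_coord {a} (mk x y z w) \<longleftrightarrow> y = 0 \<and> z = 0" "in_coord {b} (mk x y z w) \<longleftrightarrow> x = 0 \<and> w = 0"
     "in_coord {a} (slidev a b (mk x y z w)) \<longleftrightarrow> x = y \<and> z = w" for x y z w
    using ab by (auto simp: mk_def in_coord_def slidev_def)
  \<comment> \<open>A coordinate Lagrangian on two elements has three nonzero vectors, and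
    feasibility says that none of them lies in the given Lagrangian. For the slide they are pulled
    back to \<open>L\<close>.\<close>
  have f: "{a} \<in> feasible {a,b} L \<longleftrightarrow> \<not> P 1 0 0 0 \<and> \<not> P 1 0 0 1 \<and> \<not> P 0 0 0 1"
    "{b} \<in> feasible {a,b} L \<longleftrightarrow> \<not> P 0 1 0 0 \<and> \<not> P 0 1 1 0 \<and> \<not> P 0 0 1 0"
    "{a} \<in> feasible {a,b} (slidev a b ` L) \<longleftrightarrow> \<not> P 1 1 0 0 \<and> \<not> P 1 1 1 1 \<and> \<not> P 0 0 1 1"
    using ab by (simp_all add: feasible_def all c z) (auto simp: bit_all)
  \<comment> \<open>A propositional statement about the 16 membership bits of \<open>L\<close>.\<close>
  show ?thesis unfolding f using P[unfolded bit_all, simplified] by sat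
qed

definition trunc :: "nat set \<Rightarrow> bvec \<Rightarrow> bvec" where
  "trunc E' p = (fst p, \<lambda>i. if i \<in> E' then snd p i else 0)"

lemma trunc_sel [simp]: "fst (trunc E' p) i = fst p i" "snd (trunc E' p) i = (if i \<in> E' then snd p i else 0)"
  by (simp_all add: trunc_def)

lemma reduce_eq_trunc: "reduce E' L = trunc E' ` {p \<in> L. \<forall>i. i \<notin> E' \<longrightarrow> fst p i = 0}"
  by (simp add: reduce_def trunc_def)

text \<open>\<open>M'\<close> is the map induced by \<open>M\<close> on the reduction. With
  \<open>M' = M\<close> this gives the commutation of an operation with restriction, with
  \<open>M'\<close> the identity its disappearance under restriction.\<close>

lemma reduce_image:
  assumes inv: "\<And>p. M (M p) = p"
    and supp: "\<And>p i. (\<And>i. i \<notin> E' \<Longrightarrow> fst p i = 0) \<Longrightarrow> i \<notin> E' \<Longrightarrow> fst (M p) i = 0"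
    and fst: "\<And>p i. (\<And>i. i \<notin> E' \<Longrightarrow> fst p i = 0) \<Longrightarrow> fst (M p) i = fst (M' (trunc E' p)) i"
    and snd: "\<And>p i. (\<And>i. i \<notin> E' \<Longrightarrow> fst p i = 0) \<Longrightarrow>
      (if i \<in> E' then snd (M p) i else 0) = snd (M' (trunc E' p)) i"
  shows "reduce E' (M ` L) = M' ` reduce E' L"
proof -
  let ?S = "{p \<in> L. \<forall>i. i \<notin> E' \<longrightarrow> fst p i = 0}"
  have "trunc E' (M p) = M' (trunc E' p)" if "p \<in> ?S" for p
    using fst[of p] snd[of p] that by (simp add: bvec_eq_iff)
  hence "trunc E' ` M ` ?S = M' ` trunc E' ` ?S"
    unfolding image_image by (rule image_cong[OF refl])
  moreover have "{p \<in> M ` L. \<forall>i. i \<notin> E' \<longrightarrow> fst p i = 0} = M ` ?S"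
  proof (intro equalityI subsetI)
    fix q assume "q \<in> {p \<in> M ` L. \<forall>i. i \<notin> E' \<longrightarrow> fst p i = 0}"
    then obtain p where p: "p \<in> L" "q = M p" "\<forall>i. i \<notin> E' \<longrightarrow> fst q i = 0" by blast
    hence "\<forall>i. i \<notin> E' \<longrightarrow> fst (M q) i = 0" using supp[of q] by blast
    thus "q \<in> M ` ?S" using p inv by simp
  next
    fix q assume "q \<in> M ` ?S"
    then obtain p where "p \<in> ?S" "q = M p" by blast
    thus "q \<in> {p \<in> M ` L. \<forall>i. i \<notin> E' \<longrightarrow> fst p i = 0}" using supp[of p] by simp
  qed
  ultimately show ?thesis unfolding reduce_eq_trunc by (simp only:)
qed

lemma reduce_slidev:
  assumes "a \<in> E'" "b \<in> E'" "a \<noteq> b" shows "reduce E' (slidev a b ` L) = slidev a b ` reduce E' L"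
  by (rule reduce_image) (use assms in auto)

lemma reduce_slidev_outside:
  assumes "a \<notin> E'" "b \<notin> E'" "a \<noteq> b" shows "reduce E' (slidev a b ` L) = reduce E' L"
proof -
  have "reduce E' (slidev a b ` L) = (\<lambda>p. p) ` reduce E' L"
    by (rule reduce_image) (use assms in auto)
  thus ?thesis by simp
qed

definition exchv :: "nat \<Rightarrow> nat \<Rightarrow> bvec \<Rightarrow> bvec" where
  "exchv a b p = twistv {b} (slidev a b (twistv {b} p))"

text \<open>On the graph of a matrix the exchange toggles the entry at \<open>(a, b)\<close>. It
  keeps all first coordinates, and each change is either weighted by a vanishing first coordinate or
  truncated once \<open>a\<close> or \<open>b\<close> is deleted.\<close>

lemma exchv_sel [simp]:
  assumes "a \<noteq> b"
  shows "fst (exchv a b p) i = fst p i"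
    "snd (exchv a b p) i = snd p i + (if i = a then fst p b else if i = b then fst p a else 0)"
  using assms by (simp_all add: exchv_def)

lemma exchv_exchv: "a \<noteq> b \<Longrightarrow> exchv a b (exchv a b p) = p"
  by (simp add: exchv_def)

lemma reduce_exchv:
  assumes "a \<in> E'" "b \<in> E'" "a \<noteq> b" shows "reduce E' (exchv a b ` L) = exchv a b ` reduce E' L"
  by (rule reduce_image) (use assms exchv_exchv in auto)

lemma reduce_exchv_outside:
  assumes "\<not> (a \<in> E' \<and> b \<in> E')" "a \<noteq> b" shows "reduce E' (exchv a b ` L) = reduce E' L"
proof -
  have "reduce E' (exchv a b ` L) = (\<lambda>p. p) ` reduce E' L"
    by (rule reduce_image) (use assms exchv_exchv in auto)
  thus ?thesis by simp
qed

lemma yv_mem_slidev: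
  assumes "a \<noteq> b" "e \<noteq> a" "e \<noteq> b" shows "yv e \<in> slidev a b ` L \<longleftrightarrow> yv e \<in> L"
proof -
  have "slidev a b (yv e) = yv e" using assms by (auto simp: bvec_eq_iff)
  thus ?thesis using slidev_slidev[OF assms(1)] by (metis image_iff)
qed

text \<open>The elements other than \<open>a\<close> and \<open>b\<close> are deleted one by one
  until the two-element case is reached. If such an element is a coloop, before or equivalently
  after the slide, no singleton \<open>{a}\<close> or \<open>{b}\<close> is feasible and both sides
  are false.\<close>

lemma feasible_slidev_singleton:
  assumes "finite E" "a \<in> E" "b \<in> E" "a \<noteq> b" "lagrangian E L"
  shows "{a} \<in> feasible E (slidev a b ` L) \<longleftrightarrow> ({a} \<in> feasible E L) \<noteq> ({b} \<in> feasible E L)"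
  using assms
proof (induction E arbitrary: L rule: finite_psubset_induct)
  case (psubset E)
  note L = psubset.prems(4) and ab = psubset.prems(1-3)
  show ?case
  proof (cases "E = {a,b}")
    case True thus ?thesis using feasible_slidev_pair[of a b L] L ab by simp
  next
    case False
    then obtain e where e: "e \<in> E" "e \<noteq> a" "e \<noteq> b" using ab by blast
    have L': "lagrangian E (slidev a b ` L)" using lagrangian_slidev psubset.hyps ab L by blast
    show ?thesis
    proof (cases "yv e \<in> L")
      case True
      thus ?thesis using feasible_coloop[of e] yv_mem_slidev[of a b e L] e ab by blast
    next
      case False
      hence False': "yv e \<notin> slidev a b ` L" using yv_mem_slidev e ab by blast
      have "{a} \<in> feasible (E - {e}) (slidev a b ` reduce (E - {e}) L) \<longleftrightarrow>
        ({a} \<in> feasible (E - {e}) (reduce (E - {e}) L)) \<noteq> ({b} \<in> feasible (E - {e}) (reduce (E - {e}) L))"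
        by (rule psubset.IH) (use e ab psubset.hyps lagrangian_reduce_delete[OF L] in auto)
      moreover have "reduce (E - {e}) (slidev a b ` L) = slidev a b ` reduce (E - {e}) L"
        by (rule reduce_slidev) (use e ab in simp_all)
      moreover have "{a} \<subseteq> E - {e}" "{b} \<subseteq> E - {e}" using e ab by auto
      ultimately show ?thesis
        using feasible_reduce_noncoloop[OF L e(1) False] feasible_reduce_noncoloop[OF L' e(1) False'] by metis
    qed
  qed
qed

lemma in_coord_slidev:
  assumes "a \<noteq> b" "a \<notin> \<phi> \<or> b \<in> \<phi>" "in_coord \<phi> p" shows "in_coord \<phi> (slidev a b p)"
  using assms by (cases "a \<in> \<phi>") (simp_all add: in_coord_def)

text \<open>The slide preserves the coordinate Lagrangian of \<phi> unless \<phi> contains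
  \<open>a\<close> and omits \<open>b\<close>, so only the feasibility of such \<phi> can
  change.\<close>

lemma feasible_slidev:
  assumes E: "finite E" "a \<in> E" "b \<in> E" "a \<noteq> b" and L: "lagrangian E L"
  shows "feasible E (slidev a b ` L) = symd (feasible E L)
    {\<phi> \<union> {a} | \<phi>. \<phi> \<subseteq> E - {a,b} \<and> \<phi> \<union> {b} \<in> feasible E L}" (is "_ = symd _ ?X")
proof (rule Set.set_eqI)
  fix \<phi>
  show "\<phi> \<in> feasible E (slidev a b ` L) \<longleftrightarrow> \<phi> \<in> symd (feasible E L) ?X"
  proof (cases "\<phi> \<subseteq> E \<and> a \<in> \<phi> \<and> b \<notin> \<phi>")
    case False
    have "\<phi> \<notin> ?X" using False E by auto
    moreover have "\<phi> \<in> feasible E (slidev a b ` L) \<longleftrightarrow> \<phi> \<in> feasible E L"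
    proof (cases "\<phi> \<subseteq> E")
      case True
      hence "in_coord \<phi> (slidev a b p) \<longleftrightarrow> in_coord \<phi> p" for p
        using False E(4) in_coord_slidev[of a b \<phi>] slidev_slidev[OF E(4)] by metis
      thus ?thesis using E(4) by (simp add: feasible_def)
    qed (auto simp: feasible_def)
    ultimately show ?thesis by (simp add: mem_symd)
  next
    case True
    \<comment> \<open>Twisting by \<psi> commutes with the slide, since \<psi> contains neither
      \<open>a\<close> nor \<open>b\<close>. It carries \<phi> to \<open>{a}\<close> and
      \<open>insert b \<psi>\<close> to \<open>{b}\<close>, which reduces the claim to
      singletons.\<close>
    define \<psi> where "\<psi> = \<phi> - {a}"
    have \<phi>: "\<phi> = insert a \<psi>" "\<psi> \<subseteq> E" "a \<notin> \<psi>" "b \<notin> \<psi>" using True by (auto simp: \<psi>_def)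
    have t: "insert x \<psi> \<in> feasible E K \<longleftrightarrow> {x} \<in> feasible E (twistv \<psi> ` K)" if "x \<notin> \<psi>" for x K
    proof -
      have "symd {x} \<psi> = insert x \<psi>" using that by (auto simp: symd_def)
      thus ?thesis unfolding feasible_twistv[OF \<phi>(2)] mem_twist_image by simp
    qed
    have "twistv \<psi> ` slidev a b ` L = slidev a b ` twistv \<psi> ` L"
      unfolding image_image by (rule image_cong) (use \<phi> in \<open>auto simp: bvec_eq_iff\<close>)
    hence "\<phi> \<in> feasible E (slidev a b ` L) \<longleftrightarrow> (\<phi> \<in> feasible E L) \<noteq> (insert b \<psi> \<in> feasible E L)"
      using feasible_slidev_singleton[OF E lagrangian_twistv[OF L], of \<psi>] \<phi> t by simp
    moreover have "\<phi> \<in> ?X \<longleftrightarrow> insert b \<psi> \<in> feasible E L"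
    proof
      assume "\<phi> \<in> ?X"
      then obtain \<chi> where "\<phi> = \<chi> \<union> {a}" "\<chi> \<subseteq> E - {a,b}" "\<chi> \<union> {b} \<in> feasible E L" by blast
      moreover from this have "\<chi> = \<psi>" using \<phi> by auto
      ultimately show "insert b \<psi> \<in> feasible E L" by simp
    next
      assume "insert b \<psi> \<in> feasible E L"
      thus "\<phi> \<in> ?X" using \<phi> by (intro CollectI exI[of _ \<psi>]) auto
    qed
    ultimately show ?thesis by (simp add: mem_symd)
  qed
qed

section \<open>Transport of Lagrangians along injective maps of ground sets\<close>

definition pushv :: "(nat \<Rightarrow> nat) \<Rightarrow> nat set \<Rightarrow> bvec \<Rightarrow> bvec" where
  "pushv f E p = (\<lambda>j. if j \<in> f ` E then fst p (inv_into E f j) else 0,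
                  \<lambda>j. if j \<in> f ` E then snd p (inv_into E f j) else 0)"

lemma pushv_sel [simp]:
  assumes "inj_on f E" "i \<in> E"
  shows "fst (pushv f E p) (f i) = fst p i" "snd (pushv f E p) (f i) = snd p i"
  using assms by (simp_all add: pushv_def)

lemma pushv_outside [simp]:
  assumes "j \<notin> f ` E" shows "fst (pushv f E p) j = 0" "snd (pushv f E p) j = 0"
  using assms by (simp_all add: pushv_def)

lemma sform_pushv:
  assumes "inj_on f E" shows "sform (f ` E) (pushv f E p) (pushv f E q) = sform E p q"
  unfolding sform_def using assms by (simp add: sum.reindex)

lemma pushv_surj:
  assumes "inj_on f E" "supported (f ` E) p"
  obtains q where "supported E q" "p = pushv f E q"
proof
  let ?q = "(\<lambda>i. if i \<in> E then fst p (f i) else 0, \<lambda>i. if i \<in> E then snd p (f i) else 0)"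
  show "supported E ?q" by (simp add: supported_def)
  have "fst p j = fst (pushv f E ?q) j \<and> snd p j = snd (pushv f E ?q) j" for j
    using assms by (cases "j \<in> f ` E") (auto simp: supported_def)
  thus "p = pushv f E ?q" by (simp add: bvec_eq_iff)
qed

lemma lagrangian_pushv:
  assumes f: "inj_on f E" and L: "lagrangian E L"
  shows "lagrangian (f ` E) (pushv f E ` L)"
proof (rule lagrangianI)
  fix p assume "p \<in> pushv f E ` L"
  thus "supported (f ` E) p" by (auto simp: supported_def)
next
  fix p q assume "p \<in> pushv f E ` L" "q \<in> pushv f E ` L"
  thus "sform (f ` E) p q = 0" using lagrangianD(2)[OF L] sform_pushv[OF f] by auto
next
  fix p assume p: "supported (f ` E) p" "\<And>q. q \<in> pushv f E ` L \<Longrightarrow> sform (f ` E) p q = 0"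
  obtain r where r: "supported E r" "p = pushv f E r" using pushv_surj[OF f p(1)] .
  have "sform E r q = 0" if "q \<in> L" for q
    using p(2)[of "pushv f E q"] r(2) sform_pushv[OF f, of r q] that by simp
  hence "r \<in> L" by (rule lagrangianD(3)[OF L r(1)])
  thus "p \<in> pushv f E ` L" using r by simp
qed

lemma in_coord_pushv:
  assumes "inj_on f E" "\<phi> \<subseteq> E" "supported E p"
  shows "in_coord (f ` \<phi>) (pushv f E p) \<longleftrightarrow> in_coord \<phi> p"
proof -
  have *: "f i \<in> f ` \<phi> \<longleftrightarrow> i \<in> \<phi>" if "i \<in> E" for i using assms that by (auto dest: inj_onD)
  show ?thesis
  proof
    assume c: "in_coord (f ` \<phi>) (pushv f E p)"
    have "(if i \<in> \<phi> then snd p i else fst p i) = 0" for i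
    proof (cases "i \<in> E")
      case True
      have "(if f i \<in> f ` \<phi> then snd (pushv f E p) (f i) else fst (pushv f E p) (f i)) = 0"
        using c unfolding in_coord_iff by blast
      thus ?thesis unfolding *[OF True] pushv_sel[OF assms(1) True] .
    qed (use assms in \<open>auto simp: supported_def\<close>)
    thus "in_coord \<phi> p" unfolding in_coord_iff by blast
  next
    assume c: "in_coord \<phi> p"
    have "(if j \<in> f ` \<phi> then snd (pushv f E p) j else fst (pushv f E p) j) = 0" for j
    proof (cases "j \<in> f ` E")
      case True
      then obtain i where i: "i \<in> E" "j = f i" by blast
      show ?thesis unfolding i(2) *[OF i(1)] pushv_sel[OF assms(1) i(1)]
        using c unfolding in_coord_iff by blast
    next
      case False
      moreover from this have "j \<notin> f ` \<phi>" using assms(2) by blast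
      ultimately show ?thesis by simp
    qed
    thus "in_coord (f ` \<phi>) (pushv f E p)" unfolding in_coord_iff by blast
  qed
qed

lemma pushv_eq_bzero:
  assumes "inj_on f E" "supported E p" shows "pushv f E p = bzero \<longleftrightarrow> p = bzero"
proof
  assume z: "pushv f E p = bzero"
  have "fst p i = 0 \<and> snd p i = 0" for i
  proof (cases "i \<in> E")
    case True
    thus ?thesis using z assms(1) pushv_sel[of f E i p] by simp
  qed (use assms in \<open>auto simp: supported_def\<close>)
  thus "p = bzero" by (simp add: bvec_eq_iff)
next
  assume z: "p = bzero"
  show "pushv f E p = bzero" unfolding z by (simp add: pushv_def bvec_eq_iff)
qed

lemma feasible_pushv:
  assumes f: "inj_on f E" and L: "lagrangian E L"
  shows "feasible (f ` E) (pushv f E ` L) = (\<lambda>\<phi>. f ` \<phi>) ` feasible E L"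
proof -
  have *: "f ` \<phi> \<in> feasible (f ` E) (pushv f E ` L) \<longleftrightarrow> \<phi> \<in> feasible E L" if "\<phi> \<subseteq> E" for \<phi>
    using that lagrangianD(1)[OF L] by (auto simp: feasible_def in_coord_pushv[OF f] pushv_eq_bzero[OF f])
  show ?thesis
  proof (intro equalityI subsetI)
    fix \<phi>' assume \<phi>': "\<phi>' \<in> feasible (f ` E) (pushv f E ` L)"
    then obtain \<phi> where "\<phi> \<subseteq> E" "\<phi>' = f ` \<phi>" using feasible_subset by (meson subset_imageE)
    thus "\<phi>' \<in> (\<lambda>\<phi>. f ` \<phi>) ` feasible E L" using \<phi>' * by blast
  next
    fix \<phi>' assume "\<phi>' \<in> (\<lambda>\<phi>. f ` \<phi>) ` feasible E L"
    thus "\<phi>' \<in> feasible (f ` E) (pushv f E ` L)" using * feasible_subset by blast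
  qed
qed

lemma pushv_slidev:
  assumes "inj_on f E" "a \<in> E" "b \<in> E"
  shows "pushv f E (slidev a b p) = slidev (f a) (f b) (pushv f E p)"
proof -
  have "fst (pushv f E (slidev a b p)) j = fst (slidev (f a) (f b) (pushv f E p)) j \<and>
    snd (pushv f E (slidev a b p)) j = snd (slidev (f a) (f b) (pushv f E p)) j" for j
  proof (cases "j \<in> f ` E")
    case True
    then obtain i where "i \<in> E" "j = f i" by blast
    thus ?thesis using assms by (auto dest: inj_onD)
  qed (use assms in auto)
  thus ?thesis by (simp add: bvec_eq_iff)
qed

lemma pushv_exchv:
  assumes "inj_on f E" "a \<in> E" "b \<in> E" "a \<noteq> b"
  shows "pushv f E (exchv a b p) = exchv (f a) (f b) (pushv f E p)"
proof -
  have ne: "f a \<noteq> f b" using assms by (auto dest: inj_onD)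
  have "fst (pushv f E (exchv a b p)) j = fst (exchv (f a) (f b) (pushv f E p)) j \<and>
    snd (pushv f E (exchv a b p)) j = snd (exchv (f a) (f b) (pushv f E p)) j" for j
  proof (cases "j \<in> f ` E")
    case True
    then obtain i where "i \<in> E" "j = f i" by blast
    thus ?thesis using assms ne by (auto dest: inj_onD)
  qed (use assms ne in auto)
  thus ?thesis by (simp add: bvec_eq_iff)
qed

lemma reduce_pushv:
  assumes f: "inj_on f E" and S: "S \<subseteq> E" and L: "\<And>p. p \<in> L \<Longrightarrow> supported E p"
  shows "reduce (f ` S) (pushv f E ` L) = pushv f S ` reduce S L"
proof -
  have f': "inj_on f S" using f S by (rule inj_on_subset)
  have mem: "f i \<in> f ` S \<longleftrightarrow> i \<in> S" if "i \<in> E" for i using f S that by (auto dest: inj_onD)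
  have supp: "(\<forall>j. j \<notin> f ` S \<longrightarrow> fst (pushv f E p) j = 0) \<longleftrightarrow> (\<forall>i. i \<notin> S \<longrightarrow> fst p i = 0)" if "p \<in> L" for p
  proof
    assume h: "\<forall>j. j \<notin> f ` S \<longrightarrow> fst (pushv f E p) j = 0"
    show "\<forall>i. i \<notin> S \<longrightarrow> fst p i = 0"
    proof (intro allI impI)
      fix i assume i: "i \<notin> S"
      show "fst p i = 0"
      proof (cases "i \<in> E")
        case True
        hence "fst (pushv f E p) (f i) = 0" using h mem i by blast
        thus ?thesis using True f by simp
      qed (use L[OF that] in \<open>simp add: supported_def\<close>)
    qed
  next
    assume h: "\<forall>i. i \<notin> S \<longrightarrow> fst p i = 0"
    show "\<forall>j. j \<notin> f ` S \<longrightarrow> fst (pushv f E p) j = 0"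
    proof (intro allI impI)
      fix j assume j: "j \<notin> f ` S"
      show "fst (pushv f E p) j = 0"
      proof (cases "j \<in> f ` E")
        case True
        then obtain i where "i \<in> E" "j = f i" by blast
        thus ?thesis using j h f by auto
      qed simp
    qed
  qed
  have tr: "trunc (f ` S) (pushv f E p) = pushv f S (trunc S p)" if "\<forall>j. j \<notin> f ` S \<longrightarrow> fst (pushv f E p) j = 0" for p
  proof -
    have "fst (trunc (f ` S) (pushv f E p)) j = fst (pushv f S (trunc S p)) j \<and>
       snd (trunc (f ` S) (pushv f E p)) j = snd (pushv f S (trunc S p)) j" for j
    proof (cases "j \<in> f ` S")
      case True
      then obtain i where i: "i \<in> S" "j = f i" by blast
      moreover from i S have "i \<in> E" by blast
      ultimately show ?thesis using f f' by simp
    qed (use that in simp)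
    thus ?thesis by (simp add: bvec_eq_iff)
  qed
  have "{p \<in> pushv f E ` L. \<forall>j. j \<notin> f ` S \<longrightarrow> fst p j = 0} = pushv f E ` {p \<in> L. \<forall>i. i \<notin> S \<longrightarrow> fst p i = 0}"
    using supp by blast
  moreover have "trunc (f ` S) ` pushv f E ` {p \<in> L. \<forall>i. i \<notin> S \<longrightarrow> fst p i = 0}
     = pushv f S ` trunc S ` {p \<in> L. \<forall>i. i \<notin> S \<longrightarrow> fst p i = 0}"
    unfolding image_image by (rule image_cong) (use tr supp in auto)
  ultimately show ?thesis unfolding reduce_eq_trunc by simp
qed

section \<open>Orthogonal direct sums of Lagrangians\<close>

definition sumv :: "bvec set \<Rightarrow> bvec set \<Rightarrow> bvec set" where
  "sumv L1 L2 = {bplus p q | p q. p \<in> L1 \<and> q \<in> L2}"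

lemma sumvI: "p \<in> L1 \<Longrightarrow> q \<in> L2 \<Longrightarrow> bplus p q \<in> sumv L1 L2"
  unfolding sumv_def by blast

definition cut :: "nat set \<Rightarrow> bvec \<Rightarrow> bvec" where
  "cut E p = (\<lambda>i. if i \<in> E then fst p i else 0, \<lambda>i. if i \<in> E then snd p i else 0)"

lemma cut_sel [simp]: "fst (cut E p) i = (if i \<in> E then fst p i else 0)"
   "snd (cut E p) i = (if i \<in> E then snd p i else 0)"
  by (simp_all add: cut_def)

lemma sform_Un:
  assumes "finite E1" "finite E2" "E1 \<inter> E2 = {}"
  shows "sform (E1 \<union> E2) p q = sform E1 p q + sform E2 p q"
  unfolding sform_def by (rule sum.union_disjoint[OF assms])

lemma sform_cong:
  assumes "\<And>i. i \<in> E \<Longrightarrow> fst p i = fst p' i \<and> snd p i = snd p' i"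
    "\<And>i. i \<in> E \<Longrightarrow> fst q i = fst q' i \<and> snd q i = snd q' i"
  shows "sform E p q = sform E p' q'"
  unfolding sform_def using assms by (intro sum.cong) auto

text \<open>The form splits over the two disjoint ground sets. A vector orthogonal to the sum is cut
  into its two components, and each is tested against sums in which the other summand is
  zero.\<close>

lemma lagrangian_sumv:
  assumes fin: "finite E1" "finite E2" and disj: "E1 \<inter> E2 = {}"
    and L1: "lagrangian E1 L1" and L2: "lagrangian E2 L2"
  shows "lagrangian (E1 \<union> E2) (sumv L1 L2)"
proof -
  have form: "sform (E1 \<union> E2) r (bplus p q) = sform E1 r p + sform E2 r q" if "p \<in> L1" "q \<in> L2" for p q r
  proof -
    have z: "fst p i = 0 \<and> snd p i = 0" if "i \<in> E2" for i
      using lagrangianD(1)[OF L1 \<open>p \<in> L1\<close>] that disj by (auto simp: supported_def)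
    have z': "fst q i = 0 \<and> snd q i = 0" if "i \<in> E1" for i
      using lagrangianD(1)[OF L2 \<open>q \<in> L2\<close>] that disj by (auto simp: supported_def)
    have "sform E1 r (bplus p q) = sform E1 r p" by (rule sform_cong) (use z' in auto)
    moreover have "sform E2 r (bplus p q) = sform E2 r q" by (rule sform_cong) (use z in auto)
    ultimately show ?thesis using sform_Un[OF fin disj] by simp
  qed
  have off: "sform E r p = 0" if "E \<inter> E' = {}" "supported E' p" for E E' r p
    unfolding sform_def using that by (intro sum.neutral ballI) (auto simp: supported_def disjoint_iff)
  have cut: "sform E (cut E r) p = sform E r p" for E r p by (rule sform_cong) auto
  show ?thesis
  proof (rule lagrangianI)
    fix r assume "r \<in> sumv L1 L2"
    then obtain p q where "r = bplus p q" "p \<in> L1" "q \<in> L2" unfolding sumv_def by blast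
    thus "supported (E1 \<union> E2) r" using lagrangianD(1)[OF L1, of p] lagrangianD(1)[OF L2, of q]
      by (simp add: supported_def)
  next
    fix r s assume "r \<in> sumv L1 L2" "s \<in> sumv L1 L2"
    then obtain p q p' q' where *: "r = bplus p q" "s = bplus p' q'" "p \<in> L1" "q \<in> L2" "p' \<in> L1" "q' \<in> L2"
      unfolding sumv_def by blast
    have "sform (E1 \<union> E2) s r = sform E1 s p + sform E2 s q" unfolding *(1) by (rule form[OF *(3,4)])
    moreover have "sform E1 s p = sform E1 p p'"
      unfolding *(2) sform_commute[of _ "bplus p' q'"] sform_bplus2
      using off[OF _ lagrangianD(1)[OF L2 *(6)], of E1 p] disj by simp
    moreover have "sform E2 s q = sform E2 q q'"
      unfolding *(2) sform_commute[of _ "bplus p' q'"] sform_bplus2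
      using off[OF _ lagrangianD(1)[OF L1 *(5)], of E2 q] disj by (simp add: Int_commute)
    ultimately show "sform (E1 \<union> E2) r s = 0"
      using lagrangianD(2)[OF L1 *(3,5)] lagrangianD(2)[OF L2 *(4,6)] by (simp add: sform_commute)
  next
    fix r assume r: "supported (E1 \<union> E2) r" and orth: "\<And>s. s \<in> sumv L1 L2 \<Longrightarrow> sform (E1 \<union> E2) r s = 0"
    have "cut E1 r \<in> L1"
    proof (rule lagrangianD(3)[OF L1])
      show "supported E1 (cut E1 r)" by (simp add: supported_def)
      fix p assume p: "p \<in> L1"
      have "bplus p bzero \<in> sumv L1 L2" using p lagrangian_bzero[OF L2] by (rule sumvI)
      from orth[OF this] show "sform E1 (cut E1 r) p = 0"
        using form[OF p lagrangian_bzero[OF L2], of r] by (simp add: cut)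
    qed
    moreover have "cut E2 r \<in> L2"
    proof (rule lagrangianD(3)[OF L2])
      show "supported E2 (cut E2 r)" by (simp add: supported_def)
      fix q assume q: "q \<in> L2"
      have "bplus bzero q \<in> sumv L1 L2" using lagrangian_bzero[OF L1] q by (rule sumvI)
      from orth[OF this] show "sform E2 (cut E2 r) q = 0"
        using form[OF lagrangian_bzero[OF L1] q, of r] by (simp add: cut)
    qed
    moreover have "r = bplus (cut E1 r) (cut E2 r)"
      using r disj by (auto simp: bvec_eq_iff supported_def)
    ultimately show "r \<in> sumv L1 L2" unfolding sumv_def by blast
  qed
qed

lemma feasible_sumv:
  assumes disj: "E1 \<inter> E2 = {}" and L1: "lagrangian E1 L1" and L2: "lagrangian E2 L2"
  shows "feasible (E1 \<union> E2) (sumv L1 L2) = {\<phi>1 \<union> \<phi>2 | \<phi>1 \<phi>2. \<phi>1 \<in> feasible E1 L1 \<and> \<phi>2 \<in> feasible E2 L2}"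
proof -
  have ic: "in_coord (\<phi>1 \<union> \<phi>2) (bplus p q) \<longleftrightarrow> in_coord \<phi>1 p \<and> in_coord \<phi>2 q"
    if "\<phi>1 \<subseteq> E1" "\<phi>2 \<subseteq> E2" "p \<in> L1" "q \<in> L2" for \<phi>1 \<phi>2 p q
  proof -
    have "(if i \<in> \<phi>1 \<union> \<phi>2 then snd (bplus p q) i else fst (bplus p q) i) = 0 \<longleftrightarrow>
       (if i \<in> \<phi>1 then snd p i else fst p i) = 0 \<and> (if i \<in> \<phi>2 then snd q i else fst q i) = 0" for i
      using that disj lagrangianD(1)[OF L1 that(3)] lagrangianD(1)[OF L2 that(4)]
      by (cases "i \<in> E1"; cases "i \<in> E2") (auto simp: supported_def)
    thus ?thesis unfolding in_coord_iff by blast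
  qed
  have z: "bplus p q = bzero \<longleftrightarrow> p = bzero \<and> q = bzero" if "p \<in> L1" "q \<in> L2" for p q
  proof -
    have "fst (bplus p q) i = 0 \<and> snd (bplus p q) i = 0 \<longleftrightarrow> fst p i = 0 \<and> snd p i = 0 \<and> fst q i = 0 \<and> snd q i = 0" for i
      using that disj lagrangianD(1)[OF L1 that(1)] lagrangianD(1)[OF L2 that(2)]
      by (cases "i \<in> E1"; cases "i \<in> E2") (auto simp: supported_def)
    thus ?thesis unfolding bvec_eq_iff bzero_sel by blast
  qed
  have *: "\<phi>1 \<union> \<phi>2 \<in> feasible (E1 \<union> E2) (sumv L1 L2) \<longleftrightarrow> \<phi>1 \<in> feasible E1 L1 \<and> \<phi>2 \<in> feasible E2 L2"
    if s: "\<phi>1 \<subseteq> E1" "\<phi>2 \<subseteq> E2" for \<phi>1 \<phi>2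
  proof -
    \<comment> \<open>The zero vector lies in both Lagrangians and in every coordinate Lagrangian;
      inserting it for one summand separates the joint condition into two.\<close>
    have "in_coord \<phi> bzero" for \<phi> by (simp add: in_coord_def)
    hence "(\<forall>p\<in>L1. \<forall>q\<in>L2. in_coord \<phi>1 p \<and> in_coord \<phi>2 q \<longrightarrow> p = bzero \<and> q = bzero) \<longleftrightarrow>
      (\<forall>p\<in>L1. in_coord \<phi>1 p \<longrightarrow> p = bzero) \<and> (\<forall>q\<in>L2. in_coord \<phi>2 q \<longrightarrow> q = bzero)"
      using lagrangian_bzero[OF L1] lagrangian_bzero[OF L2] by blast
    moreover have "\<phi>1 \<union> \<phi>2 \<in> feasible (E1 \<union> E2) (sumv L1 L2) \<longleftrightarrow>
      (\<forall>p\<in>L1. \<forall>q\<in>L2. in_coord (\<phi>1 \<union> \<phi>2) (bplus p q) \<longrightarrow> bplus p q = bzero)"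
      using s unfolding feasible_def sumv_def by blast
    moreover have "\<dots> \<longleftrightarrow> (\<forall>p\<in>L1. \<forall>q\<in>L2. in_coord \<phi>1 p \<and> in_coord \<phi>2 q \<longrightarrow> p = bzero \<and> q = bzero)"
      using ic[OF s] z by simp
    ultimately show ?thesis using s unfolding feasible_def by blast
  qed
  show ?thesis
  proof (intro equalityI subsetI)
    fix \<phi> assume \<phi>: "\<phi> \<in> feasible (E1 \<union> E2) (sumv L1 L2)"
    have "\<phi> = (\<phi> \<inter> E1) \<union> (\<phi> \<inter> E2)" using feasible_subset[OF \<phi>] by blast
    thus "\<phi> \<in> {\<phi>1 \<union> \<phi>2 | \<phi>1 \<phi>2. \<phi>1 \<in> feasible E1 L1 \<and> \<phi>2 \<in> feasible E2 L2}"
      using *[of "\<phi> \<inter> E1" "\<phi> \<inter> E2"] \<phi> by auto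
  next
    fix \<phi> assume "\<phi> \<in> {\<phi>1 \<union> \<phi>2 | \<phi>1 \<phi>2. \<phi>1 \<in> feasible E1 L1 \<and> \<phi>2 \<in> feasible E2 L2}"
    thus "\<phi> \<in> feasible (E1 \<union> E2) (sumv L1 L2)" using * feasible_subset by blast
  qed
qed

lemma reduce_sumv:
  assumes disj: "E1 \<inter> E2 = {}" and L: "\<And>p. p \<in> L1 \<Longrightarrow> supported E1 p" "\<And>q. q \<in> L2 \<Longrightarrow> supported E2 q"
    and S: "S1 \<subseteq> E1" "S2 \<subseteq> E2"
  shows "reduce (S1 \<union> S2) (sumv L1 L2) = sumv (reduce S1 L1) (reduce S2 L2)"
proof -
  have supp: "(\<forall>i. i \<notin> S1 \<union> S2 \<longrightarrow> fst (bplus p q) i = 0) \<longleftrightarrow>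
      (\<forall>i. i \<notin> S1 \<longrightarrow> fst p i = 0) \<and> (\<forall>i. i \<notin> S2 \<longrightarrow> fst q i = 0)" if "p \<in> L1" "q \<in> L2" for p q
  proof -
    have "(i \<notin> S1 \<union> S2 \<longrightarrow> fst (bplus p q) i = 0) \<longleftrightarrow> (i \<notin> S1 \<longrightarrow> fst p i = 0) \<and> (i \<notin> S2 \<longrightarrow> fst q i = 0)" for i
      using L(1)[OF that(1)] L(2)[OF that(2)] S disj
      by (cases "i \<in> E1"; cases "i \<in> E2") (auto simp: supported_def)
    thus ?thesis by blast
  qed
  have tr: "trunc (S1 \<union> S2) (bplus p q) = bplus (trunc S1 p) (trunc S2 q)" if "p \<in> L1" "q \<in> L2" for p q
  proof -
    have "snd (trunc (S1 \<union> S2) (bplus p q)) i = snd (bplus (trunc S1 p) (trunc S2 q)) i" for i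
      using L(1)[OF that(1)] L(2)[OF that(2)] S disj
      by (cases "i \<in> E1"; cases "i \<in> E2") (auto simp: supported_def)
    thus ?thesis by (simp add: bvec_eq_iff)
  qed
  show ?thesis
  proof (intro equalityI subsetI)
    fix r assume "r \<in> reduce (S1 \<union> S2) (sumv L1 L2)"
    then obtain p q where "p \<in> L1" "q \<in> L2" "\<forall>i. i \<notin> S1 \<union> S2 \<longrightarrow> fst (bplus p q) i = 0"
      "r = trunc (S1 \<union> S2) (bplus p q)" unfolding reduce_eq_trunc sumv_def by blast
    thus "r \<in> sumv (reduce S1 L1) (reduce S2 L2)" using supp tr
      unfolding reduce_eq_trunc sumv_def by blast
  next
    fix r assume "r \<in> sumv (reduce S1 L1) (reduce S2 L2)"
    then obtain p q where "p \<in> L1" "q \<in> L2" "\<forall>i. i \<notin> S1 \<longrightarrow> fst p i = 0" "\<forall>i. i \<notin> S2 \<longrightarrow> fst q i = 0"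
      "r = bplus (trunc S1 p) (trunc S2 q)" unfolding reduce_eq_trunc sumv_def by blast
    thus "r \<in> reduce (S1 \<union> S2) (sumv L1 L2)" using supp[of p q] tr[of p q] sumvI[of p L1 q L2]
      unfolding reduce_eq_trunc by (intro image_eqI[of _ _ "bplus p q"]) simp_all
  qed
qed

section \<open>Binary delta-matroids are the transversal families of Lagrangians\<close>

definition graphv :: "(nat \<Rightarrow> nat \<Rightarrow> bit) \<Rightarrow> nat set \<Rightarrow> bvec set" where
  "graphv A E = {(u, \<lambda>i. if i \<in> E then \<Sum>j\<in>E. A i j * u j else 0) | u. \<forall>i. i \<notin> E \<longrightarrow> u i = 0}"

lemma mem_graphv:
  "p \<in> graphv A E \<longleftrightarrow> supported E p \<and> (\<forall>i\<in>E. snd p i = (\<Sum>j\<in>E. A i j * fst p j))"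
proof
  assume "p \<in> graphv A E"
  thus "supported E p \<and> (\<forall>i\<in>E. snd p i = (\<Sum>j\<in>E. A i j * fst p j))"
    by (auto simp: graphv_def supported_def)
next
  assume p: "supported E p \<and> (\<forall>i\<in>E. snd p i = (\<Sum>j\<in>E. A i j * fst p j))"
  hence "p = (fst p, \<lambda>i. if i \<in> E then \<Sum>j\<in>E. A i j * fst p j else 0)"
    by (simp add: bvec_eq_iff supported_def)
  moreover have "\<forall>i. i \<notin> E \<longrightarrow> fst p i = 0" using p by (simp add: supported_def)
  ultimately show "p \<in> graphv A E" unfolding graphv_def by blast
qed

lemma graphv_cong:
  assumes "\<And>i j. i \<in> E \<Longrightarrow> j \<in> E \<Longrightarrow> A i j = B i j" shows "graphv A E = graphv B E"
proof -
  have "(\<Sum>j\<in>E. A i j * u j) = (\<Sum>j\<in>E. B i j * u j)" if "i \<in> E" for i u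
    using assms that by (intro sum.cong) simp_all
  thus ?thesis unfolding set_eq_iff mem_graphv by simp
qed

definition xv :: "nat \<Rightarrow> nat \<Rightarrow> bit" where "xv k = (\<lambda>i. if i = k then 1 else 0)"

lemma sform_xv:
  assumes "finite E" "k \<in> E"
  shows "sform E p (xv k, v) = (\<Sum>i\<in>E. v i * fst p i) + snd p k"
  using assms by (simp add: sform_def xv_def sum.distrib mult.commute if_distrib[of "\<lambda>x. x * _"] if_distrib[of "\<lambda>x. _ * x"] cong: if_cong)

lemma lagrangian_graphv:
  assumes E: "finite E" and sym: "\<And>i j. i \<in> E \<Longrightarrow> j \<in> E \<Longrightarrow> A i j = A j i"
  shows "lagrangian E (graphv A E)"
proof (rule lagrangianI)
  fix p assume "p \<in> graphv A E" thus "supported E p" by (simp add: mem_graphv)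
next
  fix p q assume p: "p \<in> graphv A E" and q: "q \<in> graphv A E"
  have "sform E p q = (\<Sum>i\<in>E. fst p i * snd q i) + (\<Sum>i\<in>E. snd p i * fst q i)"
    by (simp add: sform_def sum.distrib)
  also have "(\<Sum>i\<in>E. fst p i * snd q i) = (\<Sum>i\<in>E. \<Sum>j\<in>E. fst p i * (A i j * fst q j))"
    using q by (intro sum.cong refl) (simp add: mem_graphv sum_distrib_left)
  also have "\<dots> = (\<Sum>j\<in>E. \<Sum>i\<in>E. fst p i * (A i j * fst q j))" by (rule sum.swap)
  also have "\<dots> = (\<Sum>j\<in>E. \<Sum>i\<in>E. A j i * fst p i * fst q j)"
    using sym by (intro sum.cong refl) (simp add: mult_ac)
  also have "\<dots> = (\<Sum>j\<in>E. snd p j * fst q j)"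
    using p by (intro sum.cong refl) (simp add: mem_graphv sum_distrib_right)
  finally show "sform E p q = 0" by simp
next
  fix p assume p: "supported E p" and orth: "\<And>q. q \<in> graphv A E \<Longrightarrow> sform E p q = 0"
  have "snd p k = (\<Sum>j\<in>E. A k j * fst p j)" if k: "k \<in> E" for k
  proof -
    let ?v = "\<lambda>i. if i \<in> E then A i k else 0"
    \<comment> \<open>The vector of the graph over the \<open>k\<close>-th unit vector:
      orthogonality to it states the \<open>k\<close>-th equation of the graph.\<close>
    have "(xv k, ?v) \<in> graphv A E" unfolding mem_graphv using E k
      by (simp add: supported_def xv_def if_distrib[of "\<lambda>x. _ * x"] cong: if_cong)
    hence "sform E p (xv k, ?v) = 0" by (rule orth)
    hence "(\<Sum>i\<in>E. ?v i * fst p i) = snd p k" unfolding sform_xv[OF E k] by simp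
    moreover have "(\<Sum>i\<in>E. ?v i * fst p i) = (\<Sum>j\<in>E. A k j * fst p j)"
      by (rule sum.cong) (use sym k in simp_all)
    ultimately show ?thesis by simp
  qed
  thus "p \<in> graphv A E" using p by (simp add: mem_graphv)
qed

text \<open>The graph meets the coordinate Lagrangian of \<phi> in the pairs (u, Mu) with u
  supported on \<phi> and Mu vanishing on \<phi>, that is, in the kernel of the principal
  submatrix.\<close>

lemma feasible_graphv:
  assumes E: "finite E"
  shows "feasible E (graphv (bitmat M) E) = {\<phi>. \<phi> \<subseteq> E \<and> nondeg_F2 M \<phi>}"
proof -
  have "(\<forall>p\<in>graphv (bitmat M) E. in_coord \<phi> p \<longrightarrow> p = bzero) \<longleftrightarrow> nondeg_F2 M \<phi>" if \<phi>: "\<phi> \<subseteq> E" for \<phi>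
  proof -
    have s: "(\<Sum>j\<in>E. bitmat M i j * u j) = (\<Sum>j\<in>\<phi>. bitmat M i j * u j)" if "\<forall>i. i \<notin> \<phi> \<longrightarrow> u i = 0" for i u
      using that \<phi> E by (intro sum.mono_neutral_right) auto
    have fin: "finite \<phi>" using \<phi> E finite_subset by blast
    show ?thesis unfolding nondeg_F2_iff_kernel[OF fin]
    proof (intro iffI allI impI ballI)
      fix u i assume h: "\<forall>p\<in>graphv (bitmat M) E. in_coord \<phi> p \<longrightarrow> p = bzero"
        and u: "(\<forall>i. i \<notin> \<phi> \<longrightarrow> u i = 0) \<and> (\<forall>i\<in>\<phi>. (\<Sum>j\<in>\<phi>. bitmat M i j * u j) = 0)"
      let ?p = "(u, \<lambda>i. if i \<in> E then \<Sum>j\<in>E. bitmat M i j * u j else 0)"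
      have "?p \<in> graphv (bitmat M) E" using u \<phi> unfolding graphv_def by blast
      moreover have "in_coord \<phi> ?p" using u \<phi> s by (simp add: in_coord_def)
      ultimately have "?p = bzero" using h by blast
      thus "u i = 0" by (simp add: bzero_def fun_eq_iff)
    next
      fix p assume h: "\<forall>u. (\<forall>i. i \<notin> \<phi> \<longrightarrow> u i = 0) \<and> (\<forall>i\<in>\<phi>. (\<Sum>j\<in>\<phi>. bitmat M i j * u j) = 0) \<longrightarrow> (\<forall>i. u i = 0)"
        and p: "p \<in> graphv (bitmat M) E" "in_coord \<phi> p"
      have u0: "\<forall>i. i \<notin> \<phi> \<longrightarrow> fst p i = 0" using p(2) by (simp add: in_coord_def)
      have "\<forall>i\<in>\<phi>. (\<Sum>j\<in>\<phi>. bitmat M i j * fst p j) = 0"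
      proof
        fix i assume i: "i \<in> \<phi>"
        hence "(\<Sum>j\<in>E. bitmat M i j * fst p j) = snd p i" using p(1) \<phi> by (auto simp: mem_graphv)
        also have "\<dots> = 0" using p(2) i by (simp add: in_coord_def)
        finally show "(\<Sum>j\<in>\<phi>. bitmat M i j * fst p j) = 0" unfolding s[OF u0] .
      qed
      hence z: "\<forall>i. fst p i = 0" using h u0 by blast
      have "snd p i = 0" for i
        using p(1) z by (cases "i \<in> E") (simp_all add: mem_graphv supported_def)
      thus "p = bzero" using z by (simp add: bvec_eq_iff)
    qed
  qed
  thus ?thesis unfolding feasible_def by blast
qed

text \<open>Feasibility of the empty set says that no nonzero vector of \<open>L\<close> has first
  component 0. A dimension count would then make the projection to first components onto; here
  induction by deletion replaces the count.\<close>

lemma feasible_empty_total: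
  assumes "finite E" "lagrangian E L" "{} \<in> feasible E L" "\<And>i. i \<notin> E \<Longrightarrow> u i = 0"
  shows "\<exists>v. (u, v) \<in> L"
  using assms
proof (induction E arbitrary: L u rule: finite_induct)
  case empty
  have "(u, \<lambda>_. 0) = bzero" using empty.prems(3) by (simp add: bzero_def fun_eq_iff)
  hence "(u, \<lambda>_. 0) \<in> L" using lagrangian_bzero[OF empty.prems(1)] by simp
  thus ?case by blast
next
  case (insert e E)
  note L = insert.prems(1)
  have EE: "insert e E - {e} = E" using insert.hyps by auto
  have y: "yv e \<notin> L"
  proof
    assume "yv e \<in> L"
    from feasible_coloop[OF this insert.prems(2)] show False by simp
  qed
  have L': "lagrangian E (reduce E L)" using lagrangian_reduce_delete[OF L, of e] insert.hyps EE by simp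
  have f': "{} \<in> feasible E (reduce E L)"
    using feasible_reduce_noncoloop[OF L _ y, of "{}"] insert.prems(2) EE by simp
  have lift: "\<exists>v. (w, v) \<in> L" if w: "\<And>i. i \<notin> E \<Longrightarrow> w i = 0" for w
  proof -
    have "\<exists>v. (w, v) \<in> reduce E L" by (rule insert.IH[OF L' f']) (rule w)
    then obtain v where v: "(w, v) \<in> reduce E L" by blast
    then obtain q where q: "q \<in> L" "\<forall>i. i \<notin> E \<longrightarrow> fst q i = 0" "\<forall>i. fst (w, v) i = fst q i"
      "\<forall>i. snd (w, v) i = (if i \<in> E then snd q i else 0)" by (rule reduceE)
    from q(3) have "q = (w, snd q)" by (simp add: prod_eq_iff fun_eq_iff)
    with q(1) have "(w, snd q) \<in> L" by simp
    thus ?thesis by blast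
  qed
  show ?case
  proof (cases "u e = 0")
    case True
    show ?thesis
    proof (rule lift)
      fix i assume "i \<notin> E" thus "u i = 0" using True insert.prems(3)[of i] by (cases "i = e") simp_all
    qed
  next
    case False
    \<comment> \<open>If every vector of \<open>L\<close> had first coordinate 0 at
      \<open>e\<close>, then \<open>yv e\<close> would be orthogonal to \<open>L\<close> and hence
      belong to it.\<close>
    obtain q where q: "q \<in> L" "fst q e \<noteq> 0"
    proof (rule ccontr)
      assume "\<not> thesis"
      hence "\<forall>q\<in>L. fst q e = 0" using that by blast
      hence "sform (insert e E) (yv e) q = 0" if "q \<in> L" for q using that insert.hyps by simp
      moreover have "supported (insert e E) (yv e)" by (simp add: supported_def)
      ultimately show False using y lagrangianD(3)[OF L] by blast
    qed
    \<comment> \<open>Both \<open>u\<close> and \<open>fst q\<close> are 1 at \<open>e\<close>, so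
      their sum is supported on \<open>E\<close> and lifts to \<open>L\<close>; adding
      \<open>q\<close> back gives a lift of \<open>u\<close>.\<close>
    have "\<exists>v. ((\<lambda>i. u i + fst q i), v) \<in> L"
    proof (rule lift)
      fix i assume "i \<notin> E"
      thus "u i + fst q i = 0" using False q(2) insert.prems(3)[of i] lagrangianD(1)[OF L q(1)]
        by (cases "i = e") (simp_all add: supported_def)
    qed
    then obtain v where "((\<lambda>i. u i + fst q i), v) \<in> L" by blast
    from lagrangian_bplus[OF L this q(1)] show ?thesis
      by (auto simp: bplus_def add.assoc)
  qed
qed

text \<open>The rows of the matrix are the lifts to \<open>L\<close> of the unit vectors. Isotropy
  of \<open>L\<close> against these lifts gives both the symmetry of the matrix and the equations of
  the graph; lifts of arbitrary first components give the other inclusion.\<close>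

lemma lagrangian_eq_graphv:
  assumes E: "finite E" and L: "lagrangian E L" and f: "{} \<in> feasible E L"
  obtains A where "\<And>i j. i \<in> E \<Longrightarrow> j \<in> E \<Longrightarrow> A i j = A j i" "L = graphv A E"
proof -
  have "\<exists>v. (xv k, v) \<in> L" if "k \<in> E" for k
    by (rule feasible_empty_total[OF E L f]) (use that in \<open>auto simp: xv_def\<close>)
  then obtain V where V: "\<And>k. k \<in> E \<Longrightarrow> (xv k, V k) \<in> L" by metis
  have row: "snd p k = (\<Sum>j\<in>E. V k j * fst p j)" if "p \<in> L" "k \<in> E" for p k
    using lagrangianD(2)[OF L that(1) V[OF that(2)]] unfolding sform_xv[OF E that(2)] by simp
  have sym: "V i j = V j i" if "i \<in> E" "j \<in> E" for i j
    using row[OF V[OF that(1)] that(2)] E that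
    by (simp add: xv_def if_distrib[of "\<lambda>x. _ * x"] cong: if_cong)
  have "L = graphv V E"
  proof (intro equalityI subsetI)
    fix p assume "p \<in> L" thus "p \<in> graphv V E" using row lagrangianD(1)[OF L] by (simp add: mem_graphv)
  next
    fix p assume p: "p \<in> graphv V E"
    have "\<exists>v. (fst p, v) \<in> L"
      by (rule feasible_empty_total[OF E L f]) (use p in \<open>auto simp: mem_graphv supported_def\<close>)
    then obtain v where v: "(fst p, v) \<in> L" by blast
    have "v i = snd p i" for i
      using p row[OF v, of i] lagrangianD(1)[OF L v] by (cases "i \<in> E") (auto simp: mem_graphv supported_def)
    hence "(fst p, v) = p" by (simp add: prod_eq_iff fun_eq_iff)
    thus "p \<in> L" using v by simp
  qed
  thus thesis using that sym by blast
qed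

section \<open>The correspondence between Lagrangians and binary delta-matroids\<close>

definition represents :: "bvec set \<Rightarrow> ss \<Rightarrow> bool" where
  "represents L D \<longleftrightarrow> lagrangian {..<fst D} L \<and> snd D = feasible {..<fst D} L"

lemma binary_dm_represents:
  assumes "binary_dm D" shows "\<exists>L. represents L D"
proof -
  obtain W adj fr X f where W: "framed_graph W adj" "X \<subseteq> W" "bij_betw f W {..<fst D}"
    "snd D = (\<lambda>\<phi>. f ` \<phi>) ` ((\<lambda>\<phi>. symd \<phi> X) ` nondeg_dm W adj fr)"
    using assms unfolding binary_dm_def by (elim conjE exE)
  define A where "A = bitmat (fg_matrix adj fr)"
  have fin: "finite W" using W(1) by (simp add: framed_graph_def)
  have sym: "A i j = A j i" for i j
  proof -
    have "adj i j = adj j i" using W(1) unfolding framed_graph_def by blast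
    thus ?thesis by (simp add: A_def bitmat_def fg_matrix_def)
  qed
  have L: "lagrangian W (twistv X ` graphv A W)"
    using lagrangian_twistv lagrangian_graphv fin sym by blast
  have f: "inj_on f W" "f ` W = {..<fst D}" using W(3) by (auto simp: bij_betw_def)
  have "feasible W (twistv X ` graphv A W) = (\<lambda>\<phi>. symd \<phi> X) ` nondeg_dm W adj fr"
    unfolding feasible_twistv[OF W(2)] A_def feasible_graphv[OF fin] nondeg_dm_def ..
  hence "represents (pushv f W ` twistv X ` graphv A W) D"
    using lagrangian_pushv[OF f(1) L] feasible_pushv[OF f(1) L] f(2) W(4) by (simp add: represents_def)
  thus ?thesis by blast
qed

text \<open>A twist by any feasible set makes the empty set feasible, so the twisted Lagrangian is
  the graph of a symmetric matrix.\<close>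

lemma represents_binary_dm:
  assumes "represents L D" shows "binary_dm D"
proof -
  let ?E = "{..<fst D}"
  have L: "lagrangian ?E L" and D: "snd D = feasible ?E L" using assms by (auto simp: represents_def)
  have ne: "feasible ?E L \<noteq> {}" using feasible_nonempty[OF _ L] by simp
  then obtain X where X: "X \<in> feasible ?E L" by blast
  hence XE: "X \<subseteq> ?E" by (rule feasible_subset)
  have L1: "lagrangian ?E (twistv X ` L)" by (rule lagrangian_twistv[OF L])
  have "{} \<in> feasible ?E (twistv X ` L)" unfolding feasible_twistv[OF XE] mem_twist_image
    using X by (simp add: symd_def)
  then obtain A where A: "\<And>i j. i \<in> ?E \<Longrightarrow> j \<in> ?E \<Longrightarrow> A i j = A j i" "twistv X ` L = graphv A ?E"
    using lagrangian_eq_graphv[OF _ L1] by blast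
  \<comment> \<open>A symmetric matrix over F_2 is a framed graph once its diagonal is split off as
    the framing. Adjacency is cut down to \<open>?E\<close> because \<open>framed_graph\<close> asks
    for symmetry on all of \<open>nat\<close>, while \<open>A\<close> is symmetric on
    \<open>?E\<close> only.\<close>
  define adj where "adj i j \<longleftrightarrow> i \<noteq> j \<and> i \<in> ?E \<and> j \<in> ?E \<and> A i j = 1" for i j
  define fr where "fr i \<longleftrightarrow> A i i = 1" for i
  have "bitmat (fg_matrix adj fr) i j = A i j" if "i \<in> ?E" "j \<in> ?E" for i j
    using that by (cases "A i j") (auto simp: bitmat_def fg_matrix_def adj_def fr_def)
  hence "graphv (bitmat (fg_matrix adj fr)) ?E = graphv A ?E"
    by (rule graphv_cong)
  hence L2: "twistv X ` L = graphv (bitmat (fg_matrix adj fr)) ?E" using A(2) by simp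
  have "feasible ?E L = feasible ?E (twistv X ` graphv (bitmat (fg_matrix adj fr)) ?E)"
    unfolding L2[symmetric] by (simp add: image_image)
  hence eq: "snd D = (\<lambda>\<phi>. id ` \<phi>) ` ((\<lambda>\<phi>. symd \<phi> X) ` nondeg_dm ?E adj fr)"
    unfolding feasible_twistv[OF XE] feasible_graphv[OF finite_lessThan] nondeg_dm_def D by simp
  have sym: "adj i j = adj j i" for i j
    using A(1)[of i j] unfolding adj_def by (cases "i \<in> ?E \<and> j \<in> ?E") auto
  have "framed_graph ?E adj" unfolding framed_graph_def using sym by (simp add: adj_def)
  moreover have "bij_betw id ?E ?E" by simp
  moreover have "wf_ss D" using ne feasible_subset unfolding wf_ss_def D by blast
  ultimately show ?thesis unfolding binary_dm_def using XE eq by blast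
qed

section \<open>Operations on binary delta-matroids\<close>

lemma ss_eqI: "fst D = fst D' \<Longrightarrow> snd D = snd D' \<Longrightarrow> D = D'" for D D' :: ss
  by (rule prod_eqI)

text \<open>This is how two set systems on the same ground set are identified below: one Lagrangian
  represents both.\<close>

lemma represents_unique: "represents L D \<Longrightarrow> represents L D' \<Longrightarrow> fst D = fst D' \<Longrightarrow> D = D'"
  by (rule ss_eqI) (simp_all add: represents_def)

lemma fst_ops [simp]:
  "fst (slide a b D) = fst D" "fst (exch a b D) = fst D" "fst (twist X D) = fst D"
  "fst (dsum D D') = fst D + fst D'" "fst (restr E' D) = card E'" "fst unit_ss = 0"
  by (simp_all add: slide_def exch_def twist_def dsum_def restr_def unit_ss_def Let_def)

lemma represents_twist:
  assumes "represents L D" "X \<subseteq> {..<fst D}" shows "represents (twistv X ` L) (twist X D)"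
  using assms by (simp add: represents_def lagrangian_twistv feasible_twistv twist_def)

lemma represents_slide:
  assumes "represents L D" "a < fst D" "b < fst D" "a \<noteq> b"
  shows "represents (slidev a b ` L) (slide a b D)"
proof -
  have ab: "finite {..<fst D}" "a \<in> {..<fst D}" "b \<in> {..<fst D}" using assms by auto
  have L: "lagrangian {..<fst D} L" using assms by (simp add: represents_def)
  show ?thesis unfolding represents_def fst_ops
    using lagrangian_slidev[OF ab assms(4) L] feasible_slidev[OF ab assms(4) L] assms(1)
    by (simp add: slide_def represents_def)
qed

lemma represents_exch:
  assumes "represents L D" "a < fst D" "b < fst D" "a \<noteq> b"
  shows "represents (exchv a b ` L) (exch a b D)"
proof -
  have "represents (twistv {b} ` slidev a b ` twistv {b} ` L) (exch a b D)"
    unfolding exch_def using assms by (intro represents_twist represents_slide) simp_all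
  thus ?thesis by (simp add: exchv_def image_image)
qed

lemma represents_unit: "represents {bzero} unit_ss"
proof -
  have "supported {} p \<longleftrightarrow> p = bzero" for p by (simp add: supported_def bvec_eq_iff)
  thus ?thesis by (auto simp: represents_def lagrangian_def feasible_def unit_ss_def sform_def)
qed

lemma shift_image: "(\<lambda>x. x + m) ` {..<n} = {m..<m + n}" for m n :: nat
  by (simp add: lessThan_atLeast0 add.commute)

lemma represents_dsum:
  assumes "represents L1 D1" "represents L2 D2"
  shows "represents (sumv L1 (pushv (\<lambda>x. x + fst D1) {..<fst D2} ` L2)) (dsum D1 D2)"
proof -
  let ?f = "\<lambda>x. x + fst D1" and ?E = "{..<fst D2}"
  have f: "inj_on ?f ?E" by (simp add: inj_on_def)
  have L1: "lagrangian {..<fst D1} L1" and L2: "lagrangian ?E L2"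
    and s: "snd D1 = feasible {..<fst D1} L1" "snd D2 = feasible ?E L2" using assms by (simp_all add: represents_def)
  note L2' = lagrangian_pushv[OF f L2]
  have disj: "{..<fst D1} \<inter> ?f ` ?E = {}" by auto
  have un: "{..<fst D1} \<union> ?f ` ?E = {..<fst D1 + fst D2}" unfolding shift_image by auto
  have "snd (dsum D1 D2) = {\<phi>1 \<union> \<phi>2 | \<phi>1 \<phi>2. \<phi>1 \<in> feasible {..<fst D1} L1 \<and> \<phi>2 \<in> (\<lambda>\<phi>. ?f ` \<phi>) ` feasible ?E L2}"
    unfolding dsum_def snd_conv s by blast
  also have "\<dots> = feasible ({..<fst D1} \<union> ?f ` ?E) (sumv L1 (pushv ?f ?E ` L2))"
    unfolding feasible_sumv[OF disj L1 L2'] feasible_pushv[OF f L2] ..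
  finally show ?thesis using lagrangian_sumv[OF _ _ disj L1 L2'] unfolding represents_def un fst_ops by simp
qed

section \<open>Restriction and its relabelling by ranks\<close>

lemma bij_relabel: assumes "finite E'" shows "bij_betw (relabel E') E' {..<card E'}"
proof -
  have lt: "relabel E' x < card E'" if "x \<in> E'" for x
    unfolding relabel_def using that assms by (intro psubset_card_mono) auto
  have mono: "relabel E' x < relabel E' y" if "x \<in> E'" "x < y" for x y
    unfolding relabel_def using that assms by (intro psubset_card_mono) auto
  have inj: "inj_on (relabel E') E'"
  proof (rule inj_onI)
    fix x y assume "x \<in> E'" "y \<in> E'" "relabel E' x = relabel E' y"
    thus "x = y" using mono[of x y] mono[of y x] by (cases x y rule: linorder_cases) auto
  qed
  moreover have "relabel E' ` E' = {..<card E'}"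
    by (rule card_subset_eq) (use lt card_image[OF inj] in auto)
  ultimately show ?thesis by (simp add: bij_betw_def)
qed

lemma inj_relabel: "finite E' \<Longrightarrow> inj_on (relabel E') E'"
  using bij_relabel by (simp add: bij_betw_def)

lemma relabel_image: "finite E' \<Longrightarrow> relabel E' ` E' = {..<card E'}"
  using bij_relabel by (simp add: bij_betw_def)

lemma relabel_less: "finite E' \<Longrightarrow> x \<in> E' \<Longrightarrow> relabel E' x < card E'"
  using relabel_image by blast

lemma snd_restr:
  assumes "represents L D" "E' \<subseteq> {..<fst D}"
  shows "snd (restr E' D) = (\<lambda>\<phi>. relabel E' ` \<phi>) ` feasible E' (reduce E' L)"
proof -
  have L: "lagrangian {..<fst D} L" and s: "snd D = feasible {..<fst D} L" using assms by (simp_all add: represents_def)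
  let ?xs = "sorted_list_of_set ({..<fst D} - E')"
  have "set ?xs = {..<fst D} - E'" by simp
  moreover have "{..<fst D} - ({..<fst D} - E') = E'" using assms(2) by blast
  ultimately have "foldr del ?xs ({..<fst D}, snd D) = (E', feasible E' (reduce E' L))"
    using foldr_del_feasible[OF L finite_lessThan, of ?xs] s by simp
  thus ?thesis by (simp add: restr_def)
qed

lemma represents_lagrangian_reduce:
  "represents L D \<Longrightarrow> E' \<subseteq> {..<fst D} \<Longrightarrow> lagrangian E' (reduce E' L)"
  by (rule lagrangian_reduce[of "{..<fst D}"]) (simp_all add: represents_def)

lemma represents_restr:
  assumes "represents L D" "E' \<subseteq> {..<fst D}"
  shows "represents (pushv (relabel E') E' ` reduce E' L) (restr E' D)"
proof -
  have fin: "finite E'" using assms(2) finite_subset by blast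
  note L' = represents_lagrangian_reduce[OF assms]
  show ?thesis unfolding represents_def fst_ops snd_restr[OF assms]
    using lagrangian_pushv[OF inj_relabel[OF fin] L'] feasible_pushv[OF inj_relabel[OF fin] L']
    by (simp add: relabel_image[OF fin])
qed

lemma restr_slide:
  assumes "binary_dm D" "E' \<subseteq> {..<fst D}" "a \<in> E'" "b \<in> E'" "a \<noteq> b"
  shows "restr E' (slide a b D) = slide (relabel E' a) (relabel E' b) (restr E' D)"
proof -
  obtain L where L: "represents L D" using binary_dm_represents[OF assms(1)] by blast
  have fin: "finite E'" using assms(2) finite_subset by blast
  have ab: "a < fst D" "b < fst D" using assms by auto
  note inj = inj_relabel[OF fin]
  have ne: "relabel E' a \<noteq> relabel E' b" using inj assms by (auto dest: inj_onD)
  have "represents (pushv (relabel E') E' ` reduce E' (slidev a b ` L)) (restr E' (slide a b D))"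
    using represents_restr[OF represents_slide[OF L ab assms(5)]] assms(2) by simp
  also have "pushv (relabel E') E' ` reduce E' (slidev a b ` L)
      = slidev (relabel E' a) (relabel E' b) ` pushv (relabel E') E' ` reduce E' L"
    unfolding reduce_slidev[OF assms(3-5)] image_image pushv_slidev[OF inj assms(3,4)] ..
  finally have "represents (slidev (relabel E' a) (relabel E' b) ` pushv (relabel E') E' ` reduce E' L) (restr E' (slide a b D))" .
  moreover have "represents (slidev (relabel E' a) (relabel E' b) ` pushv (relabel E') E' ` reduce E' L)
      (slide (relabel E' a) (relabel E' b) (restr E' D))"
    using relabel_less[OF fin] assms ne by (intro represents_slide represents_restr[OF L]) simp_all
  ultimately show ?thesis by (rule represents_unique) simp
qed

lemma restr_exch:
  assumes "binary_dm D" "E' \<subseteq> {..<fst D}" "a \<in> E'" "b \<in> E'" "a \<noteq> b"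
  shows "restr E' (exch a b D) = exch (relabel E' a) (relabel E' b) (restr E' D)"
proof -
  obtain L where L: "represents L D" using binary_dm_represents[OF assms(1)] by blast
  have fin: "finite E'" using assms(2) finite_subset by blast
  have ab: "a < fst D" "b < fst D" using assms by auto
  note inj = inj_relabel[OF fin]
  have ne: "relabel E' a \<noteq> relabel E' b" using inj assms by (auto dest: inj_onD)
  have "represents (pushv (relabel E') E' ` reduce E' (exchv a b ` L)) (restr E' (exch a b D))"
    using represents_restr[OF represents_exch[OF L ab assms(5)]] assms(2) by simp
  also have "pushv (relabel E') E' ` reduce E' (exchv a b ` L)
      = exchv (relabel E' a) (relabel E' b) ` pushv (relabel E') E' ` reduce E' L"
    unfolding reduce_exchv[OF assms(3-5)] image_image pushv_exchv[OF inj assms(3-5)] ..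
  finally have "represents (exchv (relabel E' a) (relabel E' b) ` pushv (relabel E') E' ` reduce E' L) (restr E' (exch a b D))" .
  moreover have "represents (exchv (relabel E' a) (relabel E' b) ` pushv (relabel E') E' ` reduce E' L)
      (exch (relabel E' a) (relabel E' b) (restr E' D))"
    using relabel_less[OF fin] assms ne by (intro represents_exch represents_restr[OF L]) simp_all
  ultimately show ?thesis by (rule represents_unique) simp
qed

lemma restr_slide_outside:
  assumes "binary_dm D" "E' \<subseteq> {..<fst D}" "a < fst D" "b < fst D" "a \<notin> E'" "b \<notin> E'" "a \<noteq> b"
  shows "restr E' (slide a b D) = restr E' D"
proof -
  obtain L where L: "represents L D" using binary_dm_represents[OF assms(1)] by blast
  show ?thesis
    using snd_restr[OF L assms(2)] snd_restr[OF represents_slide[OF L assms(3,4,7)]] assms(2)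
    by (intro ss_eqI) (simp_all add: reduce_slidev_outside[OF assms(5-7)])
qed

lemma restr_exch_outside:
  assumes "binary_dm D" "E' \<subseteq> {..<fst D}" "a < fst D" "b < fst D" "\<not> (a \<in> E' \<and> b \<in> E')" "a \<noteq> b"
  shows "restr E' (exch a b D) = restr E' D"
proof -
  obtain L where L: "represents L D" using binary_dm_represents[OF assms(1)] by blast
  show ?thesis
    using snd_restr[OF L assms(2)] snd_restr[OF represents_exch[OF L assms(3,4,6)]] assms(2)
    by (intro ss_eqI) (simp_all add: reduce_exchv_outside[OF assms(5,6)])
qed

lemma binary_dm_restr: "binary_dm D \<Longrightarrow> E' \<subseteq> {..<fst D} \<Longrightarrow> binary_dm (restr E' D)"
  by (metis binary_dm_represents represents_binary_dm represents_restr)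

lemma binary_dm_slide: "binary_dm D \<Longrightarrow> a < fst D \<Longrightarrow> b < fst D \<Longrightarrow> a \<noteq> b \<Longrightarrow> binary_dm (slide a b D)"
  by (metis binary_dm_represents represents_binary_dm represents_slide)

lemma binary_dm_exch: "binary_dm D \<Longrightarrow> a < fst D \<Longrightarrow> b < fst D \<Longrightarrow> a \<noteq> b \<Longrightarrow> binary_dm (exch a b D)"
  by (metis binary_dm_represents represents_binary_dm represents_exch)

lemma binary_dm_dsum: "binary_dm D \<Longrightarrow> binary_dm D' \<Longrightarrow> binary_dm (dsum D D')"
  by (metis binary_dm_represents represents_binary_dm represents_dsum)

lemma binary_dm_unit: "binary_dm unit_ss"
  using represents_unit by (rule represents_binary_dm)

text \<open>Ranking in \<open>E'\<close> is strictly increasing, so the rank of an element within a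
  subset \<open>S\<close> can be computed after relabelling.\<close>

lemma relabel_relabel:
  assumes "finite E'" "S \<subseteq> E'" "x \<in> E'"
  shows "relabel (relabel E' ` S) (relabel E' x) = relabel S x"
proof -
  have mono: "relabel E' y < relabel E' x \<longleftrightarrow> y < x" if "y \<in> E'" "x \<in> E'" for x y
  proof -
    have "relabel E' x < relabel E' y" if "x \<in> E'" "x < y" for x y
      unfolding relabel_def using that assms(1) by (intro psubset_card_mono) auto
    thus ?thesis using that by (metis linorder_neqE_nat not_less_iff_gr_or_eq)
  qed
  have "{z \<in> relabel E' ` S. z < relabel E' x} = relabel E' ` {y \<in> S. y < x}"
    using mono assms by blast
  moreover have "inj_on (relabel E') {y \<in> S. y < x}"
    using inj_relabel[OF assms(1)] by (rule inj_on_subset) (use assms in auto)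
  ultimately show ?thesis unfolding relabel_def[of "relabel E' ` S"] relabel_def[of S]
    by (simp add: card_image)
qed

text \<open>An equality and not only an isomorphism, because ranks compose; this is why
  coassociativity will hold exactly.\<close>

lemma restr_restr:
  assumes "binary_dm D" "E' \<subseteq> {..<fst D}" "S \<subseteq> E'"
  shows "restr (relabel E' ` S) (restr E' D) = restr S D"
proof (rule ss_eqI)
  obtain L where L: "represents L D" using binary_dm_represents[OF assms(1)] by blast
  have fin: "finite E'" using assms(2) finite_subset by blast
  note inj = inj_relabel[OF fin]
  have inj': "inj_on (relabel E') S" using inj assms(3) by (rule inj_on_subset)
  have S: "S \<subseteq> {..<fst D}" using assms by blast
  show "fst (restr (relabel E' ` S) (restr E' D)) = fst (restr S D)" by (simp add: card_image[OF inj'])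
  have "relabel E' ` S \<subseteq> {..<fst (restr E' D)}" using relabel_image[OF fin] assms(3) by auto
  from snd_restr[OF represents_restr[OF L assms(2)] this]
  have "snd (restr (relabel E' ` S) (restr E' D)) = (\<lambda>\<phi>. relabel (relabel E' ` S) ` \<phi>) `
      feasible (relabel E' ` S) (reduce (relabel E' ` S) (pushv (relabel E') E' ` reduce E' L))" .
  also have "reduce (relabel E' ` S) (pushv (relabel E') E' ` reduce E' L) = pushv (relabel E') S ` reduce S L"
    using reduce_pushv[OF inj assms(3) lagrangianD(1)[OF represents_lagrangian_reduce[OF L assms(2)]]]
    by (simp add: reduce_reduce[OF assms(3)])
  also have "feasible (relabel E' ` S) (pushv (relabel E') S ` reduce S L) = (\<lambda>\<phi>. relabel E' ` \<phi>) ` feasible S (reduce S L)"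
    by (rule feasible_pushv[OF inj' represents_lagrangian_reduce[OF L S]])
  also have "(\<lambda>\<phi>. relabel (relabel E' ` S) ` \<phi>) ` (\<lambda>\<phi>. relabel E' ` \<phi>) ` feasible S (reduce S L)
     = (\<lambda>\<phi>. relabel S ` \<phi>) ` feasible S (reduce S L)"
    unfolding image_image
  proof (intro image_cong refl)
    fix \<phi> x assume "\<phi> \<in> feasible S (reduce S L)" "x \<in> \<phi>"
    thus "relabel (relabel E' ` S) (relabel E' x) = relabel S x"
      using relabel_relabel[OF fin assms(3)] feasible_subset assms(3) by blast
  qed
  also have "\<dots> = snd (restr S D)" by (rule snd_restr[OF L S, symmetric])
  finally show "snd (restr (relabel E' ` S) (restr E' D)) = snd (restr S D)" .
qed

lemma restr_full:
  assumes "binary_dm D" shows "restr {..<fst D} D = D"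
proof (rule ss_eqI)
  obtain L where L: "represents L D" using binary_dm_represents[OF assms] by blast
  have r: "relabel {..<n} x = x" if "x < n" for x n
  proof -
    have "{y \<in> {..<n}. y < x} = {..<x}" using that by auto
    thus ?thesis by (simp add: relabel_def)
  qed
  have im: "relabel {..<fst D} ` \<phi> = \<phi>" if "\<phi> \<in> snd D" for \<phi>
  proof -
    have "\<phi> \<subseteq> {..<fst D}" using that L feasible_subset by (auto simp: represents_def)
    hence "relabel {..<fst D} ` \<phi> = (\<lambda>x. x) ` \<phi>" using r by (intro image_cong) auto
    thus ?thesis by simp
  qed
  have "reduce {..<fst D} L = L" using L by (intro reduce_self) (simp add: represents_def)
  hence "snd (restr {..<fst D} D) = (\<lambda>\<phi>. relabel {..<fst D} ` \<phi>) ` snd D"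
    using snd_restr[OF L order_refl] L by (simp add: represents_def)
  also have "\<dots> = (\<lambda>\<phi>. \<phi>) ` snd D" by (rule image_cong) (use im in simp_all)
  finally show "snd (restr {..<fst D} D) = snd D" by simp
qed simp

text \<open>Degree 0 is spanned by the unit. The counit laws and the start of the antipode recursion
  rest on this.\<close>

lemma binary_dm_0:
  assumes "binary_dm D" "fst D = 0" shows "D = unit_ss"
proof (rule ss_eqI)
  have "snd D \<noteq> {}" "\<forall>\<phi>\<in>snd D. \<phi> = {}" using assms by (auto simp: binary_dm_def wf_ss_def)
  thus "snd D = snd unit_ss" by (auto simp: unit_ss_def)
qed (use assms in simp)

lemma restr_empty: "binary_dm D \<Longrightarrow> restr {} D = unit_ss"
  by (rule binary_dm_0) (simp_all add: binary_dm_restr)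

lemma relabel_Un_shift:
  assumes "S1 \<subseteq> {..<n}" "finite S2"
  shows "x < n \<Longrightarrow> relabel (S1 \<union> (\<lambda>x. x + n) ` S2) x = relabel S1 x"
    and "relabel (S1 \<union> (\<lambda>x. x + n) ` S2) (y + n) = relabel S2 y + card S1"
proof -
  have "{z \<in> S1 \<union> (\<lambda>x. x + n) ` S2. z < x} = {z \<in> S1. z < x}" if "x < n" for x using that by auto
  thus "x < n \<Longrightarrow> relabel (S1 \<union> (\<lambda>x. x + n) ` S2) x = relabel S1 x" by (simp add: relabel_def)
  have fin: "finite S1" using assms(1) finite_subset by blast
  have "{z \<in> S1 \<union> (\<lambda>x. x + n) ` S2. z < y + n} = S1 \<union> (\<lambda>x. x + n) ` {z \<in> S2. z < y}" using assms(1) by auto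
  moreover have "card (S1 \<union> (\<lambda>x. x + n) ` {z \<in> S2. z < y}) = card S1 + card ((\<lambda>x. x + n) ` {z \<in> S2. z < y})"
    using assms fin by (intro card_Un_disjoint) auto
  ultimately show "relabel (S1 \<union> (\<lambda>x. x + n) ` S2) (y + n) = relabel S2 y + card S1"
    by (simp add: relabel_def card_image inj_on_def)
qed

lemma setcompr2_cong:
  assumes "\<And>a b. a \<in> A \<Longrightarrow> f a b = g a b"
  shows "{f a b | a b. a \<in> A \<and> b \<in> B} = {g a b | a b. a \<in> A \<and> b \<in> B}"
  using assms by (intro Collect_cong iffI; elim exE conjE) (metis, metis)

text \<open>Ranking respects the concatenation of the two ground sets, so the labels agree as well
  and the bialgebra law will hold exactly.\<close>

lemma restr_dsum:
  assumes "binary_dm D1" "binary_dm D2" "S1 \<subseteq> {..<fst D1}" "S2 \<subseteq> {..<fst D2}"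
  shows "restr (S1 \<union> (\<lambda>x. x + fst D1) ` S2) (dsum D1 D2) = dsum (restr S1 D1) (restr S2 D2)"
proof (rule ss_eqI)
  let ?f = "\<lambda>x. x + fst D1" and ?E = "{..<fst D2}"
  let ?S = "S1 \<union> ?f ` S2"
  obtain L1 L2 where L1: "represents L1 D1" and L2: "represents L2 D2"
    using binary_dm_represents assms by blast
  have f: "inj_on ?f ?E" "inj_on ?f S2" by (simp_all add: inj_on_def)
  have fin: "finite S1" "finite S2" using assms finite_subset by blast+
  have disj: "{..<fst D1} \<inter> ?f ` ?E = {}" by auto
  have disj': "S1 \<inter> ?f ` S2 = {}" using assms by auto
  have lag: "lagrangian {..<fst D1} L1" "lagrangian ?E L2" using L1 L2 by (simp_all add: represents_def)
  note lag2 = lagrangian_pushv[OF f(1) lag(2)]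
  show "fst (restr ?S (dsum D1 D2)) = fst (dsum (restr S1 D1) (restr S2 D2))"
    using card_Un_disjoint[OF fin(1) _ disj'] fin by (simp add: card_image[OF f(2)])
  have sub: "?S \<subseteq> {..<fst (dsum D1 D2)}" using assms by auto
  note R1 = represents_lagrangian_reduce[OF L1 assms(3)] and R2 = represents_lagrangian_reduce[OF L2 assms(4)]
  have "reduce ?S (sumv L1 (pushv ?f ?E ` L2)) = sumv (reduce S1 L1) (reduce (?f ` S2) (pushv ?f ?E ` L2))"
    by (rule reduce_sumv[OF disj lagrangianD(1)[OF lag(1)] lagrangianD(1)[OF lag2]]) (use assms in auto)
  also have "reduce (?f ` S2) (pushv ?f ?E ` L2) = pushv ?f S2 ` reduce S2 L2"
    by (rule reduce_pushv[OF f(1) assms(4) lagrangianD(1)[OF lag(2)]])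
  finally have "feasible ?S (reduce ?S (sumv L1 (pushv ?f ?E ` L2)))
      = {\<phi>1 \<union> \<phi>2 | \<phi>1 \<phi>2. \<phi>1 \<in> feasible S1 (reduce S1 L1) \<and> \<phi>2 \<in> (\<lambda>\<phi>. ?f ` \<phi>) ` feasible S2 (reduce S2 L2)}"
    using feasible_sumv[OF disj' R1 lagrangian_pushv[OF f(2) R2]] feasible_pushv[OF f(2) R2] by (simp only:)
  hence "snd (restr ?S (dsum D1 D2)) = {relabel ?S ` (\<phi>1 \<union> ?f ` \<phi>2) | \<phi>1 \<phi>2. \<phi>1 \<in> feasible S1 (reduce S1 L1) \<and> \<phi>2 \<in> feasible S2 (reduce S2 L2)}"
    unfolding snd_restr[OF represents_dsum[OF L1 L2] sub] by (simp only:) blast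
  also have "\<dots> = {relabel S1 ` \<phi>1 \<union> (\<lambda>x. x + card S1) ` relabel S2 ` \<phi>2 | \<phi>1 \<phi>2. \<phi>1 \<in> feasible S1 (reduce S1 L1) \<and> \<phi>2 \<in> feasible S2 (reduce S2 L2)}"
  proof -
    have "relabel ?S ` (\<phi>1 \<union> ?f ` \<phi>2) = relabel S1 ` \<phi>1 \<union> (\<lambda>x. x + card S1) ` relabel S2 ` \<phi>2"
      if "\<phi>1 \<in> feasible S1 (reduce S1 L1)" for \<phi>1 \<phi>2
    proof -
      have "\<phi>1 \<subseteq> {..<fst D1}" using feasible_subset[OF that] assms(3) by blast
      hence "relabel ?S ` \<phi>1 = relabel S1 ` \<phi>1"
        using relabel_Un_shift(1)[OF assms(3) fin(2)] by (intro image_cong) auto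
      moreover have "relabel ?S ` ?f ` \<phi>2 = (\<lambda>x. x + card S1) ` relabel S2 ` \<phi>2"
        unfolding image_image relabel_Un_shift(2)[OF assms(3) fin(2)] ..
      ultimately show ?thesis by (simp add: image_Un)
    qed
    thus ?thesis by (rule setcompr2_cong)
  qed
  also have "\<dots> = snd (dsum (restr S1 D1) (restr S2 D2))"
    unfolding dsum_def snd_conv fst_ops snd_restr[OF L1 assms(3)] snd_restr[OF L2 assms(4)] by blast
  finally show "snd (restr ?S (dsum D1 D2)) = snd (dsum (restr S1 D1) (restr S2 D2))" .
qed

section \<open>Isomorphisms and restriction\<close>

lemma iso_ssI:
  assumes "fst D = fst D'" "bij_betw \<tau> {..<fst D} {..<fst D}" "wf_ss D" "snd D' = (\<lambda>\<phi>. \<tau> ` \<phi>) ` snd D"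
  shows "iso_ss D D'"
proof -
  \<comment> \<open>\<open>permutes\<close> also requires every label outside the ground set to be
    fixed, so \<tau> is replaced by the identity there.\<close>
  define \<sigma> where "\<sigma> x = (if x < fst D then \<tau> x else x)" for x
  have "bij_betw \<sigma> {..<fst D} {..<fst D}"
    using assms(2) by (rule iffD1[OF bij_betw_cong, rotated]) (simp add: \<sigma>_def)
  hence "\<sigma> permutes {..<fst D}" by (rule bij_imp_permutes) (simp add: \<sigma>_def)
  moreover have "\<tau> ` \<phi> = \<sigma> ` \<phi>" if "\<phi> \<in> snd D" for \<phi>
    using that assms(3) by (intro image_cong) (auto simp: \<sigma>_def wf_ss_def)
  hence "snd D' = (\<lambda>\<phi>. \<sigma> ` \<phi>) ` snd D" unfolding assms(4) by (rule image_cong[OF refl])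
  ultimately show ?thesis unfolding iso_ss_def using assms(1) by blast
qed

lemma binary_dm_wf: "binary_dm D \<Longrightarrow> wf_ss D"
  by (simp add: binary_dm_def)

lemma restr_iso:
  assumes "binary_dm D" "fst D' = fst D" "\<sigma> permutes {..<fst D}" "snd D' = (\<lambda>\<phi>. \<sigma> ` \<phi>) ` snd D"
    "S \<subseteq> {..<fst D}"
  shows "iso_ss (restr S D) (restr (\<sigma> ` S) D')"
proof -
  let ?E = "{..<fst D}"
  obtain L where L: "represents L D" using binary_dm_represents[OF assms(1)] by blast
  have lag: "lagrangian ?E L" using L by (simp add: represents_def)
  have \<sigma>: "inj_on \<sigma> ?E" "\<sigma> ` ?E = ?E" using permutes_inj_on[OF assms(3)] permutes_image[OF assms(3)] by auto
  have \<sigma>S: "inj_on \<sigma> S" using \<sigma>(1) assms(5) by (rule inj_on_subset)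
  have fin: "finite S" "finite (\<sigma> ` S)" using assms(5) finite_subset by blast+
  have L': "represents (pushv \<sigma> ?E ` L) D'"
    using lagrangian_pushv[OF \<sigma>(1) lag] feasible_pushv[OF \<sigma>(1) lag] L \<sigma>(2) assms(2,4)
    by (simp add: represents_def)
  have sub: "\<sigma> ` S \<subseteq> {..<fst D'}" using image_mono[OF assms(5), of \<sigma>] unfolding \<sigma>(2) assms(2) .
  note R = represents_lagrangian_reduce[OF L assms(5)]
  have s': "snd (restr (\<sigma> ` S) D') = (\<lambda>\<phi>. relabel (\<sigma> ` S) ` \<sigma> ` \<phi>) ` feasible S (reduce S L)"
  proof -
    have "reduce (\<sigma> ` S) (pushv \<sigma> ?E ` L) = pushv \<sigma> S ` reduce S L"
      by (rule reduce_pushv[OF \<sigma>(1) assms(5) lagrangianD(1)[OF lag]])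
    thus ?thesis unfolding snd_restr[OF L' sub] by (simp add: feasible_pushv[OF \<sigma>S R] image_image)
  qed
  \<comment> \<open>The labels of both restrictions are ranks, so the isomorphism undoes the ranking
    in \<open>S\<close>, applies \<sigma> and ranks again in its image.\<close>
  let ?\<tau> = "relabel (\<sigma> ` S) \<circ> \<sigma> \<circ> inv_into S (relabel S)"
  have card: "card (\<sigma> ` S) = card S" by (rule card_image[OF \<sigma>S])
  have "bij_betw ?\<tau> {..<card S} {..<card S}"
  proof (intro bij_betw_trans)
    show "bij_betw (inv_into S (relabel S)) {..<card S} S" by (rule bij_betw_inv_into[OF bij_relabel[OF fin(1)]])
    show "bij_betw \<sigma> S (\<sigma> ` S)" using \<sigma>S by (simp add: bij_betw_def)
    show "bij_betw (relabel (\<sigma> ` S)) (\<sigma> ` S) {..<card S}" using bij_relabel[OF fin(2)] card by simp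
  qed
  moreover have "snd (restr (\<sigma> ` S) D') = (\<lambda>\<phi>. ?\<tau> ` \<phi>) ` snd (restr S D)"
    unfolding s' snd_restr[OF L assms(5)] image_image
  proof (intro image_cong refl)
    fix \<phi> x assume "\<phi> \<in> feasible S (reduce S L)" "x \<in> \<phi>"
    hence "x \<in> S" using feasible_subset by blast
    thus "relabel (\<sigma> ` S) (\<sigma> x) = ?\<tau> (relabel S x)" by (simp add: inv_into_f_f[OF inj_relabel[OF fin(1)]])
  qed
  ultimately show ?thesis
    using binary_dm_wf[OF binary_dm_restr[OF assms(1,5)]] card by (intro iso_ssI[of _ _ ?\<tau>]) simp_all
qed

section \<open>Direct sums against sliding, exchange and isomorphism\<close>

lemma mem_snd_dsum:
  assumes "wf_ss D1"
  shows "\<phi> \<in> snd (dsum D1 D2) \<longleftrightarrow> \<phi> \<inter> {..<fst D1} \<in> snd D1 \<and> {x. x + fst D1 \<in> \<phi>} \<in> snd D2"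
proof
  assume "\<phi> \<in> snd (dsum D1 D2)"
  then obtain \<phi>1 \<phi>2 where *: "\<phi> = \<phi>1 \<union> (\<lambda>x. x + fst D1) ` \<phi>2" "\<phi>1 \<in> snd D1" "\<phi>2 \<in> snd D2"
    unfolding dsum_def by auto
  have "\<phi>1 \<subseteq> {..<fst D1}" using assms *(2) by (auto simp: wf_ss_def)
  hence "\<phi> \<inter> {..<fst D1} = \<phi>1" "{x. x + fst D1 \<in> \<phi>} = \<phi>2" unfolding *(1) by auto
  thus "\<phi> \<inter> {..<fst D1} \<in> snd D1 \<and> {x. x + fst D1 \<in> \<phi>} \<in> snd D2" using * by simp
next
  assume *: "\<phi> \<inter> {..<fst D1} \<in> snd D1 \<and> {x. x + fst D1 \<in> \<phi>} \<in> snd D2"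
  have "x \<in> (\<lambda>x. x + fst D1) ` {x. x + fst D1 \<in> \<phi>}" if "x \<in> \<phi>" "\<not> x < fst D1" for x
    by (rule image_eqI[of _ _ "x - fst D1"]) (use that in auto)
  hence "\<phi> = (\<phi> \<inter> {..<fst D1}) \<union> (\<lambda>x. x + fst D1) ` {x. x + fst D1 \<in> \<phi>}" by auto
  thus "\<phi> \<in> snd (dsum D1 D2)" using * unfolding dsum_def snd_conv by blast
qed

lemma mem_snd_twist: "\<phi> \<in> snd (twist X D) \<longleftrightarrow> symd \<phi> X \<in> snd D"
  by (simp add: twist_def mem_twist_image)

lemma mem_snd_slide:
  assumes "\<forall>\<phi>\<in>snd D. \<phi> \<subseteq> {..<fst D}" "a \<noteq> b"
  shows "\<phi> \<in> snd (slide a b D) \<longleftrightarrow> (\<phi> \<in> snd D) \<noteq> (a \<in> \<phi> \<and> b \<notin> \<phi> \<and> insert b (\<phi> - {a}) \<in> snd D)"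
proof -
  have "\<phi> \<in> {\<phi> \<union> {a} | \<phi>. \<phi> \<subseteq> {..<fst D} - {a, b} \<and> \<phi> \<union> {b} \<in> snd D} \<longleftrightarrow>
    a \<in> \<phi> \<and> b \<notin> \<phi> \<and> insert b (\<phi> - {a}) \<in> snd D" (is "_ \<in> ?X \<longleftrightarrow> ?R")
  proof
    assume "\<phi> \<in> ?X"
    then obtain \<psi> where *: "\<phi> = \<psi> \<union> {a}" "\<psi> \<subseteq> {..<fst D} - {a, b}" "\<psi> \<union> {b} \<in> snd D" by blast
    hence "\<phi> - {a} = \<psi>" by auto
    thus ?R using * assms(2) by auto
  next
    assume R: ?R
    moreover from R have "insert b (\<phi> - {a}) \<in> snd D" by simp
    with assms(1) have "insert b (\<phi> - {a}) \<subseteq> {..<fst D}" by (rule bspec)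
    with R have "\<phi> - {a} \<subseteq> {..<fst D} - {a, b}" by auto
    ultimately show "\<phi> \<in> ?X" by (intro CollectI exI[of _ "\<phi> - {a}"]) auto
  qed
  thus ?thesis by (simp add: slide_def mem_symd)
qed

lemma mem_snd_exch:
  assumes "\<forall>\<phi>\<in>snd D. \<phi> \<subseteq> {..<fst D}" "a \<noteq> b" "b < fst D"
  shows "\<phi> \<in> snd (exch a b D) \<longleftrightarrow> (\<phi> \<in> snd D) \<noteq> (a \<in> \<phi> \<and> b \<in> \<phi> \<and> \<phi> - {a, b} \<in> snd D)"
proof -
  have wf: "\<forall>\<psi>\<in>snd (twist {b} D). \<psi> \<subseteq> {..<fst (twist {b} D)}"
  proof
    fix \<psi> assume "\<psi> \<in> snd (twist {b} D)"
    hence "symd \<psi> {b} \<subseteq> {..<fst D}" using assms(1) by (simp add: mem_snd_twist)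
    thus "\<psi> \<subseteq> {..<fst (twist {b} D)}" using assms(3) by (auto simp: symd_def)
  qed
  have "symd (insert b (symd \<phi> {b} - {a})) {b} = \<phi> - {a, b}" if "b \<in> \<phi>"
    using that assms(2) by (auto simp: symd_def)
  moreover have "a \<in> symd \<phi> {b} \<longleftrightarrow> a \<in> \<phi>" "b \<notin> symd \<phi> {b} \<longleftrightarrow> b \<in> \<phi>" using assms(2) by (auto simp: symd_def)
  ultimately show ?thesis
    unfolding exch_def mem_snd_twist[of \<phi>] mem_snd_slide[OF wf assms(2)]
    by (cases "b \<in> \<phi>") (simp_all add: mem_snd_twist)
qed

lemma wf_ssD: "wf_ss D \<Longrightarrow> \<phi> \<in> snd D \<Longrightarrow> \<phi> \<subseteq> {..<fst D}"
  by (simp add: wf_ss_def)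

lemma wf_ss_subset: "wf_ss D \<Longrightarrow> \<forall>\<phi>\<in>snd D. \<phi> \<subseteq> {..<fst D}"
  by (simp add: wf_ss_def)

lemma wf_dsum: "wf_ss D1 \<Longrightarrow> wf_ss D2 \<Longrightarrow> wf_ss (dsum D1 D2)"
  unfolding wf_ss_def dsum_def by fastforce

text \<open>Only the left summand is slid here; relations in the right factor of a product will be
  reached through commutativity modulo isomorphism.\<close>

lemma slide_dsum:
  assumes "wf_ss D1" "wf_ss D2" "a < fst D1" "b < fst D1" "a \<noteq> b" "wf_ss (slide a b D1)"
  shows "slide a b (dsum D1 D2) = dsum (slide a b D1) D2"
proof (rule ss_eqI)
  note w = wf_ss_subset[OF wf_dsum[OF assms(1,2)]]
  show "snd (slide a b (dsum D1 D2)) = snd (dsum (slide a b D1) D2)"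
  proof (rule Set.set_eqI)
    fix \<phi>
    have "insert b (\<phi> - {a}) \<inter> {..<fst D1} = insert b (\<phi> \<inter> {..<fst D1} - {a})"
      "{x. x + fst D1 \<in> insert b (\<phi> - {a})} = {x. x + fst D1 \<in> \<phi>}" using assms by auto
    thus "\<phi> \<in> snd (slide a b (dsum D1 D2)) \<longleftrightarrow> \<phi> \<in> snd (dsum (slide a b D1) D2)"
      unfolding mem_snd_slide[OF w assms(5)] mem_snd_dsum[OF assms(1)] mem_snd_dsum[OF assms(6)] fst_ops
        mem_snd_slide[OF wf_ss_subset[OF assms(1)] assms(5)] using assms(3,4) by auto
  qed
qed simp

lemma exch_dsum:
  assumes "wf_ss D1" "wf_ss D2" "a < fst D1" "b < fst D1" "a \<noteq> b" "wf_ss (exch a b D1)"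
  shows "exch a b (dsum D1 D2) = dsum (exch a b D1) D2"
proof (rule ss_eqI)
  note w = wf_ss_subset[OF wf_dsum[OF assms(1,2)]]
  have b: "b < fst (dsum D1 D2)" using assms by simp
  show "snd (exch a b (dsum D1 D2)) = snd (dsum (exch a b D1) D2)"
  proof (rule Set.set_eqI)
    fix \<phi>
    have "(\<phi> - {a,b}) \<inter> {..<fst D1} = \<phi> \<inter> {..<fst D1} - {a,b}"
      "{x. x + fst D1 \<in> \<phi> - {a,b}} = {x. x + fst D1 \<in> \<phi>}" using assms by auto
    thus "\<phi> \<in> snd (exch a b (dsum D1 D2)) \<longleftrightarrow> \<phi> \<in> snd (dsum (exch a b D1) D2)"
      unfolding mem_snd_exch[OF w assms(5) b] mem_snd_dsum[OF assms(1)] mem_snd_dsum[OF assms(6)] fst_ops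
        mem_snd_exch[OF wf_ss_subset[OF assms(1)] assms(5,4)] using assms(3,4) by auto
  qed
qed simp

lemma dsum_unit [simp]: "dsum unit_ss D = D" "dsum D unit_ss = D"
  by (auto intro!: ss_eqI simp: dsum_def unit_ss_def)

lemma dsum_assoc: "dsum (dsum A B) C = dsum A (dsum B C)"
proof (rule ss_eqI)
  have "(\<phi>1 \<union> (\<lambda>x. x + fst A) ` \<phi>2) \<union> (\<lambda>x. x + (fst A + fst B)) ` \<phi>3
      = \<phi>1 \<union> (\<lambda>x. x + fst A) ` (\<phi>2 \<union> (\<lambda>x. x + fst B) ` \<phi>3)" for \<phi>1 \<phi>2 \<phi>3
    by (simp add: image_Un image_image Un_assoc add_ac)
  hence *: "{(\<phi>1 \<union> (\<lambda>x. x + fst A) ` \<phi>2) \<union> (\<lambda>x. x + (fst A + fst B)) ` \<phi>3 | \<phi>1 \<phi>2 \<phi>3. \<phi>1 \<in> snd A \<and> \<phi>2 \<in> snd B \<and> \<phi>3 \<in> snd C}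
    = {\<phi>1 \<union> (\<lambda>x. x + fst A) ` (\<phi>2 \<union> (\<lambda>x. x + fst B) ` \<phi>3) | \<phi>1 \<phi>2 \<phi>3. \<phi>1 \<in> snd A \<and> \<phi>2 \<in> snd B \<and> \<phi>3 \<in> snd C}"
    by (simp only:)
  have "snd (dsum (dsum A B) C) = {(\<phi>1 \<union> (\<lambda>x. x + fst A) ` \<phi>2) \<union> (\<lambda>x. x + (fst A + fst B)) ` \<phi>3 | \<phi>1 \<phi>2 \<phi>3. \<phi>1 \<in> snd A \<and> \<phi>2 \<in> snd B \<and> \<phi>3 \<in> snd C}"
    unfolding dsum_def fst_conv snd_conv by blast
  also note *
  also have "{\<phi>1 \<union> (\<lambda>x. x + fst A) ` (\<phi>2 \<union> (\<lambda>x. x + fst B) ` \<phi>3) | \<phi>1 \<phi>2 \<phi>3. \<phi>1 \<in> snd A \<and> \<phi>2 \<in> snd B \<and> \<phi>3 \<in> snd C} = snd (dsum A (dsum B C))"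
    unfolding dsum_def fst_conv snd_conv by blast
  finally show "snd (dsum (dsum A B) C) = snd (dsum A (dsum B C))" .
qed simp

lemma iso_dsum_commute:
  assumes "wf_ss D1" "wf_ss D2" shows "iso_ss (dsum D1 D2) (dsum D2 D1)"
proof (rule iso_ssI)
  let ?\<tau> = "\<lambda>x. if x < fst D1 then x + fst D2 else x - fst D1"
  show "bij_betw ?\<tau> {..<fst (dsum D1 D2)} {..<fst (dsum D1 D2)}"
    by (rule bij_betw_byWitness[of _ "\<lambda>x. if x < fst D2 then x + fst D1 else x - fst D2"]) auto
  have *: "?\<tau> ` (\<phi>1 \<union> (\<lambda>x. x + fst D1) ` \<phi>2) = \<phi>2 \<union> (\<lambda>x. x + fst D2) ` \<phi>1" if "\<phi>1 \<in> snd D1" for \<phi>1 \<phi>2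
  proof -
    have "?\<tau> ` \<phi>1 = (\<lambda>x. x + fst D2) ` \<phi>1" using wf_ssD[OF assms(1) that] by (intro image_cong) auto
    moreover have "?\<tau> ` (\<lambda>x. x + fst D1) ` \<phi>2 = (\<lambda>x. x) ` \<phi>2"
      unfolding image_image by (rule image_cong) simp_all
    ultimately show ?thesis unfolding image_Un by auto
  qed
  have "(\<lambda>\<phi>. ?\<tau> ` \<phi>) ` snd (dsum D1 D2) = {?\<tau> ` (\<phi>1 \<union> (\<lambda>x. x + fst D1) ` \<phi>2) | \<phi>1 \<phi>2. \<phi>1 \<in> snd D1 \<and> \<phi>2 \<in> snd D2}"
    unfolding dsum_def snd_conv by blast
  also have "\<dots> = {\<phi>2 \<union> (\<lambda>x. x + fst D2) ` \<phi>1 | \<phi>1 \<phi>2. \<phi>1 \<in> snd D1 \<and> \<phi>2 \<in> snd D2}"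
    by (rule setcompr2_cong[OF *])
  also have "\<dots> = snd (dsum D2 D1)" unfolding dsum_def snd_conv by blast
  finally show "snd (dsum D2 D1) = (\<lambda>\<phi>. ?\<tau> ` \<phi>) ` snd (dsum D1 D2)" ..
qed (simp_all add: wf_dsum[OF assms])

lemma iso_dsum:
  assumes "iso_ss D D'" shows "iso_ss (dsum D X) (dsum D' X)"
proof -
  obtain \<sigma> where \<sigma>: "\<sigma> permutes {..<fst D}" "snd D' = (\<lambda>\<phi>. \<sigma> ` \<phi>) ` snd D" and f: "fst D = fst D'"
    using assms unfolding iso_ss_def by blast
  have perm: "\<sigma> permutes {..<fst (dsum D X)}" using permutes_subset[OF \<sigma>(1)] by auto
  have *: "\<sigma> ` (\<phi>1 \<union> (\<lambda>x. x + fst D) ` \<phi>2) = \<sigma> ` \<phi>1 \<union> (\<lambda>x. x + fst D) ` \<phi>2" for \<phi>1 \<phi>2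
  proof -
    have "\<sigma> (x + fst D) = x + fst D" for x using permutes_not_in[OF \<sigma>(1)] by simp
    thus ?thesis by (simp add: image_Un image_image)
  qed
  have "(\<lambda>\<phi>. \<sigma> ` \<phi>) ` snd (dsum D X) = {\<sigma> ` (\<phi>1 \<union> (\<lambda>x. x + fst D) ` \<phi>2) | \<phi>1 \<phi>2. \<phi>1 \<in> snd D \<and> \<phi>2 \<in> snd X}"
    unfolding dsum_def snd_conv by blast
  also have "\<dots> = {\<sigma> ` \<phi>1 \<union> (\<lambda>x. x + fst D) ` \<phi>2 | \<phi>1 \<phi>2. \<phi>1 \<in> snd D \<and> \<phi>2 \<in> snd X}"
    by (simp only: *)
  also have "\<dots> = snd (dsum D' X)" unfolding dsum_def snd_conv \<sigma>(2) f by blast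
  finally have "snd (dsum D' X) = (\<lambda>\<phi>. \<sigma> ` \<phi>) ` snd (dsum D X)" ..
  thus ?thesis unfolding iso_ss_def using perm f by auto
qed

section \<open>Parity of feasible sets\<close>

definition even_family :: "'a set set \<Rightarrow> bool" where
  "even_family \<Phi> \<longleftrightarrow> (\<exists>p. \<forall>\<phi>\<in>\<Phi>. even (card \<phi>) = p)"

lemma even_ss_iff: "even_ss D \<longleftrightarrow> even_family (snd D)"
proof
  assume h: "even_ss D"
  show "even_family (snd D)"
  proof (cases "snd D = {}")
    case False
    then obtain \<psi> where "\<psi> \<in> snd D" by blast
    hence "\<forall>\<phi>\<in>snd D. even (card \<phi>) = even (card \<psi>)" using h unfolding even_ss_def by blast
    thus ?thesis unfolding even_family_def by (rule exI)
  qed (simp add: even_family_def)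
next
  assume "even_family (snd D)"
  then obtain p where "\<forall>\<phi>\<in>snd D. even (card \<phi>) = p" unfolding even_family_def by (rule exE)
  thus "even_ss D" by (simp add: even_ss_def)
qed

text \<open>\<open>c\<close> records the effect of \<open>g\<close> on parity: \<open>True\<close>
  if it is kept, \<open>False\<close> if it is reversed.\<close>

lemma even_family_image:
  assumes "even_family \<Phi>" "\<And>\<phi>. \<phi> \<in> \<Phi> \<Longrightarrow> even (card (g \<phi>)) = (even (card \<phi>) = c)"
  shows "even_family (g ` \<Phi>)"
proof -
  obtain p where p: "\<forall>\<phi>\<in>\<Phi>. even (card \<phi>) = p" using assms(1) unfolding even_family_def by (rule exE)
  have "\<forall>\<psi>\<in>g ` \<Phi>. even (card \<psi>) = (p = c)" using p assms(2) by simp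
  thus ?thesis unfolding even_family_def by (rule exI)
qed

lemma wf_finite: "wf_ss D \<Longrightarrow> \<phi> \<in> snd D \<Longrightarrow> finite \<phi>"
  using wf_ssD finite_subset by blast

lemma card_symd: "finite A \<Longrightarrow> finite B \<Longrightarrow> even (card (symd A B)) \<longleftrightarrow> (even (card A) = even (card B))"
proof -
  assume fin: "finite A" "finite B"
  have "card (symd A B) = card (A - B) + card (B - A)"
    unfolding symd_def using fin by (intro card_Un_disjoint) auto
  moreover have "card A = card (A - B) + card (A \<inter> B)" "card B = card (B - A) + card (A \<inter> B)"
    using fin by (metis card_Diff_subset_Int card_Int_Diff add.commute Int_commute finite_Int)+
  ultimately show ?thesis by simp presburger
qed

lemma even_twist:
  assumes "wf_ss D" "even_ss D" "finite X" shows "even_ss (twist X D)"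
proof -
  have "even (card (symd \<phi> X)) = (even (card \<phi>) = even (card X))" if "\<phi> \<in> snd D" for \<phi>
    using card_symd wf_finite[OF assms(1) that] assms(3) by blast
  from even_family_image[OF _ this] show ?thesis using assms(2)
    unfolding even_ss_iff twist_def snd_conv by blast
qed

lemma even_slide:
  assumes "wf_ss D" "even_ss D" "a \<noteq> b" shows "even_ss (slide a b D)"
proof -
  obtain p where p: "\<And>\<phi>. \<phi> \<in> snd D \<Longrightarrow> even (card \<phi>) = p"
    using assms(2) unfolding even_ss_iff even_family_def by auto
  have "even (card \<phi>) = p" if "\<phi> \<in> snd (slide a b D)" for \<phi>
  proof (cases "\<phi> \<in> snd D")
    case False
    hence *: "a \<in> \<phi>" "b \<notin> \<phi>" "insert b (\<phi> - {a}) \<in> snd D"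
      using that mem_snd_slide[OF wf_ss_subset[OF assms(1)] assms(3)] by blast+
    have fin: "finite \<phi>" using wf_finite[OF assms(1) *(3)] by simp
    have "card (insert b (\<phi> - {a})) = Suc (card (\<phi> - {a}))" using * fin by simp
    also have "\<dots> = card \<phi>" by (rule card_Suc_Diff1[OF fin *(1)])
    finally have "card (insert b (\<phi> - {a})) = card \<phi>" .
    thus ?thesis using p[OF *(3)] by simp
  qed (use p in simp)
  thus ?thesis unfolding even_ss_iff even_family_def by blast
qed

lemma wf_twist: "wf_ss D \<Longrightarrow> X \<subseteq> {..<fst D} \<Longrightarrow> wf_ss (twist X D)"
  unfolding wf_ss_def twist_def symd_def by auto

lemma even_exch:
  assumes "wf_ss D" "even_ss D" "a \<noteq> b" "b < fst D" "wf_ss (slide a b (twist {b} D))"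
  shows "even_ss (exch a b D)"
  unfolding exch_def using assms by (intro even_twist even_slide wf_twist) auto

lemma even_dsum:
  assumes "wf_ss D1" "wf_ss D2" "even_ss D1" "even_ss D2" shows "even_ss (dsum D1 D2)"
proof -
  obtain p q where p: "\<And>\<phi>. \<phi> \<in> snd D1 \<Longrightarrow> even (card \<phi>) = p" and q: "\<And>\<phi>. \<phi> \<in> snd D2 \<Longrightarrow> even (card \<phi>) = q"
    using assms(3,4) unfolding even_ss_iff even_family_def by auto
  have "even (card \<phi>) = (p = q)" if \<phi>: "\<phi> \<in> snd (dsum D1 D2)" for \<phi>
  proof -
    obtain \<phi>1 \<phi>2 where *: "\<phi> = \<phi>1 \<union> (\<lambda>x. x + fst D1) ` \<phi>2" "\<phi>1 \<in> snd D1" "\<phi>2 \<in> snd D2"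
      using \<phi> unfolding dsum_def by auto
    have "card \<phi> = card \<phi>1 + card ((\<lambda>x. x + fst D1) ` \<phi>2)"
      unfolding *(1) using wf_finite[OF assms(1) *(2)] wf_finite[OF assms(2) *(3)] wf_ssD[OF assms(1) *(2)]
      by (intro card_Un_disjoint) auto
    thus ?thesis using p[OF *(2)] q[OF *(3)] by (simp add: card_image inj_on_def)
  qed
  thus ?thesis unfolding even_ss_iff even_family_def by blast
qed

lemma even_del:
  assumes "even_family (snd G)" "\<And>\<phi>. \<phi> \<in> snd G \<Longrightarrow> finite \<phi>"
  shows "even_family (snd (del e G)) \<and> (\<forall>\<phi>\<in>snd (del e G). finite \<phi>)"
proof (cases "\<forall>\<phi>\<in>snd G. e \<in> \<phi>")
  case True
  have "even (card (\<phi> - {e})) = (even (card \<phi>) = False)" if "\<phi> \<in> snd G" for \<phi>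
  proof -
    have "card \<phi> = Suc (card (\<phi> - {e}))" using True assms(2) that by (metis card_Suc_Diff1)
    thus ?thesis by simp
  qed
  thus ?thesis using True assms even_family_image[OF assms(1), of "\<lambda>\<phi>. \<phi> - {e}" False] by (auto simp: del_def)
next
  case False
  thus ?thesis using assms by (auto simp: del_def even_family_def)
qed

lemma even_restr:
  assumes "binary_dm D" "even_ss D" "E' \<subseteq> {..<fst D}" shows "even_ss (restr E' D)"
proof -
  obtain L where L: "represents L D" using binary_dm_represents[OF assms(1)] by blast
  have fin: "finite E'" using assms(3) finite_subset by blast
  have "even_family (snd (foldr del xs ({..<fst D}, snd D))) \<and> (\<forall>\<phi>\<in>snd (foldr del xs ({..<fst D}, snd D)). finite \<phi>)" for xs
  proof (induction xs)
    case Nil thus ?case using assms(2) wf_finite[OF binary_dm_wf[OF assms(1)]] by (simp add: even_ss_iff)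
  next
    case (Cons x xs)
    show ?case using even_del[of "foldr del xs ({..<fst D}, snd D)" x] Cons by simp
  qed
  moreover have "foldr del (sorted_list_of_set ({..<fst D} - E')) ({..<fst D}, snd D) = (E', feasible E' (reduce E' L))"
  proof -
    have "{..<fst D} - ({..<fst D} - E') = E'" using assms(3) by blast
    thus ?thesis using foldr_del_feasible[of "{..<fst D}" L "sorted_list_of_set ({..<fst D} - E')"] L
      by (simp add: represents_def)
  qed
  ultimately have ev: "even_family (feasible E' (reduce E' L))" by (metis snd_conv)
  have "even (card (relabel E' ` \<phi>)) = (even (card \<phi>) = True)" if "\<phi> \<in> feasible E' (reduce E' L)" for \<phi>
    using inj_on_subset[OF inj_relabel[OF fin] feasible_subset[OF that]] by (simp add: card_image)
  from even_family_image[OF ev this] show ?thesis unfolding even_ss_iff snd_restr[OF L assms(3)] .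
qed

lemma even_unit: "even_ss unit_ss"
  by (simp add: even_ss_def unit_ss_def)

lemma binary_dm_twist: "binary_dm D \<Longrightarrow> X \<subseteq> {..<fst D} \<Longrightarrow> binary_dm (twist X D)"
  by (metis binary_dm_represents represents_binary_dm represents_twist)

section \<open>Finitely supported vectors\<close>

lemma vadd_eq: "vadd v w = v + w" and vsub_eq: "vsub v w = v - w"
  by (simp_all add: vadd_def vsub_def fun_eq_iff)

lemma sum_fun_apply: "(sum f I) x = (\<Sum>i\<in>I. f i x)" for f :: "'i \<Rightarrow> 'a \<Rightarrow> complex"
  by (induction I rule: infinite_finite_induct) simp_all

lemma vsum_eq: "vsum f I = sum f I"
  by (simp add: vsum_def fun_eq_iff sum_fun_apply)

lemma scal_apply: "scal c v x = c * v x"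
  by (simp add: scal_def)

interpretation fv: vector_space scal
  by unfold_locales (simp_all add: fun_eq_iff scal_apply algebra_simps)

lemma cspan_eq: "cspan S = fv.span S"
  unfolding cspan_def fv.span_explicit vsum_eq by blast

definition fin :: "('a \<Rightarrow> complex) \<Rightarrow> bool" where "fin v \<longleftrightarrow> finite (supp v)"

lemma bv_apply: "bv a x = (if x = a then 1 else 0)"
  by (simp add: bv_def)

lemma supp_bv [simp]: "supp (bv a) = {a}"
  by (auto simp: supp_def bv_apply)

lemma fin_bv [simp]: "fin (bv a)" by (simp add: fin_def)

lemma fin_0 [simp]: "fin 0" by (simp add: fin_def supp_def)

lemma fin_add [simp]: "fin v \<Longrightarrow> fin w \<Longrightarrow> fin (v + w)"
  unfolding fin_def by (rule finite_subset[of _ "supp v \<union> supp w"]) (auto simp: supp_def)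

lemma fin_diff [simp]: "fin v \<Longrightarrow> fin w \<Longrightarrow> fin (v - w)"
  unfolding fin_def by (rule finite_subset[of _ "supp v \<union> supp w"]) (auto simp: supp_def)

lemma fin_scal [simp]: "fin v \<Longrightarrow> fin (scal c v)"
  unfolding fin_def by (rule finite_subset[of _ "supp v"]) (auto simp: supp_def scal_apply)

lemma fin_uminus [simp]: "fin v \<Longrightarrow> fin (- v)"
  using fin_diff[of 0 v] by simp

lemma fin_sum: "(\<And>i. i \<in> I \<Longrightarrow> fin (f i)) \<Longrightarrow> fin (sum f I)"
  by (induction I rule: infinite_finite_induct) simp_all

lemma fin_fsupp_on: "v \<in> fsupp_on A \<Longrightarrow> fin v"
  by (simp add: fsupp_on_def fin_def)

lemma expand_on:
  assumes "finite T" "supp v \<subseteq> T" shows "v = (\<Sum>a\<in>T. scal (v a) (bv a))"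
proof
  fix x
  have "(\<Sum>a\<in>T. scal (v a) (bv a)) x = (\<Sum>a\<in>T. if a = x then v a else 0)"
    unfolding sum_fun_apply by (intro sum.cong refl) (simp add: scal_apply bv_apply)
  also have "\<dots> = v x" using assms by (auto simp: supp_def)
  finally show "v x = (\<Sum>a\<in>T. scal (v a) (bv a)) x" ..
qed

lemma expand: "fin v \<Longrightarrow> v = (\<Sum>a\<in>supp v. scal (v a) (bv a))"
  by (rule expand_on) (simp_all add: fin_def)

lemma subspace_fsupp_on: "fv.subspace (fsupp_on A)"
proof (rule fv.subspaceI)
  fix v w :: "'a \<Rightarrow> complex" assume "v \<in> fsupp_on A" "w \<in> fsupp_on A"
  moreover have "supp (v + w) \<subseteq> supp v \<union> supp w" by (auto simp: supp_def)
  ultimately show "v + w \<in> fsupp_on A"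
    unfolding fsupp_on_def using finite_subset[of "supp (v + w)" "supp v \<union> supp w"] by auto
next
  fix c and v :: "'a \<Rightarrow> complex" assume "v \<in> fsupp_on A"
  moreover have "supp (scal c v) \<subseteq> supp v" by (auto simp: supp_def scal_apply)
  ultimately show "scal c v \<in> fsupp_on A"
    unfolding fsupp_on_def using finite_subset[of "supp (scal c v)" "supp v"] by auto
qed (simp add: fsupp_on_def supp_def)

lemma bv_fsupp_on [simp]: "bv a \<in> fsupp_on A \<longleftrightarrow> a \<in> A"
  by (simp add: fsupp_on_def)

text \<open>Linearity is required on finitely supported vectors only: \<^const>\<open>linext\<close> is zero on all
  other vectors, so its extensions are not additive globally.\<close>

definition lin :: "(('a \<Rightarrow> complex) \<Rightarrow> ('b \<Rightarrow> complex)) \<Rightarrow> bool" where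
  "lin T \<longleftrightarrow> (\<forall>v w. fin v \<longrightarrow> fin w \<longrightarrow> T (v + w) = T v + T w) \<and>
    (\<forall>c v. fin v \<longrightarrow> T (scal c v) = scal c (T v)) \<and> (\<forall>v. fin v \<longrightarrow> fin (T v))"

lemma linI:
  assumes "\<And>v w. fin v \<Longrightarrow> fin w \<Longrightarrow> T (v + w) = T v + T w"
    "\<And>c v. fin v \<Longrightarrow> T (scal c v) = scal c (T v)" "\<And>v. fin v \<Longrightarrow> fin (T v)"
  shows "lin T"
  using assms unfolding lin_def by blast

lemma lin_add: "lin T \<Longrightarrow> fin v \<Longrightarrow> fin w \<Longrightarrow> T (v + w) = T v + T w"
  and lin_scal: "lin T \<Longrightarrow> fin v \<Longrightarrow> T (scal c v) = scal c (T v)"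
  and lin_fin: "lin T \<Longrightarrow> fin v \<Longrightarrow> fin (T v)"
  unfolding lin_def by blast+

lemma lin_0: assumes "lin T" shows "T 0 = 0"
  using lin_scal[OF assms fin_0, of 0] by (simp add: fun_eq_iff scal_apply)

lemma lin_diff: assumes "lin T" "fin v" "fin w" shows "T (v - w) = T v - T w"
proof -
  have "T v = T ((v - w) + w)" by simp
  also have "\<dots> = T (v - w) + T w" by (intro lin_add fin_diff assms)
  finally show ?thesis by (simp add: algebra_simps)
qed

lemma lin_sum:
  assumes "lin T" shows "(\<And>i. i \<in> I \<Longrightarrow> fin (f i)) \<Longrightarrow> T (sum f I) = (\<Sum>i\<in>I. T (f i))"
proof (induction I rule: infinite_finite_induct)
  case (insert x I)
  have "T (f x + sum f I) = T (f x) + T (sum f I)"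
    using insert by (intro lin_add[OF assms] fin_sum) simp_all
  thus ?case using insert by (simp del: plus_fun_apply)
qed (simp_all add: lin_0[OF assms])

lemma lin_comp: assumes T: "lin T" and R: "lin R" shows "lin (\<lambda>x. R (T x))"
  by (rule linI) (simp_all only: lin_add[OF T] lin_add[OF R] lin_scal[OF T] lin_scal[OF R] lin_fin[OF T] lin_fin[OF R])

lemma lin_id: "lin (\<lambda>x. x)"
  by (rule linI) simp_all

lemma lin_minus: assumes T: "lin T" and R: "lin R" shows "lin (\<lambda>x. T x - R x)"
proof (rule linI)
  fix v :: "'a \<Rightarrow> complex" assume "fin v" thus "fin (T v - R v)" using lin_fin[OF T] lin_fin[OF R] by (intro fin_diff)
qed (simp_all only: lin_add[OF T] lin_add[OF R] lin_scal[OF T] lin_scal[OF R] fv.scale_right_diff_distrib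
    add_diff_add)

lemma lin_scal_right: assumes T: "lin T" shows "lin (\<lambda>x. scal c (T x))"
  by (rule linI) (simp_all only: lin_add[OF T] lin_scal[OF T] lin_fin[OF T] fin_scal
    fv.scale_right_distrib fv.scale_left_commute)

lemma lin_plus: assumes T: "lin T" and R: "lin R" shows "lin (\<lambda>x. T x + R x)"
proof (rule linI)
  fix v :: "'a \<Rightarrow> complex" assume "fin v" thus "fin (T v + R v)" using lin_fin[OF T] lin_fin[OF R] by (intro fin_add)
qed (simp_all only: lin_add[OF T] lin_add[OF R] lin_scal[OF T] lin_scal[OF R] fv.scale_right_distrib add_ac)

lemma lin_zero: "lin (\<lambda>x. 0)"
  by (rule linI) (simp_all only: fin_0 fv.scale_zero_right add_0_left)

lemma lin_sum_right: "(\<And>i. i \<in> I \<Longrightarrow> lin (T i)) \<Longrightarrow> lin (\<lambda>x. \<Sum>i\<in>I. T i x)"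
proof (induction I rule: infinite_finite_induct)
  case (insert i I)
  have "lin (\<lambda>v. T i v + (\<Sum>i\<in>I. T i v))"
    using insert by (intro lin_plus) simp_all
  thus ?case unfolding sum.insert[OF insert.hyps] .
qed (simp_all only: sum.infinite sum.empty lin_zero not_False_eq_True)

lemma linext_on:
  assumes "finite T" "supp v \<subseteq> T" shows "linext f v = (\<Sum>a\<in>T. scal (v a) (f a))"
  unfolding linext_def vsum_eq using assms
  by (intro sum.mono_neutral_left) (auto simp: supp_def fun_eq_iff scal_apply)

lemma linext_bv [simp]: "linext f (bv a) = f a"
  using linext_on[of "{a}" "bv a" f] by (simp add: bv_apply fun_eq_iff scal_apply)

lemma lin_linext:
  assumes "\<And>a. fin (f a)" shows "lin (linext f)"
proof (rule linI)
  fix v w :: "'a \<Rightarrow> complex" assume "fin v" "fin w"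
  let ?T = "supp v \<union> supp w"
  have T: "finite ?T" "supp v \<subseteq> ?T" "supp w \<subseteq> ?T" "supp (v + w) \<subseteq> ?T"
    using \<open>fin v\<close> \<open>fin w\<close> by (auto simp: fin_def supp_def)
  show "linext f (v + w) = linext f v + linext f w"
    unfolding linext_on[OF T(1,2)] linext_on[OF T(1,3)] linext_on[OF T(1,4)]
    by (simp add: fv.scale_left_distrib sum.distrib)
next
  fix c and v :: "'a \<Rightarrow> complex" assume "fin v"
  hence T: "finite (supp v)" "supp v \<subseteq> supp v" "supp (scal c v) \<subseteq> supp v"
    by (auto simp: fin_def supp_def scal_apply)
  show "linext f (scal c v) = scal c (linext f v)"
    unfolding linext_on[OF T(1,2)] linext_on[OF T(1,3)] by (simp add: fv.scale_sum_right scal_apply)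
next
  fix v :: "'a \<Rightarrow> complex" assume "fin v" thus "fin (linext f v)"
    unfolding linext_def vsum_eq using assms by (intro fin_sum) simp
qed

text \<open>No finiteness of \<open>x\<close> is required, since a sum over an infinite
  \<open>supp x\<close> is 0. Hence products are linear in the right argument for every left one,
  while linearity in the left argument asks for a finitely supported right one.\<close>

lemma lin_linext_arg:
  assumes "\<And>a. lin (T a)" shows "lin (\<lambda>y. linext (\<lambda>a. T a y) x)"
  unfolding linext_def vsum_eq using assms by (intro lin_sum_right lin_scal_right)

lemma lin_expand: assumes "lin T" "fin v" shows "T v = (\<Sum>a\<in>supp v. scal (v a) (T (bv a)))"
proof -
  have "T v = T (\<Sum>a\<in>supp v. scal (v a) (bv a))" using expand[OF assms(2)] by simp
  also have "\<dots> = (\<Sum>a\<in>supp v. scal (v a) (T (bv a)))"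
    by (subst lin_sum[OF assms(1)]) (simp_all add: lin_scal[OF assms(1)])
  finally show ?thesis .
qed

lemma lin_eqI:
  assumes "lin T" "lin R" "x \<in> fsupp_on A" "\<And>a. a \<in> A \<Longrightarrow> T (bv a) = R (bv a)"
  shows "T x = R x"
  unfolding lin_expand[OF assms(1) fin_fsupp_on[OF assms(3)]] lin_expand[OF assms(2) fin_fsupp_on[OF assms(3)]]
  using assms(3,4) by (intro sum.cong refl) (auto simp: fsupp_on_def)

lemma lin_memI:
  assumes "lin T" "fv.subspace K" "x \<in> fsupp_on A" "\<And>a. a \<in> A \<Longrightarrow> T (bv a) \<in> K"
  shows "T x \<in> K"
  unfolding lin_expand[OF assms(1) fin_fsupp_on[OF assms(3)]]
  using assms(2-4) by (intro fv.subspace_sum fv.subspace_scale) (auto simp: fsupp_on_def)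

lemma lin_span_memI:
  assumes T: "lin T" and K: "fv.subspace K" and B: "\<And>b. b \<in> B \<Longrightarrow> fin b" "\<And>b. b \<in> B \<Longrightarrow> T b \<in> K"
    and x: "x \<in> fv.span B"
  shows "T x \<in> K"
proof -
  \<comment> \<open>Finite support is carried along, because \<open>T\<close> is additive only on
    such vectors and the set must be a subspace.\<close>
  have "x \<in> {x. fin x \<and> T x \<in> K}"
  proof (rule subsetD[OF fv.span_minimal x])
    show "fv.subspace {x. fin x \<and> T x \<in> K}"
      using fv.subspace_add[OF K] fv.subspace_scale[OF K] fv.subspace_0[OF K]
      by (intro fv.subspaceI) (simp_all add: lin_0[OF T] lin_add[OF T] lin_scal[OF T])
  qed (use B in auto)
  thus ?thesis by simp
qed

section \<open>Tensors of finitely supported vectors\<close>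

lemma tens_apply: "tens v w p = v (fst p) * w (snd p)"
  by (simp add: tens_def case_prod_beta)

lemma tens_bv: "tens (bv a) (bv b) = bv (a, b)"
  by (auto simp: fun_eq_iff tens_apply bv_apply prod_eq_iff)

lemma tens3_bv: "tens3 (bv a) (bv b) (bv c) = bv (a, b, c)"
  by (auto simp: fun_eq_iff tens3_def bv_apply)

lemma fin_tens: "fin v \<Longrightarrow> fin w \<Longrightarrow> fin (tens v w)"
  unfolding fin_def by (rule finite_subset[of _ "supp v \<times> supp w"]) (auto simp: supp_def tens_apply)

lemma lin_tens_left: "fin w \<Longrightarrow> lin (\<lambda>v. tens v w)"
  and lin_tens_right: "fin w \<Longrightarrow> lin (tens w)"
  by (rule linI; simp add: fin_tens fun_eq_iff tens_apply scal_apply algebra_simps)+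

section \<open>The Hopf algebra structure on the quotient\<close>

lemma fin_inner: "fin y \<Longrightarrow> fin (linext (\<lambda>b. bv (dsum a b)) y)"
  by (rule lin_fin[OF lin_linext]) simp_all

lemma lin_mult_left: "fin y \<Longrightarrow> lin (\<lambda>x. mult x y)"
  unfolding Defs.mult_def by (rule lin_linext) (rule fin_inner)

lemma lin_mult_right: "lin (mult x)"
  unfolding Defs.mult_def by (rule lin_linext_arg) (rule lin_linext, simp)

lemma mult_bv [simp]: "mult (bv a) (bv b) = bv (dsum a b)"
  by (simp add: Defs.mult_def)

lemma fin_mult: "fin x \<Longrightarrow> fin y \<Longrightarrow> fin (mult x y)"
  by (rule lin_fin[OF lin_mult_right])

lemma fin_comult_b: "fin (comult_b D)"
  unfolding comult_b_def vsum_eq by (rule fin_sum) (simp add: tens_bv)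

lemma lin_comult: "lin comult"
  unfolding comult_def by (rule lin_linext) (rule fin_comult_b)

lemma comult_bv [simp]: "comult (bv D) = comult_b D"
  by (simp add: comult_def)

lemma comult_b_eq:
  "comult_b D = (\<Sum>E'\<in>Pow {..<fst D}. bv (restr E' D, restr ({..<fst D} - E') D))"
  by (simp add: comult_b_def vsum_eq tens_bv)

lemma lin_mtens: "lin mtens"
  unfolding mtens_def by (rule lin_linext) simp

lemma mtens_tens:
  assumes "fin x" "fin y" shows "mtens (tens x y) = mult x y"
proof -
  have *: "v \<in> fsupp_on UNIV" if "fin v" for v :: "ss \<Rightarrow> complex" using that by (simp add: fsupp_on_def fin_def)
  have "mtens (tens x (bv b)) = mult x (bv b)" for b
    by (rule lin_eqI[OF lin_comp[OF lin_tens_left lin_mtens] lin_mult_left *[OF assms(1)]])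
      (simp_all add: tens_bv mtens_def)
  thus ?thesis
    by (intro lin_eqI[OF lin_comp[OF lin_tens_right lin_mtens] lin_mult_right *[OF assms(2)]])
      (simp_all add: assms)
qed

text \<open>The four-term combination of an arbitrary function of the set system;
  \<open>four bv\<close> is the relation itself, and linear maps and finite sums can be moved
  through it.\<close>

definition four :: "(ss \<Rightarrow> 'b::ab_group_add) \<Rightarrow> nat \<Rightarrow> nat \<Rightarrow> ss \<Rightarrow> 'b" where
  "four g a b D = g D - g (exch a b D) - g (slide a b D) + g (exch a b (slide a b D))"

lemma four_term_rels_eq:
  "four_term_rels A = {four bv a b D | D a b. D \<in> A \<and> a < fst D \<and> b < fst D \<and> a \<noteq> b}"
  by (simp add: four_term_rels_def four_def vadd_eq vsub_eq)

lemma four_sum: "four (\<lambda>D. \<Sum>i\<in>I. g i D) a b D = (\<Sum>i\<in>I. four (g i) a b D)"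
  by (simp add: four_def sum.distrib sum_subtractf)

lemma four_uminus: "four (\<lambda>D. - g D) a b D = - four g a b D"
  by (simp add: four_def)

lemma four_lin:
  assumes "lin T" "\<And>D. fin (g D)" shows "four (\<lambda>D. T (g D)) a b D = T (four g a b D)"
  unfolding four_def using assms(2)
  by (simp only: lin_add[OF assms(1)] lin_diff[OF assms(1)] fin_add fin_diff)

text \<open>In the left antipode law on \<open>D\<close>, the summand with \<open>E'\<close> the
  whole ground set is the antipode of \<open>D\<close> times the unit. Solving for it leaves proper
  subsets, whose restrictions have smaller degree.\<close>

function antipode_b :: "ss \<Rightarrow> ss \<Rightarrow> complex" where
  "antipode_b D = (if fst D = 0 then unitv else
     - (\<Sum>E'\<in>Pow {..<fst D} - {{..<fst D}}.
         mult (antipode_b (restr E' D)) (bv (restr ({..<fst D} - E') D))))"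
  by pat_completeness (hypsubst, rule refl)
termination
proof (relation "measure fst")
  fix D :: ss and E' assume "E' \<in> Pow {..<fst D} - {{..<fst D}}"
  hence "E' \<subset> {..<fst D}" by blast
  from psubset_card_mono[OF _ this] show "(restr E' D, D) \<in> measure fst" by simp
qed simp

declare antipode_b.simps [simp del]

lemma bij_betw_image_permutes:
  assumes "\<sigma> permutes E"
  shows "bij_betw ((`) \<sigma>) (Pow E) (Pow E)" "bij_betw ((`) \<sigma>) (Pow E - {E}) (Pow E - {E})"
proof -
  show *: "bij_betw ((`) \<sigma>) (Pow E) (Pow E)"
    using permutes_imp_bij[OF assms] by (rule bij_betw_Pow)
  have "(`) \<sigma> ` (Pow E - {E}) = (`) \<sigma> ` Pow E - (`) \<sigma> ` {E}"
    using * by (intro inj_on_image_set_diff[of _ "Pow E"]) (auto simp: bij_betw_def)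
  also have "\<dots> = Pow E - {E}" using * permutes_image[OF assms] by (simp add: bij_betw_def)
  finally show "bij_betw ((`) \<sigma>) (Pow E - {E}) (Pow E - {E})"
    using inj_on_subset[of "(`) \<sigma>" "Pow E" "Pow E - {E}"] * by (simp add: bij_betw_def Diff_subset)
qed

lemma bij_betw_complement: "bij_betw (\<lambda>X. E - X) (Pow E) (Pow E)"
  by (rule bij_betw_byWitness[of _ "\<lambda>X. E - X"]) auto

text \<open>The closure properties common to all binary and to even binary delta-matroids; the Hopf
  structure is derived from them alone.\<close>

locale dm_class =
  fixes A :: "ss set"
  assumes binary: "D \<in> A \<Longrightarrow> binary_dm D"
    and unit_in: "unit_ss \<in> A"
    and dsum_in: "D \<in> A \<Longrightarrow> D' \<in> A \<Longrightarrow> dsum D D' \<in> A"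
    and restr_in: "D \<in> A \<Longrightarrow> E' \<subseteq> {..<fst D} \<Longrightarrow> restr E' D \<in> A"
    and slide_in: "D \<in> A \<Longrightarrow> a < fst D \<Longrightarrow> b < fst D \<Longrightarrow> a \<noteq> b \<Longrightarrow> slide a b D \<in> A"
    and exch_in: "D \<in> A \<Longrightarrow> a < fst D \<Longrightarrow> b < fst D \<Longrightarrow> a \<noteq> b \<Longrightarrow> exch a b D \<in> A"
begin

section \<open>The subspace of relations and its ideal property\<close>

abbreviation "V \<equiv> fsupp_on A"
definition "J = fv.span (iso_rels A \<union> four_term_rels A)"
definition "JT = fv.span ({tens j v | j v. j \<in> J \<and> v \<in> V} \<union> {tens v j | j v. j \<in> J \<and> v \<in> V})"

lemma subspace_V: "fv.subspace V" by (rule subspace_fsupp_on)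
lemma subspace_J: "fv.subspace J" unfolding J_def by (rule fv.subspace_span)
lemma subspace_JT: "fv.subspace JT" unfolding JT_def by (rule fv.subspace_span)

lemma iso_J: "D \<in> A \<Longrightarrow> D' \<in> A \<Longrightarrow> iso_ss D D' \<Longrightarrow> bv D - bv D' \<in> J"
  unfolding J_def iso_rels_def vsub_eq by (intro fv.span_base) blast

lemma four_J: "D \<in> A \<Longrightarrow> a < fst D \<Longrightarrow> b < fst D \<Longrightarrow> a \<noteq> b \<Longrightarrow> four bv a b D \<in> J"
  unfolding J_def four_term_rels_eq by (intro fv.span_base) blast

lemma four_V:
  assumes "D \<in> A" "a < fst D" "b < fst D" "a \<noteq> b" "\<And>D. D \<in> A \<Longrightarrow> g D \<in> V"
  shows "four g a b D \<in> V"
  unfolding four_def using assms(5)[OF assms(1)] assms(5)[OF slide_in[OF assms(1-4)]]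
    assms(5)[OF exch_in[OF assms(1-4)]] assms(5)[OF exch_in[OF slide_in[OF assms(1-4)]]] assms(2-4)
  by (intro fv.subspace_add[OF subspace_V] fv.subspace_diff[OF subspace_V]) simp_all

lemma J_subset_V: "J \<subseteq> V"
  unfolding J_def
proof (rule fv.span_minimal[OF _ subspace_V], intro subsetI)
  fix r assume "r \<in> iso_rels A \<union> four_term_rels A"
  thus "r \<in> V"
  proof
    assume "r \<in> iso_rels A"
    then obtain D D' where "D \<in> A" "D' \<in> A" "r = bv D - bv D'" unfolding iso_rels_def vsub_eq by blast
    thus ?thesis using fv.subspace_diff[OF subspace_V] by simp
  next
    assume "r \<in> four_term_rels A"
    then obtain D a b where "D \<in> A" "a < fst D" "b < fst D" "a \<noteq> b" "r = four bv a b D"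
      unfolding four_term_rels_eq by blast
    thus ?thesis using four_V[of D a b bv] by simp
  qed
qed

text \<open>Ideal property, coideal property, grading, counit and antipode are all checked through
  this rule on the two families of generators of \<open>J\<close>, with \<open>K\<close> the
  subspace to be hit.\<close>

lemma J_memI:
  assumes T: "lin T" and K: "fv.subspace K" and x: "x \<in> J"
    and iso: "\<And>D D'. D \<in> A \<Longrightarrow> D' \<in> A \<Longrightarrow> iso_ss D D' \<Longrightarrow> T (bv D) - T (bv D') \<in> K"
    and four: "\<And>D a b. D \<in> A \<Longrightarrow> a < fst D \<Longrightarrow> b < fst D \<Longrightarrow> a \<noteq> b \<Longrightarrow> four (\<lambda>D. T (bv D)) a b D \<in> K"
  shows "T x \<in> K"
proof (rule lin_span_memI[OF T K _ _ x[unfolded J_def]])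
  fix r assume r: "r \<in> iso_rels A \<union> four_term_rels A"
  thus "fin r" using J_subset_V fv.span_base unfolding J_def by (blast intro: fin_fsupp_on)
  from r show "T r \<in> K"
  proof
    assume "r \<in> iso_rels A"
    then obtain D D' where "D \<in> A" "D' \<in> A" "iso_ss D D'" "r = bv D - bv D'" unfolding iso_rels_def vsub_eq by blast
    thus ?thesis using iso[of D D'] by (simp only: lin_diff[OF T] fin_bv)
  next
    assume "r \<in> four_term_rels A"
    then obtain D a b where "D \<in> A" "a < fst D" "b < fst D" "a \<noteq> b" and r: "r = four bv a b D"
      unfolding four_term_rels_eq by blast
    have "four (\<lambda>D. T (bv D)) a b D \<in> K" by (rule four) fact+
    thus ?thesis unfolding four_lin[OF T fin_bv] r .
  qed
qed

lemma mult_V: assumes "x \<in> V" "y \<in> V" shows "mult x y \<in> V"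
proof -
  have "mult x (bv b) \<in> V" if "b \<in> A" for b
    by (rule lin_memI[OF lin_mult_left subspace_V assms(1)]) (use that dsum_in in simp_all)
  thus ?thesis by (intro lin_memI[OF lin_mult_right subspace_V assms(2)])
qed

lemma mult_commute_J: assumes "x \<in> V" "y \<in> V" shows "mult x y - mult y x \<in> J"
proof -
  have "mult x (bv b) - mult (bv b) x \<in> J" if b: "b \<in> A" for b
  proof (rule lin_memI[OF lin_minus[OF lin_mult_left lin_mult_right] subspace_J assms(1)])
    fix a assume a: "a \<in> A"
    show "mult (bv a) (bv b) - mult (bv b) (bv a) \<in> J"
      unfolding mult_bv using a b dsum_in binary_dm_wf[OF binary] by (intro iso_J iso_dsum_commute) simp_all
  qed simp
  thus ?thesis
    by (intro lin_memI[OF lin_minus[OF lin_mult_right lin_mult_left] subspace_J assms(2)])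
      (simp_all only: fin_fsupp_on[OF assms(1)])
qed

lemma four_dsum:
  assumes "D \<in> A" "X \<in> A" "a < fst D" "b < fst D" "a \<noteq> b"
  shows "four (\<lambda>D. bv (dsum D X)) a b D = four bv a b (dsum D X)"
proof -
  note s = slide_in[OF assms(1,3-5)]
  note e = exch_in[OF assms(1,3-5)]
  have se: "exch a b (slide a b D) \<in> A" by (rule exch_in[OF s]) (use assms in simp_all)
  note wf = binary_dm_wf[OF binary]
  have "slide a b (dsum D X) = dsum (slide a b D) X"
    by (rule slide_dsum) (use assms s wf in simp_all)
  moreover have "exch a b (dsum D X) = dsum (exch a b D) X"
    by (rule exch_dsum) (use assms e wf in simp_all)
  moreover have "exch a b (dsum (slide a b D) X) = dsum (exch a b (slide a b D)) X"
    by (rule exch_dsum) (use assms s se wf in simp_all)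
  ultimately show ?thesis by (simp only: four_def)
qed

lemma mult_J_left: assumes "j \<in> J" "x \<in> V" shows "mult j x \<in> J"
proof -
  have "mult j (bv X) \<in> J" if X: "X \<in> A" for X
  proof (rule J_memI[OF lin_mult_left[OF fin_bv] subspace_J assms(1)])
    fix D D' assume "D \<in> A" "D' \<in> A" "iso_ss D D'"
    thus "mult (bv D) (bv X) - mult (bv D') (bv X) \<in> J"
      unfolding mult_bv using X dsum_in by (intro iso_J iso_dsum) simp_all
  next
    fix D a b assume "D \<in> A" "a < fst D" "b < fst D" "a \<noteq> b"
    thus "four (\<lambda>D. mult (bv D) (bv X)) a b D \<in> J"
      unfolding mult_bv using X dsum_in by (subst four_dsum) (simp_all add: four_J)
  qed
  thus ?thesis by (intro lin_memI[OF lin_mult_right subspace_J assms(2)])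
qed

lemma mult_J_right: assumes "j \<in> J" "x \<in> V" shows "mult x j \<in> J"
proof -
  have "mult x j = mult j x - (mult j x - mult x j)" by simp
  moreover have "mult j x - mult x j \<in> J"
    using assms J_subset_V by (intro mult_commute_J) auto
  ultimately show ?thesis
    using fv.subspace_diff[OF subspace_J mult_J_left[OF assms]] by metis
qed

text \<open>The coproduct and the recursive part of the antipode are both sums over \<open>E'\<close> of terms
  \<open>\<beta> (f (D|E')) (D|(E - E'))\<close> with \<open>\<beta>\<close> bilinear; compatibility with the relations is checked
  term by term.\<close>

definition cterm :: "((ss \<Rightarrow> complex) \<Rightarrow> (ss \<Rightarrow> complex) \<Rightarrow> 'b \<Rightarrow> complex) \<Rightarrow> (ss \<Rightarrow> ss \<Rightarrow> complex)
    \<Rightarrow> nat set \<Rightarrow> ss \<Rightarrow> 'b \<Rightarrow> complex" where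
  "cterm \<beta> f E' D = \<beta> (f (restr E' D)) (bv (restr ({..<fst D} - E') D))"

text \<open>One factor is replaced at a time, with \<sigma> carrying both \<open>E'\<close> and its
  complement. The last hypothesis is an isomorphism relation when \<open>f\<close> is
  \<open>bv\<close>; for the antipode it is the induction hypothesis.\<close>

lemma cterm_iso:
  assumes K: "fv.subspace K" and lin1: "\<And>y. fin y \<Longrightarrow> lin (\<lambda>x. \<beta> x y)" and lin2: "\<And>x. fin x \<Longrightarrow> lin (\<beta> x)"
    and J1: "\<And>j y. j \<in> J \<Longrightarrow> y \<in> V \<Longrightarrow> \<beta> j y \<in> K" and J2: "\<And>j y. j \<in> J \<Longrightarrow> y \<in> V \<Longrightarrow> \<beta> y j \<in> K"
    and f: "\<And>D. D \<in> A \<Longrightarrow> f D \<in> V"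
    and D: "D \<in> A" "D' \<in> A" "fst D' = fst D" "\<sigma> permutes {..<fst D}" "snd D' = (\<lambda>\<phi>. \<sigma> ` \<phi>) ` snd D"
      "E' \<subseteq> {..<fst D}"
    and fi: "f (restr E' D) - f (restr (\<sigma> ` E') D') \<in> J"
  shows "cterm \<beta> f E' D - cterm \<beta> f (\<sigma> ` E') D' \<in> K"
proof -
  let ?n = "{..<fst D}"
  have im: "\<sigma> ` ?n = ?n" by (rule permutes_image[OF D(4)])
  have c: "?n - \<sigma> ` E' = \<sigma> ` (?n - E')"
    using image_set_diff[OF permutes_inj[OF D(4)], of ?n E'] im by simp
  have sub: "\<sigma> ` E' \<subseteq> {..<fst D'}" "\<sigma> ` (?n - E') \<subseteq> {..<fst D'}"
    using image_mono[OF D(6), of \<sigma>] image_mono[of "?n - E'" ?n \<sigma>] unfolding im D(3) by auto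
  let ?x = "f (restr E' D)" and ?x' = "f (restr (\<sigma> ` E') D')"
  let ?y = "bv (restr (?n - E') D)" and ?y' = "bv (restr (\<sigma> ` (?n - E')) D')"
  have V: "?x \<in> V" "?x' \<in> V" using f restr_in D(1,2,6) sub by simp_all
  have y: "restr (?n - E') D \<in> A" "restr (\<sigma> ` (?n - E')) D' \<in> A"
    using restr_in[OF D(1), of "?n - E'"] restr_in[OF D(2) sub(2)] by auto
  have yJ: "?y - ?y' \<in> J"
    by (rule iso_J[OF y restr_iso[OF binary[OF D(1)] D(3-5)]]) blast
  have "\<beta> ?x ?y - \<beta> ?x' ?y' = (\<beta> ?x ?y - \<beta> ?x' ?y) + (\<beta> ?x' ?y - \<beta> ?x' ?y')" by simp
  also have "\<beta> ?x ?y - \<beta> ?x' ?y = \<beta> (?x - ?x') ?y"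
    using fin_fsupp_on[OF V(1)] fin_fsupp_on[OF V(2)] by (simp only: lin_diff[OF lin1] fin_bv)
  also have "\<beta> ?x' ?y - \<beta> ?x' ?y' = \<beta> ?x' (?y - ?y')"
    using fin_fsupp_on[OF V(2)] by (simp only: lin_diff[OF lin2] fin_bv)
  also have "\<beta> (?x - ?x') ?y + \<beta> ?x' (?y - ?y') \<in> K"
    using J1[OF fi] J2[OF yJ] V y by (intro fv.subspace_add[OF K]) simp_all
  finally show ?thesis unfolding cterm_def D(3) c .
qed

text \<open>For fixed \<open>E'\<close> everything depends on how \<open>a\<close> and
  \<open>b\<close> are distributed between \<open>E'\<close> and its complement. As in the
  isomorphism case, the last hypothesis receives the induction hypothesis of the antipode.\<close>

lemma cterm_four:
  assumes K: "fv.subspace K" and lin1: "\<And>y. fin y \<Longrightarrow> lin (\<lambda>x. \<beta> x y)" and lin2: "\<And>x. fin x \<Longrightarrow> lin (\<beta> x)"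
    and J1: "\<And>j y. j \<in> J \<Longrightarrow> y \<in> V \<Longrightarrow> \<beta> j y \<in> K" and J2: "\<And>j y. j \<in> J \<Longrightarrow> y \<in> V \<Longrightarrow> \<beta> y j \<in> K"
    and f: "\<And>D. D \<in> A \<Longrightarrow> f D \<in> V"
    and D: "D \<in> A" "a < fst D" "b < fst D" "a \<noteq> b" and E': "E' \<subseteq> {..<fst D}"
    and ff: "a \<in> E' \<Longrightarrow> b \<in> E' \<Longrightarrow> four f (relabel E' a) (relabel E' b) (restr E' D) \<in> J"
  shows "four (cterm \<beta> f E') a b D \<in> K"
proof -
  let ?n = "{..<fst D}" and ?s = "slide a b D"
  have C: "?n - E' \<subseteq> ?n" by blast
  note bin = binary[OF D(1)]
  have s: "?s \<in> A" "binary_dm ?s" using slide_in[OF D] binary by auto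
  have es: "restr S (exch a b ?s) = restr S ?s" if "S \<subseteq> ?n" "\<not> (a \<in> S \<and> b \<in> S)" for S
    by (rule restr_exch_outside[OF s(2)]) (use that D in simp_all)
  have e: "restr S (exch a b D) = restr S D" if "S \<subseteq> ?n" "\<not> (a \<in> S \<and> b \<in> S)" for S
    by (rule restr_exch_outside[OF bin]) (use that D in simp_all)
  have o: "restr S ?s = restr S D" if "S \<subseteq> ?n" "a \<notin> S" "b \<notin> S" for S
    by (rule restr_slide_outside[OF bin]) (use that D in simp_all)
  have i: "four (\<lambda>D. g (restr S D)) a b D = four g (relabel S a) (relabel S b) (restr S D)"
    if "S \<subseteq> ?n" "a \<in> S" "b \<in> S" for g :: "ss \<Rightarrow> ss \<Rightarrow> complex" and S
    unfolding four_def using restr_slide[OF bin that D(4)] restr_exch[OF bin that D(4)]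
      restr_exch[OF s(2) _ that(2,3) D(4)] that(1) by simp
  have fV: "fin (f (restr S X))" if "X \<in> A" "S \<subseteq> {..<fst X}" for X S
    using fin_fsupp_on[OF f[OF restr_in[OF that]]] .
  note eA = exch_in[OF D]
  have seA: "exch a b ?s \<in> A" by (rule exch_in[OF s(1)]) (use D in simp_all)
  consider (both) "a \<in> E'" "b \<in> E'" | (none) "a \<notin> E'" "b \<notin> E'" | (mixed) "(a \<in> E') \<noteq> (b \<in> E')" by blast
  thus ?thesis
  proof cases
    case both
    \<comment> \<open>The complement contains neither \<open>a\<close> nor \<open>b\<close>, so the
      second factor is the same in all four terms and the relation acts on the first.\<close>
    let ?y = "bv (restr (?n - E') D)"
    have "four (cterm \<beta> f E') a b D = four (\<lambda>X. \<beta> (f (restr E' X)) ?y) a b D"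
      unfolding four_def cterm_def fst_ops using both o[OF C] e[OF C] es[OF C] by simp
    also have "\<dots> = \<beta> (four (\<lambda>X. f (restr E' X)) a b D) ?y"
      unfolding four_def using fV D(1) s(1) eA seA E'
      by (simp only: lin_add[OF lin1] lin_diff[OF lin1] fin_bv fin_add fin_diff fst_ops)
    also have "\<dots> = \<beta> (four f (relabel E' a) (relabel E' b) (restr E' D)) ?y"
      unfolding i[OF E' both] ..
    also have "\<dots> \<in> K" using ff[OF both] restr_in[OF D(1) C] by (intro J1) simp_all
    finally show ?thesis .
  next
    case none
    \<comment> \<open>The mirror image: the first factor is constant and the relation acts on the
      restriction to the complement, where it is a generator of \<open>J\<close>.\<close>
    have ab: "a \<in> ?n - E'" "b \<in> ?n - E'" using none D by auto
    have fin: "finite (?n - E')" by simp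
    let ?x = "f (restr E' D)" and ?C = "?n - E'"
    have "four (cterm \<beta> f E') a b D = four (\<lambda>X. \<beta> ?x (bv (restr ?C X))) a b D"
      unfolding four_def cterm_def fst_ops using none o[OF E'] e[OF E'] es[OF E'] by simp
    also have "\<dots> = \<beta> ?x (four (\<lambda>X. bv (restr ?C X)) a b D)"
      by (rule four_lin[OF lin2[OF fV[OF D(1) E']]]) simp
    also have "\<dots> = \<beta> ?x (four bv (relabel ?C a) (relabel ?C b) (restr ?C D))"
      unfolding i[OF C ab] ..
    also have "\<dots> \<in> K"
    proof (rule J2[OF four_J f[OF restr_in[OF D(1) E']]])
      show "relabel ?C a \<noteq> relabel ?C b" using inj_relabel[OF fin] ab D(4) by (auto dest: inj_onD)
    qed (use restr_in[OF D(1) C] relabel_less[OF fin] ab in simp_all)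
    finally show ?thesis .
  next
    case mixed
    \<comment> \<open>If \<open>a\<close> and \<open>b\<close> are separated, exchange is invisible
      on both sides of the tensor. The term of \<open>D\<close> cancels that of its exchange, and
      the term of the slide cancels that of the exchanged slide.\<close>
    have "four (cterm \<beta> f E') a b D = 0"
      unfolding four_def cterm_def fst_ops using mixed e[OF C] es[OF C] e[OF E'] es[OF E'] D by auto
    thus ?thesis using fv.subspace_0[OF K] by simp
  qed
qed

end

text \<open>The counit is a scalar; multiplying it by \<open>unitv\<close> turns it into a map
  between vector spaces of functions, to which the criteria for \<open>lin\<close> apply.\<close>

lemma lin_counit: "lin (\<lambda>x. scal (counit x) unitv)"
  by (rule linI) (simp_all add: counit_def unitv_def fin_scal fun_eq_iff scal_apply algebra_simps)

lemma fin_antipode_b: "fin (antipode_b D)"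
proof (induction D rule: antipode_b.induct)
  case (1 D)
  show ?case
  proof (cases "fst D = 0")
    case True thus ?thesis by (simp add: antipode_b.simps[of D] unitv_def)
  next
    case False
    thus ?thesis unfolding antipode_b.simps[of D] using 1
      by (simp only: if_False) (intro fin_uminus fin_sum fin_mult fin_bv, blast)
  qed
qed

lemma mult_unit_right: assumes "fin x" shows "mult x unitv = x"
proof (rule lin_eqI[OF lin_mult_left lin_id])
  show "x \<in> fsupp_on UNIV" using assms by (simp add: fsupp_on_def fin_def)
qed (simp_all add: unitv_def)

lemma mult_unit_left: assumes "fin x" shows "mult unitv x = x"
proof (rule lin_eqI[OF lin_mult_right lin_id])
  show "x \<in> fsupp_on UNIV" using assms by (simp add: fsupp_on_def fin_def)
qed (simp_all add: unitv_def)

lemma lin_id': "lin id"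
  by (rule linI) simp_all

definition antipode :: "(ss \<Rightarrow> complex) \<Rightarrow> ss \<Rightarrow> complex" where
  "antipode = linext antipode_b"

lemma lin_antipode: "lin antipode"
  unfolding antipode_def by (rule lin_linext) (rule fin_antipode_b)

lemma antipode_bv [simp]: "antipode (bv D) = antipode_b D"
  by (simp add: antipode_def)

section \<open>Linearity of the remaining structure maps\<close>

lemma lin_tmap:
  assumes "lin f" "lin g" shows "lin (tmap f g)"
  unfolding tmap_def by (rule lin_linext) (simp add: fin_tens lin_fin[OF assms(1)] lin_fin[OF assms(2)])

text \<open>The convolution product of \<open>f\<close> and \<open>g\<close> on a basis
  vector.\<close>

lemma mtens_tmap_comult:
  assumes f: "lin f" and g: "lin g"
  shows "mtens (tmap f g (comult (bv D))) =
    (\<Sum>E'\<in>Pow {..<fst D}. mult (f (bv (restr E' D))) (g (bv (restr ({..<fst D} - E') D))))"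
proof -
  have "mtens (tmap f g (bv (p, q))) = mult (f (bv p)) (g (bv q))" for p q
    by (simp add: tmap_def mtens_tens lin_fin[OF f] lin_fin[OF g])
  thus ?thesis unfolding comult_bv comult_b_eq
    by (subst lin_sum[OF lin_comp[OF lin_tmap[OF f g] lin_mtens]]) simp_all
qed

lemma lin_comult_l: "lin comult_l" and lin_comult_r: "lin comult_r"
  unfolding comult_l_def comult_r_def
  by (rule lin_linext, rule lin_fin[OF lin_linext fin_comult_b], simp add: tens3_bv)+

lemma lin_counit_l: "lin counit_l" and lin_counit_r: "lin counit_r"
  unfolding counit_l_def counit_r_def by (rule lin_linext, simp)+

lemma lin_tswap: "lin tswap"
proof (rule linI)
  fix v :: "'a \<times> 'a \<Rightarrow> complex" assume "fin v"
  have "supp (tswap v) \<subseteq> prod.swap ` supp v"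
  proof
    fix p assume "p \<in> supp (tswap v)"
    thus "p \<in> prod.swap ` supp v" by (cases p) (auto simp: supp_def tswap_def image_iff)
  qed
  from finite_subset[OF this] show "fin (tswap v)" using \<open>fin v\<close> by (simp add: fin_def)
qed (auto simp: tswap_def fun_eq_iff scal_apply)

lemma tswap_bv: "tswap (bv (a, b)) = bv (b, a)"
  by (auto simp: tswap_def bv_apply fun_eq_iff)

lemma lin_tmult_left: "fin t \<Longrightarrow> lin (\<lambda>s. tmult s t)"
  unfolding tmult_def by (rule lin_linext) (rule lin_fin[OF lin_linext], simp_all add: tens_bv)

lemma lin_tmult_right: "lin (tmult s)"
  unfolding tmult_def by (rule lin_linext_arg) (rule lin_linext, simp add: tens_bv)

lemma tmult_bv: "tmult (bv p) (bv q) = bv (dsum (fst p) (fst q), dsum (snd p) (snd q))"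
  by (simp add: tmult_def tens_bv)

lemma lin_hcomp: "lin (hcomp k)"
proof (rule linI)
  fix v :: "ss \<Rightarrow> complex" assume "fin v"
  have "supp (hcomp k v) \<subseteq> supp v" by (auto simp: supp_def hcomp_def)
  from finite_subset[OF this] show "fin (hcomp k v)" using \<open>fin v\<close> by (simp add: fin_def)
qed (auto simp: hcomp_def fun_eq_iff scal_apply)

lemma hcomp_bv: "hcomp k (bv D) = (if fst D = k then bv D else 0)"
  by (auto simp: hcomp_def bv_apply fun_eq_iff)

context dm_class
begin

text \<open>\<open>Q\<close> will be the family of all subsets for the coproduct and of the proper
  subsets for the antipode; both are permuted by \<sigma>.\<close>

lemma cterm_sum_iso:
  assumes K: "fv.subspace K" and lin1: "\<And>y. fin y \<Longrightarrow> lin (\<lambda>x. \<beta> x y)" and lin2: "\<And>x. fin x \<Longrightarrow> lin (\<beta> x)"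
    and J1: "\<And>j y. j \<in> J \<Longrightarrow> y \<in> V \<Longrightarrow> \<beta> j y \<in> K" and J2: "\<And>j y. j \<in> J \<Longrightarrow> y \<in> V \<Longrightarrow> \<beta> y j \<in> K"
    and f: "\<And>D. D \<in> A \<Longrightarrow> f D \<in> V"
    and D: "D \<in> A" "D' \<in> A" "fst D' = fst D" "\<sigma> permutes {..<fst D}" "snd D' = (\<lambda>\<phi>. \<sigma> ` \<phi>) ` snd D"
    and Q: "bij_betw ((`) \<sigma>) Q Q" "Q \<subseteq> Pow {..<fst D}"
    and fi: "\<And>E'. E' \<in> Q \<Longrightarrow> f (restr E' D) - f (restr (\<sigma> ` E') D') \<in> J"
  shows "(\<Sum>E'\<in>Q. cterm \<beta> f E' D) - (\<Sum>E'\<in>Q. cterm \<beta> f E' D') \<in> K"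
proof -
  have "(\<Sum>E'\<in>Q. cterm \<beta> f E' D') = (\<Sum>E'\<in>Q. cterm \<beta> f (\<sigma> ` E') D')"
    by (rule sum.reindex_bij_betw[OF Q(1), symmetric])
  hence "(\<Sum>E'\<in>Q. cterm \<beta> f E' D) - (\<Sum>E'\<in>Q. cterm \<beta> f E' D') =
      (\<Sum>E'\<in>Q. cterm \<beta> f E' D - cterm \<beta> f (\<sigma> ` E') D')" by (simp only: sum_subtractf)
  also have "\<dots> \<in> K"
    by (rule fv.subspace_sum[OF K], rule cterm_iso[OF K lin1 lin2 J1 J2 f D]) (use Q(2) fi in auto)
  finally show ?thesis .
qed

lemma cterm_sum_four:
  assumes K: "fv.subspace K" and lin1: "\<And>y. fin y \<Longrightarrow> lin (\<lambda>x. \<beta> x y)" and lin2: "\<And>x. fin x \<Longrightarrow> lin (\<beta> x)"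
    and J1: "\<And>j y. j \<in> J \<Longrightarrow> y \<in> V \<Longrightarrow> \<beta> j y \<in> K" and J2: "\<And>j y. j \<in> J \<Longrightarrow> y \<in> V \<Longrightarrow> \<beta> y j \<in> K"
    and f: "\<And>D. D \<in> A \<Longrightarrow> f D \<in> V"
    and D: "D \<in> A" "a < fst D" "b < fst D" "a \<noteq> b" and Q: "Q \<subseteq> Pow {..<fst D}"
    and ff: "\<And>E'. E' \<in> Q \<Longrightarrow> a \<in> E' \<Longrightarrow> b \<in> E' \<Longrightarrow> four f (relabel E' a) (relabel E' b) (restr E' D) \<in> J"
  shows "four (\<lambda>D. \<Sum>E'\<in>Q. cterm \<beta> f E' D) a b D \<in> K"
  unfolding four_sum
  by (rule fv.subspace_sum[OF K], rule cterm_four[OF K lin1 lin2 J1 J2 f D]) (use Q ff in auto)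

lemma tens_J_left: "j \<in> J \<Longrightarrow> y \<in> V \<Longrightarrow> tens j y \<in> JT"
  and tens_J_right: "j \<in> J \<Longrightarrow> y \<in> V \<Longrightarrow> tens y j \<in> JT"
  unfolding JT_def by (rule fv.span_base, blast)+

lemma iso_ssE:
  assumes "iso_ss D D'"
  obtains \<sigma> where "fst D' = fst D" "\<sigma> permutes {..<fst D}" "snd D' = (\<lambda>\<phi>. \<sigma> ` \<phi>) ` snd D"
  using assms unfolding iso_ss_def by metis

lemma restr_iso_J:
  assumes "D \<in> A" "D' \<in> A" "fst D' = fst D" "\<sigma> permutes {..<fst D}" "snd D' = (\<lambda>\<phi>. \<sigma> ` \<phi>) ` snd D"
    "E' \<subseteq> {..<fst D}"
  shows "iso_ss (restr E' D) (restr (\<sigma> ` E') D')" "restr E' D \<in> A" "restr (\<sigma> ` E') D' \<in> A"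
proof -
  show "iso_ss (restr E' D) (restr (\<sigma> ` E') D')" by (rule restr_iso[OF binary[OF assms(1)] assms(3-6)])
  show "restr E' D \<in> A" by (rule restr_in[OF assms(1,6)])
  have "\<sigma> ` E' \<subseteq> {..<fst D'}"
    using image_mono[OF assms(6), of \<sigma>] unfolding permutes_image[OF assms(4)] assms(3) .
  thus "restr (\<sigma> ` E') D' \<in> A" by (rule restr_in[OF assms(2)])
qed

lemma restr_four:
  assumes "D \<in> A" "E' \<subseteq> {..<fst D}" "a \<in> E'" "b \<in> E'" "a \<noteq> b"
  shows "relabel E' a < fst (restr E' D)" "relabel E' b < fst (restr E' D)" "relabel E' a \<noteq> relabel E' b"
proof -
  have fin: "finite E'" using assms(2) finite_subset by blast
  show "relabel E' a < fst (restr E' D)" "relabel E' b < fst (restr E' D)"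
    using relabel_less[OF fin] assms by simp_all
  show "relabel E' a \<noteq> relabel E' b" using inj_relabel[OF fin] assms by (auto dest: inj_onD)
qed

section \<open>The coideal property\<close>

lemma comult_b_cterm: "comult_b D = (\<Sum>E'\<in>Pow {..<fst D}. cterm tens bv E' D)"
  by (simp add: comult_b_def vsum_eq cterm_def)

lemma comult_J: assumes "j \<in> J" shows "comult j \<in> JT"
proof (rule J_memI[OF lin_comult subspace_JT assms])
  fix D D' assume D: "D \<in> A" "D' \<in> A" and "iso_ss D D'"
  then obtain \<sigma> where \<sigma>: "fst D' = fst D" "\<sigma> permutes {..<fst D}" "snd D' = (\<lambda>\<phi>. \<sigma> ` \<phi>) ` snd D"
    using iso_ssE by blast
  show "comult (bv D) - comult (bv D') \<in> JT"
    unfolding comult_bv comult_b_cterm \<sigma>(1)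
  proof (rule cterm_sum_iso[OF subspace_JT lin_tens_left lin_tens_right tens_J_left tens_J_right _ D \<sigma>
      bij_betw_image_permutes(1)[OF \<sigma>(2)] order_refl])
    fix E' assume "E' \<in> Pow {..<fst D}"
    thus "bv (restr E' D) - bv (restr (\<sigma> ` E') D') \<in> J"
      using restr_iso_J[OF D \<sigma>, of E'] by (intro iso_J) simp_all
  qed simp_all
next
  fix D a b assume D: "D \<in> A" "a < fst D" "b < fst D" "a \<noteq> b"
  have "four (\<lambda>D. comult (bv D)) a b D = four (\<lambda>X. \<Sum>E'\<in>Pow {..<fst D}. cterm tens bv E' X) a b D"
    by (simp only: four_def comult_bv comult_b_cterm fst_ops)
  also have "\<dots> \<in> JT"
  proof (rule cterm_sum_four[OF subspace_JT lin_tens_left lin_tens_right tens_J_left tens_J_right _ D order_refl])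
    fix E' assume "E' \<in> Pow {..<fst D}" "a \<in> E'" "b \<in> E'"
    thus "four bv (relabel E' a) (relabel E' b) (restr E' D) \<in> J"
      using restr_four[OF D(1), of E' a b] restr_in[OF D(1)] D(4) by (intro four_J) simp_all
  qed simp_all
  finally show "four (\<lambda>D. comult (bv D)) a b D \<in> JT" .
qed

section \<open>The antipode\<close>

lemma antipode_b_cterm:
  "fst D \<noteq> 0 \<Longrightarrow> antipode_b D = - (\<Sum>E'\<in>Pow {..<fst D} - {{..<fst D}}. cterm mult antipode_b E' D)"
  unfolding cterm_def by (subst antipode_b.simps) simp

lemma antipode_b_0: "fst D = 0 \<Longrightarrow> antipode_b D = unitv"
  by (simp add: antipode_b.simps[of D])

lemma unitv_V: "unitv \<in> V"
  by (simp add: unitv_def unit_in)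

lemma card_proper: "E' \<in> Pow {..<n} - {{..<n}} \<Longrightarrow> card E' < n" for n :: nat
  using psubset_card_mono[of "{..<n}" E'] by auto

lemma antipode_b_V: "D \<in> A \<Longrightarrow> antipode_b D \<in> V"
proof (induction "fst D" arbitrary: D rule: less_induct)
  case less
  show ?case
  proof (cases "fst D = 0")
    case True thus ?thesis by (simp add: antipode_b_0 unitv_V)
  next
    case False
    have "cterm mult antipode_b E' D \<in> V" if E': "E' \<in> Pow {..<fst D} - {{..<fst D}}" for E'
      unfolding cterm_def
    proof (rule mult_V)
      show "antipode_b (restr E' D) \<in> V"
        by (rule less.hyps) (use card_proper[OF E'] restr_in[OF less.prems] E' in auto)
      show "bv (restr ({..<fst D} - E') D) \<in> V" using restr_in[OF less.prems, of "{..<fst D} - E'"] by auto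
    qed
    thus ?thesis unfolding antipode_b_cterm[OF False]
      by (intro fv.subspace_neg[OF subspace_V] fv.subspace_sum[OF subspace_V])
  qed
qed

lemma antipode_b_iso: "D \<in> A \<Longrightarrow> D' \<in> A \<Longrightarrow> iso_ss D D' \<Longrightarrow> antipode_b D - antipode_b D' \<in> J"
proof (induction "fst D" arbitrary: D D' rule: less_induct)
  case less
  note D = less.prems(1,2)
  obtain \<sigma> where \<sigma>: "fst D' = fst D" "\<sigma> permutes {..<fst D}" "snd D' = (\<lambda>\<phi>. \<sigma> ` \<phi>) ` snd D"
    using iso_ssE[OF less.prems(3)] by blast
  show ?case
  proof (cases "fst D = 0")
    case True thus ?thesis using \<sigma>(1) fv.subspace_0[OF subspace_J] by (simp add: antipode_b_0)
  next
    case False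
    let ?Q = "Pow {..<fst D} - {{..<fst D}}"
    have "(\<Sum>E'\<in>?Q. cterm mult antipode_b E' D) - (\<Sum>E'\<in>?Q. cterm mult antipode_b E' D') \<in> J"
    proof (rule cterm_sum_iso[OF subspace_J lin_mult_left lin_mult_right mult_J_left mult_J_right
        antipode_b_V D \<sigma> bij_betw_image_permutes(2)[OF \<sigma>(2)]])
      fix E' assume E': "E' \<in> ?Q"
      thus "antipode_b (restr E' D) - antipode_b (restr (\<sigma> ` E') D') \<in> J"
        using restr_iso_J[OF D \<sigma>, of E'] card_proper[OF E'] by (intro less.hyps) auto
    qed auto
    from fv.subspace_neg[OF subspace_J this] show ?thesis
      using antipode_b_cterm[of D] antipode_b_cterm[of D'] False \<sigma>(1) by simp
  qed
qed

text \<open>The four systems of a relation share their ground set, so the recursion can be unfolded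
  in all of them with the same index set. The restriction of a relation to a proper subset
  containing \<open>a\<close> and \<open>b\<close> has smaller degree.\<close>

lemma antipode_b_four:
  "D \<in> A \<Longrightarrow> a < fst D \<Longrightarrow> b < fst D \<Longrightarrow> a \<noteq> b \<Longrightarrow> four antipode_b a b D \<in> J"
proof (induction "fst D" arbitrary: D a b rule: less_induct)
  case less
  note D = less.prems
  let ?Q = "Pow {..<fst D} - {{..<fst D}}"
  have nz: "fst D \<noteq> 0" using D by auto
  have "four antipode_b a b D = four (\<lambda>X. - (\<Sum>E'\<in>?Q. cterm mult antipode_b E' X)) a b D"
    unfolding four_def using nz by (simp add: antipode_b_cterm)
  also have "\<dots> = - four (\<lambda>X. \<Sum>E'\<in>?Q. cterm mult antipode_b E' X) a b D" by (rule four_uminus)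
  also have "\<dots> \<in> J"
  proof (rule fv.subspace_neg[OF subspace_J], rule cterm_sum_four[OF subspace_J lin_mult_left lin_mult_right
      mult_J_left mult_J_right antipode_b_V D])
    fix E' assume E': "E' \<in> ?Q" "a \<in> E'" "b \<in> E'"
    hence sub: "E' \<subseteq> {..<fst D}" by blast
    show "four antipode_b (relabel E' a) (relabel E' b) (restr E' D) \<in> J"
      using restr_four[OF D(1) sub E'(2,3) D(4)] card_proper[OF E'(1)] restr_in[OF D(1) sub]
      by (intro less.hyps) simp_all
  qed auto
  finally show ?case .
qed

lemma antipode_V: assumes "x \<in> V" shows "antipode x \<in> V"
  by (rule lin_memI[OF lin_antipode subspace_V assms]) (unfold antipode_bv, erule antipode_b_V)

lemma antipode_J: "j \<in> J \<Longrightarrow> antipode j \<in> J"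
  by (rule J_memI[OF lin_antipode subspace_J]) (simp_all add: antipode_b_iso antipode_b_four)

lemma antipode_conv:
  assumes D: "D \<in> A"
  shows "(\<Sum>E'\<in>Pow {..<fst D}. cterm mult antipode_b E' D) = scal (counit (bv D)) unitv"
proof (cases "fst D = 0")
  case True
  hence "D = unit_ss" using binary_dm_0 binary[OF D] by blast
  moreover have "restr {} unit_ss = unit_ss" by (rule restr_empty[OF binary[OF unit_in]])
  ultimately show ?thesis
    by (simp add: cterm_def antipode_b_0 mult_unit_right unitv_def counit_def bv_apply scal_apply fun_eq_iff)
next
  case False
  have "D \<noteq> unit_ss" using False by auto
  hence z: "scal (counit (bv D)) unitv = 0" by (simp add: counit_def bv_apply)
  \<comment> \<open>The summand of the whole ground set is \<open>antipode_b D\<close> times the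
    unit, and by the recursion the remaining ones add up to its negative.\<close>
  have "(\<Sum>E'\<in>Pow {..<fst D}. cterm mult antipode_b E' D) = cterm mult antipode_b {..<fst D} D
      + (\<Sum>E'\<in>Pow {..<fst D} - {{..<fst D}}. cterm mult antipode_b E' D)"
    by (rule sum.remove) simp_all
  also have "(\<Sum>E'\<in>Pow {..<fst D} - {{..<fst D}}. cterm mult antipode_b E' D) = - antipode_b D"
    using antipode_b_cterm[OF False] by simp
  also have "cterm mult antipode_b {..<fst D} D = antipode_b D"
    using mult_unit_right[OF fin_antipode_b, of D]
    by (simp add: cterm_def restr_full[OF binary[OF D]] restr_empty[OF binary[OF D]] unitv_def)
  finally show ?thesis unfolding z by (simp only: right_minus)
qed

lemma antipode_left:
  assumes "x \<in> V" shows "mtens (tmap antipode id (comult x)) = scal (counit x) unitv"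
proof (rule lin_eqI[OF lin_comp[OF lin_comult lin_comp[OF lin_tmap[OF lin_antipode lin_id'] lin_mtens]] lin_counit assms])
  fix D assume D: "D \<in> A"
  show "mtens (tmap antipode id (comult (bv D))) = scal (counit (bv D)) unitv"
    unfolding mtens_tmap_comult[OF lin_antipode lin_id'] antipode_conv[OF D, symmetric]
    by (simp add: cterm_def)
qed

text \<open>Passing to complements in the left law exchanges the two arguments, but also the order
  of the product. Restoring the order uses commutativity, so the right law is obtained modulo
  \<open>J\<close>.\<close>

lemma antipode_right:
  assumes "x \<in> V" shows "mtens (tmap id antipode (comult x)) - scal (counit x) unitv \<in> J"
proof (rule lin_memI[OF lin_minus[OF lin_comp[OF lin_comult lin_comp[OF lin_tmap[OF lin_id' lin_antipode] lin_mtens]] lin_counit] subspace_J assms])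
  fix D assume D: "D \<in> A"
  let ?n = "{..<fst D}"
  have "(\<Sum>E'\<in>Pow ?n. cterm mult antipode_b E' D) = (\<Sum>E'\<in>Pow ?n. cterm mult antipode_b (?n - E') D)"
    by (rule sum.reindex_bij_betw[OF bij_betw_complement, symmetric])
  hence "mtens (tmap id antipode (comult (bv D))) - scal (counit (bv D)) unitv =
      (\<Sum>E'\<in>Pow ?n. mult (bv (restr E' D)) (antipode_b (restr (?n - E') D)) - cterm mult antipode_b (?n - E') D)"
    unfolding mtens_tmap_comult[OF lin_id' lin_antipode] antipode_conv[OF D, symmetric]
    by (simp add: sum_subtractf)
  also have "\<dots> \<in> J"
  proof (rule fv.subspace_sum[OF subspace_J])
    fix E' assume E': "E' \<in> Pow ?n"
    hence "?n - (?n - E') = E'" by blast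
    moreover have "bv (restr E' D) \<in> V" "antipode_b (restr (?n - E') D) \<in> V"
      using E' restr_in[OF D] by (simp_all add: antipode_b_V Diff_subset)
    ultimately show "mult (bv (restr E' D)) (antipode_b (restr (?n - E') D)) - cterm mult antipode_b (?n - E') D \<in> J"
      unfolding cterm_def using mult_commute_J by simp
  qed
  finally show "mtens (tmap id antipode (comult (bv D))) - scal (counit (bv D)) unitv \<in> J" .
qed

section \<open>Algebra and coalgebra laws holding exactly\<close>

lemma mult_assoc: assumes "x \<in> V" "y \<in> V" "z \<in> V" shows "mult (mult x y) z = mult x (mult y z)"
proof -
  note f = fin_fsupp_on[OF assms(1)] fin_fsupp_on[OF assms(2)] fin_fsupp_on[OF assms(3)]
  have 1: "mult (mult (bv a) (bv b)) z = mult (bv a) (mult (bv b) z)" for a b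
    by (rule lin_eqI[OF lin_mult_right lin_comp[OF lin_mult_right lin_mult_right] assms(3)]) (simp add: dsum_assoc)
  have 2: "mult (mult (bv a) y) z = mult (bv a) (mult y z)" for a
    by (rule lin_eqI[OF lin_comp[OF lin_mult_right lin_mult_left[OF f(3)]] lin_comp[OF lin_mult_left[OF f(3)] lin_mult_right] assms(2)])
      (rule 1)
  show ?thesis
    by (rule lin_eqI[OF lin_comp[OF lin_mult_left[OF f(2)] lin_mult_left[OF f(3)]] lin_mult_left[OF fin_mult[OF f(2,3)]] assms(1)])
      (rule 2)
qed

lemma comult_b_restr:
  assumes D: "D \<in> A" and E': "E' \<subseteq> {..<fst D}"
  shows "comult_b (restr E' D) = (\<Sum>T\<in>Pow E'. bv (restr T D, restr (E' - T) D))"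
proof -
  have fin: "finite E'" using E' finite_subset by blast
  have bij: "bij_betw ((`) (relabel E')) (Pow E') (Pow {..<card E'})"
    using bij_relabel[OF fin] by (rule bij_betw_Pow)
  have "comult_b (restr E' D) =
      (\<Sum>T\<in>Pow E'. bv (restr (relabel E' ` T) (restr E' D), restr ({..<card E'} - relabel E' ` T) (restr E' D)))"
    unfolding comult_b_eq fst_ops by (rule sum.reindex_bij_betw[OF bij, symmetric])
  also have "\<dots> = (\<Sum>T\<in>Pow E'. bv (restr T D, restr (E' - T) D))"
  proof (intro sum.cong refl)
    fix T assume T: "T \<in> Pow E'"
    hence c: "{..<card E'} - relabel E' ` T = relabel E' ` (E' - T)"
      using inj_on_image_set_diff[OF inj_relabel[OF fin], of E' T] relabel_image[OF fin] by simp
    have "restr (relabel E' ` T) (restr E' D) = restr T D"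
      "restr (relabel E' ` (E' - T)) (restr E' D) = restr (E' - T) D"
      using T by (auto intro!: restr_restr[OF binary[OF D] E'])
    thus "bv (restr (relabel E' ` T) (restr E' D), restr ({..<card E'} - relabel E' ` T) (restr E' D))
        = bv (restr T D, restr (E' - T) D)" unfolding c by simp
  qed
  finally show ?thesis .
qed

lemma comult_l_b:
  assumes D: "D \<in> A"
  shows "comult_l (comult_b D) = (\<Sum>E'\<in>Pow {..<fst D}. \<Sum>T\<in>Pow E'.
    bv (restr T D, restr (E' - T) D, restr ({..<fst D} - E') D))"
proof -
  have key: "comult_l (bv (restr E' D, q)) = (\<Sum>T\<in>Pow E'. bv (restr T D, restr (E' - T) D, q))"
    if E': "E' \<subseteq> {..<fst D}" for E' q
  proof -
    have "comult_l (bv (restr E' D, q)) = linext (\<lambda>p. tens3 (bv (fst p)) (bv (snd p)) (bv q)) (comult_b (restr E' D))"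
      by (simp add: comult_l_def)
    also have "\<dots> = (\<Sum>T\<in>Pow E'. bv (restr T D, restr (E' - T) D, q))"
      unfolding comult_b_restr[OF D E'] by (subst lin_sum[OF lin_linext]) (simp_all add: tens3_bv)
    finally show ?thesis .
  qed
  have "comult_l (comult_b D) = (\<Sum>E'\<in>Pow {..<fst D}. comult_l (bv (restr E' D, restr ({..<fst D} - E') D)))"
    unfolding comult_b_eq by (rule lin_sum[OF lin_comult_l]) simp
  thus ?thesis by (simp only:) (intro sum.cong refl key, blast)
qed

lemma comult_r_b:
  assumes D: "D \<in> A"
  shows "comult_r (comult_b D) = (\<Sum>E'\<in>Pow {..<fst D}. \<Sum>T\<in>Pow ({..<fst D} - E').
    bv (restr E' D, restr T D, restr ({..<fst D} - E' - T) D))"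
proof -
  have key: "comult_r (bv (q, restr E' D)) = (\<Sum>T\<in>Pow E'. bv (q, restr T D, restr (E' - T) D))"
    if E': "E' \<subseteq> {..<fst D}" for E' q
  proof -
    have "comult_r (bv (q, restr E' D)) = linext (\<lambda>p. tens3 (bv q) (bv (fst p)) (bv (snd p))) (comult_b (restr E' D))"
      by (simp add: comult_r_def)
    also have "\<dots> = (\<Sum>T\<in>Pow E'. bv (q, restr T D, restr (E' - T) D))"
      unfolding comult_b_restr[OF D E'] by (subst lin_sum[OF lin_linext]) (simp_all add: tens3_bv)
    finally show ?thesis .
  qed
  have "comult_r (comult_b D) = (\<Sum>E'\<in>Pow {..<fst D}. comult_r (bv (restr E' D, restr ({..<fst D} - E') D)))"
    unfolding comult_b_eq by (rule lin_sum[OF lin_comult_r]) simp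
  thus ?thesis by (simp only:) (intro sum.cong refl key, blast)
qed

lemma coassoc: assumes "x \<in> V" shows "comult_l (comult x) = comult_r (comult x)"
proof (rule lin_eqI[OF lin_comp[OF lin_comult lin_comult_l] lin_comp[OF lin_comult lin_comult_r] assms])
  fix D assume D: "D \<in> A"
  let ?n = "{..<fst D}"
  have f1: "\<forall>E'\<in>Pow ?n. finite (Pow E')" by (auto intro: finite_subset)
  have f: "finite (Pow ?n)" and f2: "\<forall>E'\<in>Pow ?n. finite (Pow (?n - E'))" by simp_all
  have "(\<Sum>(E', T)\<in>(SIGMA E':Pow ?n. Pow E'). bv (restr T D, restr (E' - T) D, restr (?n - E') D))
      = (\<Sum>(E', T)\<in>(SIGMA E':Pow ?n. Pow (?n - E')). bv (restr E' D, restr T D, restr (?n - E' - T) D))"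
  \<comment> \<open>Both sums run over the ordered partitions of the ground set into three blocks:
    T, E' - T and the rest on the left, E', T and the rest on the right.\<close>
  proof (rule sum.reindex_bij_witness[of _ "\<lambda>(E', T). (E' \<union> T, E')" "\<lambda>(E', T). (T, E' - T)"])
    fix p assume "p \<in> (SIGMA E':Pow ?n. Pow E')"
    then obtain E' T where p: "p = (E', T)" "E' \<subseteq> ?n" "T \<subseteq> E'" by blast
    have "?n - T - (E' - T) = ?n - E'" using p by blast
    thus "(case case p of (E', T) \<Rightarrow> (T, E' - T) of (E', T) \<Rightarrow> bv (restr E' D, restr T D, restr (?n - E' - T) D))
       = (case p of (E', T) \<Rightarrow> bv (restr T D, restr (E' - T) D, restr (?n - E') D))" by (simp add: p(1))
  qed auto
  thus "comult_l (comult (bv D)) = comult_r (comult (bv D))"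
    unfolding comult_bv comult_l_b[OF D] comult_r_b[OF D] sum.Sigma[OF f f1] sum.Sigma[OF f f2] .
qed

lemma counit_l_comult: assumes "x \<in> V" shows "counit_l (comult x) = x"
proof (rule lin_eqI[OF lin_comp[OF lin_comult lin_counit_l] lin_id assms])
  fix D assume D: "D \<in> A"
  let ?n = "{..<fst D}"
  have "counit_l (comult (bv D)) = (\<Sum>E'\<in>Pow ?n. scal (counit (bv (restr E' D))) (bv (restr (?n - E') D)))"
    unfolding comult_bv comult_b_eq by (subst lin_sum[OF lin_counit_l]) (simp_all add: counit_l_def)
  \<comment> \<open>Only degree 0 is seen by the counit, so every nonempty \<open>E'\<close>
    contributes 0.\<close>
  also have "\<dots> = (\<Sum>E'\<in>{{}}. scal (counit (bv (restr E' D))) (bv (restr (?n - E') D)))"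
  proof (rule sum.mono_neutral_right)
    show "\<forall>E'\<in>Pow ?n - {{}}. scal (counit (bv (restr E' D))) (bv (restr (?n - E') D)) = 0"
    proof
      fix E' assume E': "E' \<in> Pow ?n - {{}}"
      hence "fst (restr E' D) \<noteq> fst unit_ss" using finite_subset[of E' ?n] by auto
      hence "restr E' D \<noteq> unit_ss" by metis
      thus "scal (counit (bv (restr E' D))) (bv (restr (?n - E') D)) = 0" by (simp add: counit_def bv_apply)
    qed
  qed auto
  also have "\<dots> = bv D"
    by (simp add: restr_empty[OF binary[OF D]] restr_full[OF binary[OF D]] counit_def bv_apply)
  finally show "counit_l (comult (bv D)) = bv D" .
qed

lemma cocomm: assumes "x \<in> V" shows "tswap (comult x) = comult x"
proof (rule lin_eqI[OF lin_comp[OF lin_comult lin_tswap] lin_comult assms])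
  fix D :: ss
  let ?n = "{..<fst D}"
  have "tswap (comult (bv D)) = (\<Sum>E'\<in>Pow ?n. bv (restr (?n - E') D, restr E' D))"
    unfolding comult_bv comult_b_eq by (subst lin_sum[OF lin_tswap]) (simp_all add: tswap_bv)
  also have "\<dots> = (\<Sum>E'\<in>Pow ?n. bv (restr (?n - (?n - E')) D, restr (?n - E') D))"
    by (rule sum.reindex_bij_betw[OF bij_betw_complement, symmetric])
  also have "\<dots> = comult (bv D)" unfolding comult_bv comult_b_eq
    by (intro sum.cong refl) (auto simp: double_diff)
  finally show "tswap (comult (bv D)) = comult (bv D)" .
qed

text \<open>The two counit maps differ by the swap of tensor factors, which fixes
  coproducts.\<close>

lemma counit_r_comult: assumes "x \<in> V" shows "counit_r (comult x) = x"
proof -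
  have "counit_r t = counit_l (tswap t)" if "fin t" for t
  proof (rule lin_eqI[OF lin_counit_r lin_comp[OF lin_tswap lin_counit_l], of _ UNIV])
    show "t \<in> fsupp_on UNIV" using that by (simp add: fsupp_on_def fin_def)
  qed (auto simp: counit_l_def counit_r_def tswap_bv)
  thus ?thesis using cocomm[OF assms] counit_l_comult[OF assms] lin_fin[OF lin_comult fin_fsupp_on[OF assms]] by simp
qed

lemma comult_b_dsum:
  assumes "a \<in> A" "b \<in> A" shows "comult_b (dsum a b) = tmult (comult_b a) (comult_b b)"
proof -
  let ?m = "{..<fst a}" and ?n = "{..<fst b}" and ?f = "\<lambda>x. x + fst a"
  \<comment> \<open>A subset of the concatenated ground set is a subset of the first block together
    with a shifted subset of the second.\<close>
  let ?j = "\<lambda>(E1, E2). E1 \<union> ?f ` E2"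
  have bij: "bij_betw ?j (Pow ?m \<times> Pow ?n) (Pow {..<fst (dsum a b)})"
  proof (rule bij_betw_byWitness[of _ "\<lambda>E. (E \<inter> ?m, {x. x + fst a \<in> E})"])
    show "\<forall>p\<in>Pow ?m \<times> Pow ?n. (?j p \<inter> ?m, {x. x + fst a \<in> ?j p}) = p" by auto
    show "\<forall>E\<in>Pow {..<fst (dsum a b)}. ?j (E \<inter> ?m, {x. x + fst a \<in> E}) = E"
    proof
      fix E
      have "x \<in> ?f ` {x. x + fst a \<in> E}" if "x \<in> E" "\<not> x < fst a" for x
        by (rule image_eqI[of _ _ "x - fst a"]) (use that in auto)
      thus "?j (E \<inter> ?m, {x. x + fst a \<in> E}) = E" by auto
    qed
  qed auto
  have "comult_b (dsum a b) = (\<Sum>p\<in>Pow ?m \<times> Pow ?n. bv (restr (?j p) (dsum a b), restr ({..<fst (dsum a b)} - ?j p) (dsum a b)))"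
    unfolding comult_b_eq by (rule sum.reindex_bij_betw[OF bij, symmetric])
  also have "\<dots> = (\<Sum>p\<in>Pow ?m \<times> Pow ?n. bv (dsum (restr (fst p) a) (restr (snd p) b), dsum (restr (?m - fst p) a) (restr (?n - snd p) b)))"
  proof (intro sum.cong refl)
    fix p assume "p \<in> Pow ?m \<times> Pow ?n"
    then obtain E1 E2 where p: "p = (E1, E2)" "E1 \<subseteq> ?m" "E2 \<subseteq> ?n" by auto
    have un: "{..<fst (dsum a b)} = ?m \<union> ?f ` ?n" unfolding shift_image by auto
    have c: "{..<fst (dsum a b)} - (E1 \<union> ?f ` E2) = (?m - E1) \<union> ?f ` (?n - E2)"
      unfolding un using p(2,3) by auto
    show "bv (restr (?j p) (dsum a b), restr ({..<fst (dsum a b)} - ?j p) (dsum a b)) =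
      bv (dsum (restr (fst p) a) (restr (snd p) b), dsum (restr (?m - fst p) a) (restr (?n - snd p) b))"
      unfolding p(1) prod.case fst_conv snd_conv c
      using restr_dsum[OF binary binary, OF assms p(2,3)]
        restr_dsum[OF binary binary, OF assms Diff_subset Diff_subset] by simp
  qed
  also have "\<dots> = (\<Sum>E1\<in>Pow ?m. \<Sum>E2\<in>Pow ?n. bv (dsum (restr E1 a) (restr E2 b), dsum (restr (?m - E1) a) (restr (?n - E2) b)))"
    by (simp add: sum.cartesian_product case_prod_beta)
  also have "\<dots> = (\<Sum>E1\<in>Pow ?m. tmult (bv (restr E1 a, restr (?m - E1) a)) (comult_b b))"
    unfolding comult_b_eq[of b] by (subst lin_sum[OF lin_tmult_right]) (simp_all add: tmult_bv)
  also have "\<dots> = tmult (comult_b a) (comult_b b)"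
    unfolding comult_b_eq[of a] by (subst lin_sum[OF lin_tmult_left[OF fin_comult_b]]) simp_all
  finally show ?thesis .
qed

lemma comult_mult: assumes "x \<in> V" "y \<in> V" shows "comult (mult x y) = tmult (comult x) (comult y)"
proof -
  note f = fin_fsupp_on[OF assms(2)]
  have "comult (mult (bv a) y) = tmult (comult (bv a)) (comult y)" if a: "a \<in> A" for a
    by (rule lin_eqI[OF lin_comp[OF lin_mult_right lin_comult] lin_comp[OF lin_comult lin_tmult_right] assms(2)])
      (simp add: comult_b_dsum[OF a])
  thus ?thesis
    by (rule lin_eqI[OF lin_comp[OF lin_mult_left[OF f] lin_comult]
       lin_comp[OF lin_comult lin_tmult_left[OF lin_fin[OF lin_comult f]]] assms(1)])
qed

lemma counit_mult: assumes "x \<in> V" "y \<in> V" shows "counit (mult x y) = counit x * counit y"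
proof -
  have scal: "scal (counit x * c) unitv = scal c (scal (counit x) unitv)" for x c by (simp add: mult.commute)
  have unit: "counit unitv = 1" by (simp add: counit_def unitv_def bv_apply)
  have b: "counit (bv (dsum a b)) = counit (bv a) * counit (bv b)" if "a \<in> A" "b \<in> A" for a b
  proof -
    have "dsum a b = unit_ss \<longleftrightarrow> a = unit_ss \<and> b = unit_ss"
    proof
      assume "dsum a b = unit_ss"
      hence "fst a + fst b = 0" by (metis fst_ops(4) fst_ops(6))
      thus "a = unit_ss \<and> b = unit_ss" using binary_dm_0 binary that by simp
    qed simp
    thus ?thesis by (auto simp: counit_def bv_apply)
  qed
  note f = fin_fsupp_on[OF assms(2)]
  have "scal (counit (mult (bv a) y)) unitv = scal (counit (bv a)) (scal (counit y) unitv)" if a: "a \<in> A" for a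
    by (rule lin_eqI[OF lin_comp[OF lin_mult_right lin_counit] lin_scal_right[OF lin_counit] assms(2)])
      (simp add: b[OF a])
  hence "scal (counit (mult x y)) unitv = scal (counit y) (scal (counit x) unitv)"
    by (intro lin_eqI[OF lin_comp[OF lin_mult_left[OF f] lin_counit] lin_scal_right[OF lin_counit] assms(1)])
      (simp add: mult.commute)
  \<comment> \<open>The scalar identity is recovered as the coefficient of \<open>unit_ss\<close>,
    which is 1 in \<open>unitv\<close>.\<close>
  from fun_cong[OF this, of unit_ss] show ?thesis
    by (simp add: scal_apply unitv_def bv_apply)
qed

section \<open>Grading and the assembly of the Hopf structure\<close>

lemma supp_comult_b:
  assumes "p \<in> supp (comult_b D)"
  obtains E' where "E' \<subseteq> {..<fst D}" "p = (restr E' D, restr ({..<fst D} - E') D)"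
proof -
  have "(\<Sum>E'\<in>Pow {..<fst D}. bv (restr E' D, restr ({..<fst D} - E') D) p) \<noteq> 0"
    using assms unfolding supp_def comult_b_eq sum_fun_apply by simp
  then obtain E' where "E' \<in> Pow {..<fst D}" "bv (restr E' D, restr ({..<fst D} - E') D) p \<noteq> 0"
    by (rule sum.not_neutral_contains_not_neutral)
  thus thesis using that by (simp add: bv_apply split: if_splits)
qed

lemma comult_V: assumes "x \<in> V" shows "comult x \<in> fsupp_on (A \<times> A)"
proof (rule lin_memI[OF lin_comult subspace_fsupp_on assms])
  fix D assume D: "D \<in> A"
  have "bv (restr E' D, restr ({..<fst D} - E') D) \<in> fsupp_on (A \<times> A)" if "E' \<in> Pow {..<fst D}" for E'
    using restr_in[OF D] that by (simp add: Diff_subset)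
  thus "comult (bv D) \<in> fsupp_on (A \<times> A)"
    unfolding comult_bv comult_b_eq by (intro fv.subspace_sum[OF subspace_fsupp_on])
qed

text \<open>Isomorphisms, slides and exchanges keep the size of the ground set, so every generator
  of \<open>J\<close> is homogeneous: its component in degree \<open>k\<close> is itself or
  0.\<close>

lemma hcomp_J: assumes "j \<in> J" shows "hcomp k j \<in> J"
proof (rule J_memI[OF lin_hcomp subspace_J assms])
  fix D D' assume "D \<in> A" "D' \<in> A" "iso_ss D D'"
  moreover from this have "fst D = fst D'" by (simp add: iso_ss_def)
  ultimately show "hcomp k (bv D) - hcomp k (bv D') \<in> J"
    using iso_J fv.subspace_0[OF subspace_J] by (simp add: hcomp_bv)
next
  fix D a b assume "D \<in> A" "a < fst D" "b < fst D" "a \<noteq> b"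
  from four_J[OF this] show "four (\<lambda>D. hcomp k (bv D)) a b D \<in> J"
    using fv.subspace_0[OF subspace_J] by (cases "fst D = k") (simp_all add: hcomp_bv four_def)
qed

lemma counit_J: assumes "j \<in> J" shows "counit j = 0"
proof -
  have "scal (counit j) unitv \<in> {0}"
  proof (rule J_memI[OF lin_counit _ assms])
    show "fv.subspace {0}" by (rule fv.subspace_single_0)
    fix D D' assume D: "D \<in> A" "D' \<in> A" "iso_ss D D'"
    hence "fst D = fst D'" by (simp add: iso_ss_def)
    hence "D = unit_ss \<longleftrightarrow> D' = unit_ss" using binary_dm_0[OF binary] D by (metis fst_ops(6))
    thus "scal (counit (bv D)) unitv - scal (counit (bv D')) unitv \<in> {0}" by (auto simp: counit_def bv_apply)
  next
    \<comment> \<open>A four-term relation needs an element in the ground set, hence lies in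
      positive degree, where the counit vanishes term by term.\<close>
    fix D :: ss and a b assume "a < fst D"
    hence "unit_ss \<noteq> X" if "fst X = fst D" for X :: ss using that by auto
    hence "counit (bv X) = 0" if "fst X = fst D" for X :: ss using that by (simp add: counit_def bv_apply)
    thus "four (\<lambda>D. scal (counit (bv D)) unitv) a b D \<in> {0}" by (simp add: four_def)
  qed
  hence "scal (counit j) unitv = 0" by (simp only: singleton_iff)
  from fun_cong[OF this, of unit_ss] show ?thesis by (simp add: scal_apply unitv_def bv_apply)
qed

lemma cspan_0: "0 \<in> cspan S"
  unfolding cspan_eq by (rule fv.span_zero)

lemma hopf_quotient: "hopf_quotient A (cspan (iso_rels A \<union> four_term_rels A))"
proof -
  have J: "cspan (iso_rels A \<union> four_term_rels A) = J" by (simp add: J_def cspan_eq)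
  have z: "0 \<in> J" by (rule fv.subspace_0[OF subspace_J])
  have JT: "cspan ({tens j v | j v. j \<in> J \<and> v \<in> V} \<union> {tens v j | j v. j \<in> J \<and> v \<in> V}) = JT"
    by (simp add: JT_def cspan_eq)
  have zT: "0 \<in> JT" by (rule fv.subspace_0[OF subspace_JT])
  have fin: "fin x" if "x \<in> V" for x using that by (rule fin_fsupp_on)
  have grading: "fst (fst p) + fst (snd p) = fst D" if p: "p \<in> supp (comult_b D)" for p D
  proof -
    obtain E' where "E' \<subseteq> {..<fst D}" "p = (restr E' D, restr ({..<fst D} - E') D)"
      using supp_comult_b[OF p] .
    thus ?thesis using card_Diff_subset[of E' "{..<fst D}"] card_mono[of "{..<fst D}" E'] finite_subset[of E' "{..<fst D}"] by simp
  qed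
  have unit: "comult unitv = tens unitv unitv"
    using restr_empty[OF binary[OF unit_in]] by (simp add: unitv_def comult_b_eq tens_bv)
  have "counit unitv = 1" by (simp add: counit_def unitv_def bv_apply)
  moreover have "\<exists>S. (\<forall>x\<in>V. \<forall>y\<in>V. S (vadd x y) = vadd (S x) (S y)) \<and>
         (\<forall>c. \<forall>x\<in>V. S (scal c x) = scal c (S x)) \<and>
         S ` V \<subseteq> V \<and> S ` J \<subseteq> J \<and>
         (\<forall>x\<in>V. vsub (mtens (tmap S id (comult x))) (scal (counit x) unitv) \<in> J) \<and>
         (\<forall>x\<in>V. vsub (mtens (tmap id S (comult x))) (scal (counit x) unitv) \<in> J)"
    by (intro exI[of _ antipode])
      (auto simp: vadd_eq vsub_eq lin_add[OF lin_antipode] lin_scal[OF lin_antipode] fin antipode_V antipode_J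
        antipode_left antipode_right z)
  moreover have "\<forall>a\<in>A. \<forall>p\<in>supp (comult_b a). fst (fst p) + fst (snd p) = fst a"
    using grading by blast
  ultimately show ?thesis
    unfolding hopf_quotient_def Let_def J JT vsub_eq
    by (simp add: unitv_V mult_V comult_V J_subset_V hcomp_J mult_J_left mult_J_right comult_J counit_J
        mult_commute_J counit_mult z zT mult_assoc mult_unit_left mult_unit_right fin coassoc
        counit_l_comult counit_r_comult cocomm comult_mult unit cspan_0 cspan_eq[of J]
        fv.span_eq_iff[THEN iffD2, OF subspace_J])
qed

end

section \<open>The two classes of delta-matroids\<close>

lemma dm_class_binary: "dm_class binary_dms"
  by unfold_locales
    (simp_all add: binary_dms_def binary_dm_unit binary_dm_dsum binary_dm_restr binary_dm_slide binary_dm_exch)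

lemma dm_class_even: "dm_class even_binary_dms"
proof
  fix D a b assume "D \<in> even_binary_dms" "a < fst D" "b < fst D" "a \<noteq> (b::nat)"
  \<comment> \<open>The parity argument for the exchange passes through the slide of the twisted
    system, which is well formed because twisting and sliding preserve binarity.\<close>
  moreover from this have "wf_ss (slide a b (twist {b} D))"
    by (intro binary_dm_wf binary_dm_slide binary_dm_twist) (simp_all add: even_binary_dms_def)
  ultimately show "slide a b D \<in> even_binary_dms" "exch a b D \<in> even_binary_dms"
    by (simp_all add: even_binary_dms_def binary_dm_slide binary_dm_exch even_slide even_exch binary_dm_wf)
qed (simp_all add: even_binary_dms_def binary_dm_unit even_unit binary_dm_dsum even_dsum binary_dm_wf
    binary_dm_restr even_restr)

theorem theorem4p5:
  shows "hopf_quotient binary_dms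
           (cspan (iso_rels binary_dms \<union> four_term_rels binary_dms))
       \<and> hopf_quotient even_binary_dms
           (cspan (iso_rels even_binary_dms \<union> four_term_rels even_binary_dms))"
  using dm_class.hopf_quotient[OF dm_class_binary] dm_class.hopf_quotient[OF dm_class_even] by blast

end
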